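(* Let $H$ be a dual-quasitriangular Hopf algebra with the calculus defined by a finite-dimensional right comodule $W$, i.e. $\Omega_0=\ker\epsilon/\ker(\rho_W\circ\mathcal Q)$ with $\rho_W\circ\mathcal Q:\Omega_0\cong\mathrm{End}(W)$. Then $H$ is framed by $V=\mathrm{End}(W)=W\otimes W^\circ$ and $e=e_{MC}\circ(\rho_W\circ\mathcal Q)^{-1}:V\to\Omega^1(H)$, and for all $h\in H$, $\phi\in\mathrm{End}(W)$, $$e(\phi)h=h_{(1)}\,e\big(\rho_-(Sh_{(2)})\circ\phi\circ\rho_+(h_{(3)})\big),\qquad \mathrm dh=h_{(1)}\,e\big(\rho_W\circ\mathcal Q(h_{(2)})\big)-h\,e(\mathrm{id}).$$ Moreover, $W$ is a spinor space with equivariant map $\gamma:V\otimes W\to W$ provided by the identity $V=\mathrm{End}(W)$ (evaluation), and for any gauge field $A:\Omega_0\to\Omega^1(H)$ the Dirac operator is $$(D\!\!\!\!/\psi)^\alpha=\partial^\alpha{}_\beta\psi^\beta-\psi^\gamma A\big(\tilde\pi_{\Omega_0}S^{-1}\rho^\beta{}_\gamma\big)^\alpha{}_\beta,$$ where $\psi=\psi^\alpha\otimes e_\alpha$ with spinor components $\psi^\alpha\in H$.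
   Context: Everything is over a field $k$; $H$ is a Hopf algebra with invertible antipode $S$. A dual-quasitriangular structure is a convolution-invertible $\mathcal R:H\otimes H\to k$ with $\mathcal R(ab\otimes c)=\mathcal R(a\otimes c_{(1)})\mathcal R(b\otimes c_{(2)})$, $\mathcal R(a\otimes bc)=\mathcal R(a_{(1)}\otimes c)\mathcal R(a_{(2)}\otimes b)$ and $b_{(1)}a_{(1)}\mathcal R(a_{(2)}\otimes b_{(2)})=\mathcal R(a_{(1)}\otimes b_{(1)})a_{(2)}b_{(2)}$. $\mathcal Q:H\to H^*$ is $\langle\mathcal Q(h),g\rangle=\mathcal R(g_{(1)}\otimes h_{(1)})\mathcal R(h_{(2)}\otimes g_{(2)})$. $W$ is a finite-dimensional right comodule with basis $\{e_\alpha\}$ and coaction $e_\alpha\mapsto e_\beta\otimes\rho^\beta{}_\alpha$, $\rho^\beta{}_\alpha\in H$; $\rho_W$ is the corresponding left action of $H^*$, $\rho_W(x)^\alpha{}_\beta=\langle x,\rho^\alpha{}_\beta\rangle$. Set $\rho_+(h)^\alpha{}_\beta=\mathcal R(h\otimes\rho^\alpha{}_\beta)$, $\rho_-(h)^\alpha{}_\beta=\mathcal R^{-1}(\rho^\alpha{}_\beta\otimes h)$. It is assumed that $\rho_W\circ\mathcal Q:\ker\epsilon\to\mathrm{End}(W)$ is surjective. $Q_H=\ker\epsilon\cap\ker(\rho_W\circ\mathcal Q)$ is a right ideal stable under $\mathrm{Ad}(h)=h_{(2)}\otimes(Sh_{(1)})h_{(3)}$, and $\Omega_0=\ker\epsilon/Q_H$.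 $\Omega^1(H)$ is the quotient of $\ker(H\otimes H\to H)$, $\mathrm dh=1\otimes h-h\otimes1$, by the subspace corresponding to $H\otimes Q_H$ under $h\otimes g\mapsto hg_{(1)}\otimes g_{(2)}$; $e_{MC}(v)$ is the class of $S\tilde v_{(1)}\otimes\tilde v_{(2)}$, $\tilde v\in\ker\epsilon$ lifting $v\in\Omega_0$. $\tilde\pi_{\Omega_0}:H\to\Omega_0$ is $h\mapsto h-\epsilon(h)1$ followed by the quotient. $W^\circ$ is the predual of $W$ with dual basis $\{f^\alpha\}$ and right coaction $f^\alpha\mapsto f^\beta\otimes S\rho^\alpha{}_\beta$; $\phi\in\mathrm{End}(W)$ is $\phi^\alpha{}_\beta e_\alpha\otimes f^\beta$, so $V$ has coaction $e_\alpha\otimes f^\beta\mapsto e_a\otimes f^b\otimes\rho^a{}_\alpha S\rho^\beta{}_b$. $H$ being framed by $(V,e)$ means that $V$ is a right $H$-comodule ($\rho_W\circ\mathcal Q$ intertwines the projected $\mathrm{Ad}$ on $\Omega_0$ with the coaction on $V$) and that $H\otimes V\to\Omega^1(H)$, $h\otimes v\mapsto h\,e(v)$, is an isomorphism. Components: $\mathrm dh=\partial^\alpha{}_\beta(h)\,e(e_\alpha\otimes f^\beta)$ and $A(v)=A(v)^\alpha{}_\beta\,e(e_\alpha\otimes f^\beta)$ with coefficients in $H$ on the left. $\gamma(e_\alpha\otimes f^\beta)w=\langle f^\beta,w\rangle e_\alpha$. In general, for a $V$-bein $e$ with basis $\{e_a\}$ of $V$, gauge field $A=A^ae(e_a)$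 and $\gamma_a=\gamma(e_a)\in\mathrm{End}(W)$, the Dirac operator on $\psi=\sum_i\psi_i\otimes\psi^i\in H\otimes W$ is $D\!\!\!\!/\psi=\sum_i(\partial^a\psi_i\otimes\gamma_a(\psi^i)-\psi_iA^a(\tilde\pi_{\Omega_0}S^{-1}(\psi^i{}_{[1]}))\otimes\gamma_a(\psi^i{}_{[0]}))$, where $w\mapsto w_{[0]}\otimes w_{[1]}$ is the coaction on $W$ and $\mathrm dh=(\partial^ah)e(e_a)$. *)

theory Defs
  imports "HOL.Vector_Spaces" "HOL-Library.Poly_Mapping" "HOL-Library.Function_Algebras"
begin

section \<open>Vector spaces with carriers, quotients and tensor products\<close>

text \<open>A vector space over the field \<open>'k\<close> is a linear subspace of an additive group type that
  carries a scalar multiplication.\<close>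

record ('k, 'v) vs =
  car :: "'v set"
  scl :: "'k \<Rightarrow> 'v \<Rightarrow> 'v"

definition vspace :: "('k::field, 'v::ab_group_add) vs \<Rightarrow> bool" where
  "vspace M \<longleftrightarrow> vector_space (scl M) \<and> module.subspace (scl M) (car M)"

definition vlin :: "('k::field, 'v::ab_group_add) vs \<Rightarrow> ('k, 'w::ab_group_add) vs \<Rightarrow> ('v \<Rightarrow> 'w) \<Rightarrow> bool"
  where
  "vlin M N f \<longleftrightarrow> f ` car M \<subseteq> car N
     \<and> (\<forall>x\<in>car M. \<forall>y\<in>car M. f (x + y) = f x + f y)
     \<and> (\<forall>c. \<forall>x\<in>car M. f (scl M c x) = scl N c (f x))"

definition viso :: "('k::field, 'v::ab_group_add) vs \<Rightarrow> ('k, 'w::ab_group_add) vs \<Rightarrow> ('v \<Rightarrow> 'w) \<Rightarrow> bool"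
  where "viso M N f \<longleftrightarrow> vlin M N f \<and> bij_betw f (car M) (car N)"

text \<open>Quotient by a subspace \<open>N\<close>: the class of \<open>x\<close> is encoded by a representative of the coset
  \<open>x + N\<close>, chosen linearly in \<open>x\<close> (equivalently, a complement of \<open>N\<close> is chosen).  Thus two vectors
  have the same class iff they differ by an element of \<open>N\<close>, classes are added and scaled as
  vectors, and a map that is constant on cosets descends to classes by evaluating it on the class
  itself; see \<open>cls_props\<close> below.\<close>

definition cls :: "('k::field \<Rightarrow> 'v::ab_group_add \<Rightarrow> 'v) \<Rightarrow> 'v set \<Rightarrow> 'v \<Rightarrow> 'v" where
  "cls s N = (SOME P. Vector_Spaces.linear s s P \<and> (\<forall>x. P (P x) = P x) \<and> (\<forall>x. P x = 0 \<longleftrightarrow> x \<in> N))"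

definition quot :: "('k::field, 'v::ab_group_add) vs \<Rightarrow> 'v set \<Rightarrow> ('k, 'v) vs" where
  "quot M N = \<lparr>car = cls (scl M) N ` car M, scl = scl M\<rparr>"

definition pscale :: "'k::field \<Rightarrow> ('a \<Rightarrow>\<^sub>0 'k) \<Rightarrow> ('a \<Rightarrow>\<^sub>0 'k)" where
  "pscale c t = Poly_Mapping.map ((*) c) t"

definition free_vs :: "'a set \<Rightarrow> ('k::field, 'a \<Rightarrow>\<^sub>0 'k) vs" where
  "free_vs A = \<lparr>car = {t. Poly_Mapping.keys t \<subseteq> A}, scl = pscale\<rparr>"

abbreviation (input) gen :: "'v \<Rightarrow> 'w \<Rightarrow> ('v \<times> 'w \<Rightarrow>\<^sub>0 'k::field)" where
  "gen v w \<equiv> Poly_Mapping.single (v, w) 1"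

definition tens_rel :: "('k::field, 'v::ab_group_add) vs \<Rightarrow> ('k, 'w::ab_group_add) vs \<Rightarrow> ('v \<times> 'w \<Rightarrow>\<^sub>0 'k) set"
  where
  "tens_rel M N = module.span pscale
     ({gen (v + v') w - gen v w - gen v' w | v v' w. v \<in> car M \<and> v' \<in> car M \<and> w \<in> car N}
    \<union> {gen v (w + w') - gen v w - gen v w' | v w w'. v \<in> car M \<and> w \<in> car N \<and> w' \<in> car N}
    \<union> {gen (scl M c v) w - pscale c (gen v w) | c v w. v \<in> car M \<and> w \<in> car N}
    \<union> {gen v (scl N c w) - pscale c (gen v w) | c v w. v \<in> car M \<and> w \<in> car N})"

definition tprod :: "('k::field, 'v::ab_group_add) vs \<Rightarrow> ('k, 'w::ab_group_add) vs \<Rightarrow> ('k, 'v \<times> 'w \<Rightarrow>\<^sub>0 'k) vs"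
  where "tprod M N = quot (free_vs (car M \<times> car N)) (tens_rel M N)"

definition tens :: "('k::field, 'v::ab_group_add) vs \<Rightarrow> ('k, 'w::ab_group_add) vs \<Rightarrow> 'v \<Rightarrow> 'w \<Rightarrow> ('v \<times> 'w \<Rightarrow>\<^sub>0 'k)"
  where "tens M N v w = cls pscale (tens_rel M N) (gen v w)"

text \<open>For bilinear \<open>f\<close>, the linear map on the tensor product with \<open>v \<otimes> w \<mapsto> f v w\<close>
  (see \<open>lin_ext_tens\<close> and \<open>lin_ext_vlin\<close>); \<open>s\<close> is the scalar multiplication of the target.\<close>

definition lin_ext :: "('k::field \<Rightarrow> 'x::ab_group_add \<Rightarrow> 'x) \<Rightarrow> ('v \<Rightarrow> 'w \<Rightarrow> 'x) \<Rightarrow> ('v \<times> 'w \<Rightarrow>\<^sub>0 'k) \<Rightarrow> 'x"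
  where "lin_ext s f t = (\<Sum>p\<in>Poly_Mapping.keys t. s (Poly_Mapping.lookup t p) (f (fst p) (snd p)))"

definition bilin :: "('k::field, 'v::ab_group_add) vs \<Rightarrow> ('k, 'w::ab_group_add) vs \<Rightarrow> ('k, 'x::ab_group_add) vs
    \<Rightarrow> ('v \<Rightarrow> 'w \<Rightarrow> 'x) \<Rightarrow> bool" where
  "bilin M N X f \<longleftrightarrow> (\<forall>v\<in>car M. vlin N X (f v)) \<and> (\<forall>w\<in>car N. vlin M X (\<lambda>v. f v w))"

abbreviation scalars :: "('k::field, 'k) vs" where
  "scalars \<equiv> \<lparr>car = UNIV, scl = (*)\<rparr>"


subsection \<open>The quotient and the tensor product have their universal properties\<close>

lemma lookup_pscale [simp]: "Poly_Mapping.lookup (pscale c t) x = c * Poly_Mapping.lookup t x"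
  by (simp add: pscale_def Poly_Mapping.map.rep_eq when_def)

lemma vector_space_pscale: "vector_space (pscale :: 'k::field \<Rightarrow> ('a \<Rightarrow>\<^sub>0 'k) \<Rightarrow> _)"
  by unfold_locales (rule poly_mapping_eqI; simp add: lookup_add algebra_simps)+

lemma cls_props:
  assumes "vector_space s" "module.subspace s N"
  shows cls_linear: "Vector_Spaces.linear s s (cls s N)"
    and cls_idem: "cls s N (cls s N x) = cls s N x"
    and cls_eq_0_iff: "cls s N x = 0 \<longleftrightarrow> x \<in> N"
    and cls_eq_iff: "cls s N x = cls s N y \<longleftrightarrow> x - y \<in> N"
    and cls_in_coset: "cls s N x - x \<in> N"
proof -
  interpret vector_space s by fact
  interpret vector_space_pair s s ..
  obtain g where gr: "\<And>x. g x \<in> N" and lg: "Vector_Spaces.linear s s g" and gN: "\<And>x. x \<in> N \<Longrightarrow> g x = x"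
    using linear_exists_left_inverse_on[OF linear_id assms(2)] by auto
  have lP: "Vector_Spaces.linear s s (\<lambda>x. x - g x)" using linear_compose_sub[OF linear_id lg] by simp
  have "\<exists>P. Vector_Spaces.linear s s P \<and> (\<forall>x. P (P x) = P x) \<and> (\<forall>x. P x = 0 \<longleftrightarrow> x \<in> N)"
  proof (intro exI conjI allI)
    show "Vector_Spaces.linear s s (\<lambda>x. x - g x)" by (rule lP)
    show "x - g x - g (x - g x) = x - g x" for x
      using gN[OF gr[of x]] by (simp add: linear_diff[OF lg])
    show "x - g x = 0 \<longleftrightarrow> x \<in> N" for x
      using gr[of x] gN[of x] by auto
  qed
  then have *: "Vector_Spaces.linear s s (cls s N) \<and> (\<forall>x. cls s N (cls s N x) = cls s N x)
      \<and> (\<forall>x. cls s N x = 0 \<longleftrightarrow> x \<in> N)"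
    unfolding cls_def by (rule someI_ex)
  show "Vector_Spaces.linear s s (cls s N)" "cls s N (cls s N x) = cls s N x" "cls s N x = 0 \<longleftrightarrow> x \<in> N"
    using * by auto
  show "cls s N x = cls s N y \<longleftrightarrow> x - y \<in> N"
    using * linear_diff[of "cls s N" x y] by (metis right_minus_eq)
  show "cls s N x - x \<in> N"
    using * linear_diff[of "cls s N" "cls s N x" x] by (metis right_minus_eq)
qed

lemma linear_lin_ext:
  fixes s :: "'a::field \<Rightarrow> 'x::ab_group_add \<Rightarrow> 'x" and f :: "'b \<Rightarrow> 'c \<Rightarrow> 'x"
  assumes "vector_space s"
  shows "Vector_Spaces.linear pscale s (lin_ext s f)"
proof -
  interpret vector_space s by fact
  interpret p: vector_space pscale by (rule vector_space_pscale)
  interpret vector_space_pair pscale s ..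
  have ext: "lin_ext s f t = (\<Sum>p\<in>K. s (Poly_Mapping.lookup t p) (f (fst p) (snd p)))"
    if "finite K" "Poly_Mapping.keys t \<subseteq> K" for t :: "'b \<times> 'c \<Rightarrow>\<^sub>0 'a" and K
    unfolding lin_ext_def by (rule sum.mono_neutral_left) (use that in \<open>auto simp: in_keys_iff\<close>)
  show ?thesis
    unfolding Vector_Spaces.linear_iff
  proof (intro conjI allI vector_space_pscale assms)
    fix t u :: "'b \<times> 'c \<Rightarrow>\<^sub>0 'a"
    let ?K = "Poly_Mapping.keys t \<union> Poly_Mapping.keys u"
    have "Poly_Mapping.keys (t + u) \<subseteq> ?K" by (rule Poly_Mapping.keys_add)
    then show "lin_ext s f (t + u) = lin_ext s f t + lin_ext s f u"
      by (simp add: ext[of ?K] lookup_add scale_left_distrib sum.distrib)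
  next
    fix c and t :: "'b \<times> 'c \<Rightarrow>\<^sub>0 'a"
    have "Poly_Mapping.keys (pscale c t) \<subseteq> Poly_Mapping.keys t" by (auto simp: in_keys_iff)
    then show "lin_ext s f (pscale c t) = s c (lin_ext s f t)"
      by (simp add: ext[of "Poly_Mapping.keys t"] scale_sum_right)
  qed
qed

lemma lin_ext_gen:
  assumes "vector_space s"
  shows "lin_ext s f (gen v w) = f v w"
proof -
  interpret vector_space s by fact
  show ?thesis by (simp add: lin_ext_def)
qed

lemma subspace_tens_rel: "module.subspace pscale (tens_rel M N)"
proof -
  interpret vector_space pscale by (rule vector_space_pscale)
  show ?thesis by (simp add: tens_rel_def)
qed

lemma lin_ext_tens_rel:
  assumes "vector_space (scl X)" "bilin M N X f" "vspace M" "vspace N" "t \<in> tens_rel M N"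
  shows "lin_ext (scl X) f t = 0"
proof -
  interpret M: vector_space "scl M" using assms by (simp add: vspace_def)
  interpret N: vector_space "scl N" using assms by (simp add: vspace_def)
  interpret X: vector_space "scl X" by fact
  interpret p: vector_space pscale by (rule vector_space_pscale)
  interpret vector_space_pair pscale "scl X" ..
  note lin = linear_lin_ext[OF assms(1), of f]
  note M = assms(3)[unfolded vspace_def] and N = assms(4)[unfolded vspace_def]
  show ?thesis
    using assms(5) unfolding tens_rel_def
  proof (rule linear_eq_0_on_span[OF lin, rotated])
    fix x assume "x \<in> {gen (v + v') w - gen v w - gen v' w | v v' w. v \<in> car M \<and> v' \<in> car M \<and> w \<in> car N}
    \<union> {gen v (w + w') - gen v w - gen v w' | v w w'. v \<in> car M \<and> w \<in> car N \<and> w' \<in> car N}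
    \<union> {gen (scl M c v) w - pscale c (gen v w) | c v w. v \<in> car M \<and> w \<in> car N}
    \<union> {gen v (scl N c w) - pscale c (gen v w) | c v w. v \<in> car M \<and> w \<in> car N}"
    then show "lin_ext (scl X) f x = 0"
      using assms(2) unfolding bilin_def vlin_def
      by (auto simp: linear_diff[OF lin] linear_scale[OF lin] lin_ext_gen[OF assms(1)])
  qed
qed

lemma tens_bilin:
  assumes "vspace M" "vspace N"
  shows "bilin M N (tprod M N) (tens M N)"
proof -
  interpret p: vector_space pscale by (rule vector_space_pscale)
  interpret vector_space_pair pscale pscale ..
  note c = cls_props[OF vector_space_pscale subspace_tens_rel[of M N]]
  note l = c(1)
  have sub: "cls pscale (tens_rel M N) (gen v w) \<in> car (tprod M N)" if "v \<in> car M" "w \<in> car N" for v w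
    unfolding tprod_def quot_def free_vs_def using that by auto
  have base: "x \<in> tens_rel M N \<Longrightarrow> cls pscale (tens_rel M N) x = 0" for x using c(3) by blast
  have a1: "tens M N (v + v') w = tens M N v w + tens M N v' w"
    if "v \<in> car M" "v' \<in> car M" "w \<in> car N" for v v' w
  proof -
    have "gen (v + v') w - gen v w - gen v' w \<in> tens_rel M N"
      unfolding tens_rel_def by (rule p.span_base) (use that in blast)
    from base[OF this] show ?thesis unfolding tens_def by (simp add: linear_diff[OF l] linear_add[OF l] algebra_simps)
  qed
  have a2: "tens M N v (w + w') = tens M N v w + tens M N v w'"
    if "v \<in> car M" "w \<in> car N" "w' \<in> car N" for v w w'
  proof -
    have "gen v (w + w') - gen v w - gen v w' \<in> tens_rel M N"
      unfolding tens_rel_def by (rule p.span_base) (use that in blast)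
    from base[OF this] show ?thesis unfolding tens_def by (simp add: linear_diff[OF l] linear_add[OF l] algebra_simps)
  qed
  have a3: "tens M N (scl M k v) w = pscale k (tens M N v w)" if "v \<in> car M" "w \<in> car N" for v w k
  proof -
    have "gen (scl M k v) w - pscale k (gen v w) \<in> tens_rel M N"
      unfolding tens_rel_def by (rule p.span_base) (use that in blast)
    from base[OF this] show ?thesis unfolding tens_def
      by (simp add: linear_diff[OF l] linear_scale[OF l])
  qed
  have a4: "tens M N v (scl N k w) = pscale k (tens M N v w)" if "v \<in> car M" "w \<in> car N" for v w k
  proof -
    have "gen v (scl N k w) - pscale k (gen v w) \<in> tens_rel M N"
      unfolding tens_rel_def by (rule p.span_base) (use that in blast)
    from base[OF this] show ?thesis unfolding tens_def
      by (simp add: linear_diff[OF l] linear_scale[OF l])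
  qed
  have sc: "scl (tprod M N) = pscale" by (simp add: tprod_def quot_def free_vs_def)
  show ?thesis
    unfolding bilin_def vlin_def sc using sub a1 a2 a3 a4 by (auto simp: tens_def)
qed

lemma lin_ext_tens:
  assumes "vector_space (scl X)" "bilin M N X f" "vspace M" "vspace N"
  shows "lin_ext (scl X) f (tens M N v w) = f v w"
proof -
  interpret X: vector_space "scl X" by fact
  interpret p: vector_space pscale by (rule vector_space_pscale)
  interpret vector_space_pair pscale "scl X" ..
  note c = cls_props[OF vector_space_pscale subspace_tens_rel[of M N]]
  have "lin_ext (scl X) f (tens M N v w - gen v w) = 0"
    unfolding tens_def by (rule lin_ext_tens_rel[OF assms c(5)])
  then show ?thesis
    by (simp add: linear_diff[OF linear_lin_ext[OF assms(1)]] lin_ext_gen[OF assms(1)])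
qed

lemma lin_ext_vlin:
  assumes "vspace X" "bilin M N X f" "vspace M" "vspace N"
  shows "vlin (tprod M N) X (lin_ext (scl X) f)"
proof -
  have vX: "vector_space (scl X)" and sX: "module.subspace (scl X) (car X)"
    using assms(1) by (auto simp: vspace_def)
  interpret X: vector_space "scl X" by fact
  interpret p: vector_space pscale by (rule vector_space_pscale)
  interpret vector_space_pair pscale "scl X" ..
  note c = cls_props[OF vector_space_pscale subspace_tens_rel[of M N]]
  note lin = linear_lin_ext[OF vX, of f]
  have "lin_ext (scl X) f t \<in> car X" if t: "t \<in> car (tprod M N)" for t
  proof -
    obtain u where u: "Poly_Mapping.keys u \<subseteq> car M \<times> car N" "t = cls pscale (tens_rel M N) u"
      using t by (auto simp: tprod_def quot_def free_vs_def)
    have "lin_ext (scl X) f (t - u) = 0"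
      unfolding u by (rule lin_ext_tens_rel[OF vX assms(2-4) c(5)])
    then have "lin_ext (scl X) f t = lin_ext (scl X) f u" by (simp add: linear_diff[OF lin])
    also have "\<dots> \<in> car X"
      unfolding lin_ext_def
      by (intro X.subspace_sum[OF sX] X.subspace_scale[OF sX])
        (use u(1) assms(2) in \<open>fastforce simp: bilin_def vlin_def\<close>)
    finally show ?thesis .
  qed
  then show ?thesis
    unfolding vlin_def
    by (auto simp: linear_add[OF lin] linear_scale[OF lin] tprod_def quot_def free_vs_def)
qed


section \<open>Hopf algebras and comodules\<close>

text \<open>The multiplication and unit of \<open>H\<close> are those of the ring type \<open>'h\<close>.  The fields \<open>rform\<close> and
  \<open>rform_inv\<close> hold \<open>\<R>\<close> and its convolution inverse, as bilinear forms.\<close>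

record (overloaded) ('k::zero, 'h) hopf =
  hscale :: "'k \<Rightarrow> 'h \<Rightarrow> 'h"
  comult :: "'h \<Rightarrow> ('h \<times> 'h \<Rightarrow>\<^sub>0 'k)"
  counit :: "'h \<Rightarrow> 'k"
  antipode :: "'h \<Rightarrow> 'h"

record (overloaded) ('k::zero, 'h) dqt_hopf = "('k, 'h) hopf" +
  rform :: "'h \<Rightarrow> 'h \<Rightarrow> 'k"
  rform_inv :: "'h \<Rightarrow> 'h \<Rightarrow> 'k"

definition hvs :: "('k::field, 'h::ring_1, 'z) hopf_scheme \<Rightarrow> ('k, 'h) vs" where
  "hvs H = \<lparr>car = UNIV, scl = hscale H\<rparr>"

text \<open>Sweedler sums \<open>f h\<^sub>(\<^sub>1\<^sub>) h\<^sub>(\<^sub>2\<^sub>)\<close> and \<open>f h\<^sub>(\<^sub>1\<^sub>) h\<^sub>(\<^sub>2\<^sub>) h\<^sub>(\<^sub>3\<^sub>)\<close> for multilinear \<open>f\<close>.\<close>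

definition sw :: "('k::field, 'h::ring_1, 'z) hopf_scheme \<Rightarrow> ('k \<Rightarrow> 'x::ab_group_add \<Rightarrow> 'x)
    \<Rightarrow> ('h \<Rightarrow> 'h \<Rightarrow> 'x) \<Rightarrow> 'h \<Rightarrow> 'x" where
  "sw H s f h = lin_ext s f (comult H h)"

definition sw3 :: "('k::field, 'h::ring_1, 'z) hopf_scheme \<Rightarrow> ('k \<Rightarrow> 'x::ab_group_add \<Rightarrow> 'x)
    \<Rightarrow> ('h \<Rightarrow> 'h \<Rightarrow> 'h \<Rightarrow> 'x) \<Rightarrow> 'h \<Rightarrow> 'x" where
  "sw3 H s f h = sw H s (\<lambda>h1 h'. sw H s (\<lambda>h2 h3. f h1 h2 h3) h') h"

abbreviation htens :: "('k::field, 'h::ring_1, 'z) hopf_scheme \<Rightarrow> 'h \<Rightarrow> 'h \<Rightarrow> ('h \<times> 'h \<Rightarrow>\<^sub>0 'k)" where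
  "htens H \<equiv> tens (hvs H) (hvs H)"

abbreviation hh :: "('k::field, 'h::ring_1, 'z) hopf_scheme \<Rightarrow> ('k, 'h \<times> 'h \<Rightarrow>\<^sub>0 'k) vs" where
  "hh H \<equiv> tprod (hvs H) (hvs H)"

locale hopf_algebra =
  fixes H :: "('k::field, 'h::ring_1, 'z) hopf_scheme"
  assumes vs: "vector_space (hscale H)"
    and mult: "bilin (hvs H) (hvs H) (hvs H) (*)"
    and comult_linear: "vlin (hvs H) (hh H) (comult H)"
    and coassoc: "sw H pscale (\<lambda>a b. sw H pscale (\<lambda>a1 a2. tens (hvs H) (hh H) a1 (htens H a2 b)) a) h
                = sw H pscale (\<lambda>a b. tens (hvs H) (hh H) a (comult H b)) h"
    and counit_linear: "vlin (hvs H) scalars (counit H)"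
    and counit_left: "sw H (hscale H) (\<lambda>h1 h2. hscale H (counit H h1) h2) h = h"
    and counit_right: "sw H (hscale H) (\<lambda>h1 h2. hscale H (counit H h2) h1) h = h"
    and comult_one: "comult H 1 = htens H 1 1"
    and comult_mult: "comult H (a * b) =
                      sw H pscale (\<lambda>a1 a2. sw H pscale (\<lambda>b1 b2. htens H (a1 * b1) (a2 * b2)) b) a"
    and counit_one: "counit H 1 = 1"
    and counit_mult: "counit H (a * b) = counit H a * counit H b"
    and antipode_linear: "vlin (hvs H) (hvs H) (antipode H)"
    and antipode_left: "sw H (hscale H) (\<lambda>h1 h2. antipode H h1 * h2) h = hscale H (counit H h) 1"
    and antipode_right: "sw H (hscale H) (\<lambda>h1 h2. h1 * antipode H h2) h = hscale H (counit H h) 1"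

locale dual_quasitriangular = hopf_algebra H
  for H :: "('k::field, 'h::ring_1, 'z) dqt_hopf_scheme" +
  assumes rform_bilin: "bilin (hvs H) (hvs H) scalars (rform H)"
    and rform_inv_bilin: "bilin (hvs H) (hvs H) scalars (rform_inv H)"
    and rform_rform_inv:
      "sw H (*) (\<lambda>a1 a2. sw H (*) (\<lambda>b1 b2. rform H a1 b1 * rform_inv H a2 b2) b) a = counit H a * counit H b"
    and rform_inv_rform:
      "sw H (*) (\<lambda>a1 a2. sw H (*) (\<lambda>b1 b2. rform_inv H a1 b1 * rform H a2 b2) b) a = counit H a * counit H b"
    and rform_mult_left: "rform H (a * b) c = sw H (*) (\<lambda>c1 c2. rform H a c1 * rform H b c2) c"
    and rform_mult_right: "rform H a (b * c) = sw H (*) (\<lambda>a1 a2. rform H a1 c * rform H a2 b) a"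
    and quasi_comm:
      "sw H (hscale H) (\<lambda>a1 a2. sw H (hscale H) (\<lambda>b1 b2. hscale H (rform H a2 b2) (b1 * a1)) b) a
     = sw H (hscale H) (\<lambda>a1 a2. sw H (hscale H) (\<lambda>b1 b2. hscale H (rform H a1 b1) (a2 * b2)) b) a"

definition right_comodule :: "('k::field, 'h::ring_1, 'z) hopf_scheme \<Rightarrow> ('k, 'v::ab_group_add) vs
    \<Rightarrow> ('v \<Rightarrow> ('v \<times> 'h \<Rightarrow>\<^sub>0 'k)) \<Rightarrow> bool" where
  "right_comodule H V \<delta> \<longleftrightarrow> vspace V \<and> vlin V (tprod V (hvs H)) \<delta>
     \<and> (\<forall>v\<in>car V. lin_ext pscale (\<lambda>u h. lin_ext pscale (\<lambda>u0 u1. tens V (hh H) u0 (htens H u1 h)) (\<delta> u)) (\<delta> v)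
                 = lin_ext pscale (\<lambda>u h. tens V (hh H) u (comult H h)) (\<delta> v))
     \<and> (\<forall>v\<in>car V. lin_ext (scl V) (\<lambda>u h. scl V (counit H h) u) (\<delta> v) = v)"

text \<open>Tensor product coaction \<open>v \<otimes> w \<mapsto> v\<^sub>[\<^sub>0\<^sub>] \<otimes> w\<^sub>[\<^sub>0\<^sub>] \<otimes> v\<^sub>[\<^sub>1\<^sub>]w\<^sub>[\<^sub>1\<^sub>]\<close>.\<close>

definition tens_coact :: "('k::field, 'h::ring_1, 'z) hopf_scheme \<Rightarrow> ('k, 'v::ab_group_add) vs \<Rightarrow> ('v \<Rightarrow> ('v \<times> 'h \<Rightarrow>\<^sub>0 'k))
    \<Rightarrow> ('k, 'w::ab_group_add) vs \<Rightarrow> ('w \<Rightarrow> ('w \<times> 'h \<Rightarrow>\<^sub>0 'k)) \<Rightarrow> ('v \<times> 'w \<Rightarrow>\<^sub>0 'k)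
    \<Rightarrow> (('v \<times> 'w \<Rightarrow>\<^sub>0 'k) \<times> 'h \<Rightarrow>\<^sub>0 'k)" where
  "tens_coact H V \<delta>V W \<delta>W = lin_ext pscale (\<lambda>v w.
     lin_ext pscale (\<lambda>v0 v1.
       lin_ext pscale (\<lambda>w0 w1. tens (tprod V W) (hvs H) (tens V W v0 w0) (v1 * w1)) (\<delta>W w)) (\<delta>V v))"

definition comodule_map :: "('k::field, 'h::ring_1, 'z) hopf_scheme \<Rightarrow> ('k, 'v::ab_group_add) vs \<Rightarrow> ('v \<Rightarrow> ('v \<times> 'h \<Rightarrow>\<^sub>0 'k))
    \<Rightarrow> ('k, 'w::ab_group_add) vs \<Rightarrow> ('w \<Rightarrow> ('w \<times> 'h \<Rightarrow>\<^sub>0 'k)) \<Rightarrow> ('v \<Rightarrow> 'w) \<Rightarrow> bool" where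
  "comodule_map H V \<delta>V W \<delta>W f \<longleftrightarrow> vlin V W f
     \<and> (\<forall>v\<in>car V. \<delta>W (f v) = lin_ext pscale (\<lambda>u h. tens W (hvs H) (f u) h) (\<delta>V v))"


section \<open>The bicovariant calculus of a right ideal \<open>Q \<subseteq> ker \<epsilon>\<close>\<close>

definition ker_eps :: "('k::field, 'h::ring_1, 'z) hopf_scheme \<Rightarrow> ('k, 'h) vs" where
  "ker_eps H = \<lparr>car = {h. counit H h = 0}, scl = hscale H\<rparr>"

definition Omega0 :: "('k::field, 'h::ring_1, 'z) hopf_scheme \<Rightarrow> 'h set \<Rightarrow> ('k, 'h) vs" where
  "Omega0 H Q = quot (ker_eps H) Q"

text \<open>\<open>h \<mapsto> h - \<epsilon>(h) 1\<close> followed by the quotient map onto \<open>\<Omega>\<^sub>0\<close>.\<close>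

definition pi_tilde :: "('k::field, 'h::ring_1, 'z) hopf_scheme \<Rightarrow> 'h set \<Rightarrow> 'h \<Rightarrow> 'h" where
  "pi_tilde H Q h = cls (hscale H) Q (h - hscale H (counit H h) 1)"

definition Ad :: "('k::field, 'h::ring_1, 'z) hopf_scheme \<Rightarrow> 'h \<Rightarrow> ('h \<times> 'h \<Rightarrow>\<^sub>0 'k)" where
  "Ad H = sw3 H pscale (\<lambda>h1 h2 h3. htens H h2 (antipode H h1 * h3))"

text \<open>\<open>Ad\<close> projected to \<open>\<Omega>\<^sub>0\<close>.  \<open>Ad\<close> maps \<open>ker \<epsilon>\<close> to \<open>ker \<epsilon> \<otimes> H\<close>, on which \<open>pi_tilde \<otimes> id\<close> is the
  quotient map; using \<open>pi_tilde\<close> allows arbitrary presentations in \<open>H \<otimes> H\<close>.\<close>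

definition Ad0 :: "('k::field, 'h::ring_1, 'z) hopf_scheme \<Rightarrow> 'h set \<Rightarrow> 'h \<Rightarrow> ('h \<times> 'h \<Rightarrow>\<^sub>0 'k)" where
  "Ad0 H Q v = lin_ext pscale (\<lambda>g k. tens (Omega0 H Q) (hvs H) (pi_tilde H Q g) k) (Ad H v)"

definition ker_mult :: "('k::field, 'h::ring_1, 'z) hopf_scheme \<Rightarrow> ('k, 'h \<times> 'h \<Rightarrow>\<^sub>0 'k) vs" where
  "ker_mult H = \<lparr>car = {t \<in> car (hh H). lin_ext (hscale H) (*) t = 0}, scl = pscale\<rparr>"

text \<open>\<open>h \<otimes> g \<mapsto> h g\<^sub>(\<^sub>1\<^sub>) \<otimes> g\<^sub>(\<^sub>2\<^sub>)\<close>, which identifies \<open>ker_mult H\<close> with \<open>H \<otimes> ker \<epsilon>\<close>.  The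
  relations of the calculus are the part of \<open>ker_mult H\<close> that it identifies with \<open>H \<otimes> Q\<close>.\<close>

definition can :: "('k::field, 'h::ring_1, 'z) hopf_scheme \<Rightarrow> ('h \<times> 'h \<Rightarrow>\<^sub>0 'k) \<Rightarrow> ('h \<times> 'h \<Rightarrow>\<^sub>0 'k)" where
  "can H = lin_ext pscale (\<lambda>h g. sw H pscale (\<lambda>g1 g2. htens H (h * g1) g2) g)"

definition Omega1_rel :: "('k::field, 'h::ring_1, 'z) hopf_scheme \<Rightarrow> 'h set \<Rightarrow> ('h \<times> 'h \<Rightarrow>\<^sub>0 'k) set" where
  "Omega1_rel H Q = {t \<in> car (ker_mult H). can H t \<in> module.span pscale {htens H h q | h q. q \<in> Q}}"

definition Omega1 :: "('k::field, 'h::ring_1, 'z) hopf_scheme \<Rightarrow> 'h set \<Rightarrow> ('k, 'h \<times> 'h \<Rightarrow>\<^sub>0 'k) vs" where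
  "Omega1 H Q = quot (ker_mult H) (Omega1_rel H Q)"

abbreviation cls1 :: "('k::field, 'h::ring_1, 'z) hopf_scheme \<Rightarrow> 'h set \<Rightarrow> ('h \<times> 'h \<Rightarrow>\<^sub>0 'k) \<Rightarrow> ('h \<times> 'h \<Rightarrow>\<^sub>0 'k)" where
  "cls1 H Q \<equiv> cls pscale (Omega1_rel H Q)"

text \<open>The bimodule structure of \<open>\<Omega>\<^sup>1\<close>, induced from the outer multiplications on \<open>H \<otimes> H\<close>.\<close>

definition lact :: "('k::field, 'h::ring_1, 'z) hopf_scheme \<Rightarrow> 'h set \<Rightarrow> 'h \<Rightarrow> ('h \<times> 'h \<Rightarrow>\<^sub>0 'k) \<Rightarrow> ('h \<times> 'h \<Rightarrow>\<^sub>0 'k)" where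
  "lact H Q h \<omega> = cls1 H Q (lin_ext pscale (\<lambda>a b. htens H (h * a) b) \<omega>)"

definition ract :: "('k::field, 'h::ring_1, 'z) hopf_scheme \<Rightarrow> 'h set \<Rightarrow> ('h \<times> 'h \<Rightarrow>\<^sub>0 'k) \<Rightarrow> 'h \<Rightarrow> ('h \<times> 'h \<Rightarrow>\<^sub>0 'k)" where
  "ract H Q \<omega> h = cls1 H Q (lin_ext pscale (\<lambda>a b. htens H a (b * h)) \<omega>)"

definition extd :: "('k::field, 'h::ring_1, 'z) hopf_scheme \<Rightarrow> 'h set \<Rightarrow> 'h \<Rightarrow> ('h \<times> 'h \<Rightarrow>\<^sub>0 'k)" where
  "extd H Q h = cls1 H Q (htens H 1 h - htens H h 1)"

text \<open>The Maurer-Cartan form; the class \<open>v \<in> \<Omega>\<^sub>0\<close> is its own lift to \<open>ker \<epsilon>\<close>.\<close>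

definition e_MC :: "('k::field, 'h::ring_1, 'z) hopf_scheme \<Rightarrow> 'h set \<Rightarrow> 'h \<Rightarrow> ('h \<times> 'h \<Rightarrow>\<^sub>0 'k)" where
  "e_MC H Q v = cls1 H Q (sw H pscale (\<lambda>v1 v2. htens H (antipode H v1) v2) v)"


section \<open>Framings, spinor spaces and the Dirac operator\<close>

text \<open>\<open>r : \<Omega>\<^sub>0 \<rightarrow> V\<close> is the intertwiner that relates the V-bein \<open>e\<close> to the Maurer-Cartan form.\<close>

definition framed :: "('k::field, 'h::ring_1, 'z) hopf_scheme \<Rightarrow> 'h set \<Rightarrow> ('k, 'v::ab_group_add) vs
    \<Rightarrow> ('v \<Rightarrow> ('v \<times> 'h \<Rightarrow>\<^sub>0 'k)) \<Rightarrow> ('h \<Rightarrow> 'v) \<Rightarrow> ('v \<Rightarrow> ('h \<times> 'h \<Rightarrow>\<^sub>0 'k)) \<Rightarrow> bool" where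
  "framed H Q V \<delta> r e \<longleftrightarrow> right_comodule H V \<delta>
     \<and> comodule_map H (Omega0 H Q) (Ad0 H Q) V \<delta> r
     \<and> vlin V (Omega1 H Q) e
     \<and> viso (tprod (hvs H) V) (Omega1 H Q) (lin_ext pscale (\<lambda>h v. lact H Q h (e v)))"

definition spinor_space :: "('k::field, 'h::ring_1, 'z) hopf_scheme \<Rightarrow> ('k, 'v::ab_group_add) vs \<Rightarrow> ('v \<Rightarrow> ('v \<times> 'h \<Rightarrow>\<^sub>0 'k))
    \<Rightarrow> ('k, 'w::ab_group_add) vs \<Rightarrow> ('w \<Rightarrow> ('w \<times> 'h \<Rightarrow>\<^sub>0 'k)) \<Rightarrow> (('v \<times> 'w \<Rightarrow>\<^sub>0 'k) \<Rightarrow> 'w) \<Rightarrow> bool" where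
  "spinor_space H V \<delta>V W \<delta>W \<gamma> \<longleftrightarrow> right_comodule H W \<delta>W
     \<and> comodule_map H (tprod V W) (tens_coact H V \<delta>V W \<delta>W) W \<delta>W \<gamma>"

text \<open>Left components of \<open>\<omega> \<in> \<Omega>\<^sup>1\<close> with respect to a V-bein \<open>e\<close> and a basis \<open>b\<close> of \<open>V\<close> indexed
  by the finite set \<open>J\<close>; they exist and are unique whenever \<open>H \<otimes> V \<cong> \<Omega>\<^sup>1\<close>.\<close>

definition comps :: "('k::field, 'h::ring_1, 'z) hopf_scheme \<Rightarrow> 'h set \<Rightarrow> 'j set \<Rightarrow> ('j \<Rightarrow> 'v)
    \<Rightarrow> ('v \<Rightarrow> ('h \<times> 'h \<Rightarrow>\<^sub>0 'k)) \<Rightarrow> ('h \<times> 'h \<Rightarrow>\<^sub>0 'k) \<Rightarrow> 'j \<Rightarrow> 'h" where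
  "comps H Q J b e \<omega> = (THE c. (\<forall>a. a \<notin> J \<longrightarrow> c a = 0) \<and> \<omega> = (\<Sum>a\<in>J. lact H Q (c a) (e (b a))))"

definition partial :: "('k::field, 'h::ring_1, 'z) hopf_scheme \<Rightarrow> 'h set \<Rightarrow> 'j set \<Rightarrow> ('j \<Rightarrow> 'v)
    \<Rightarrow> ('v \<Rightarrow> ('h \<times> 'h \<Rightarrow>\<^sub>0 'k)) \<Rightarrow> 'j \<Rightarrow> 'h \<Rightarrow> 'h" where
  "partial H Q J b e a h = comps H Q J b e (extd H Q h) a"

definition gauge_field :: "('k::field, 'h::ring_1, 'z) hopf_scheme \<Rightarrow> 'h set \<Rightarrow> ('h \<Rightarrow> ('h \<times> 'h \<Rightarrow>\<^sub>0 'k)) \<Rightarrow> bool" where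
  "gauge_field H Q A \<longleftrightarrow> vlin (Omega0 H Q) (Omega1 H Q) A"

definition dirac :: "('k::field, 'h::ring_1, 'z) hopf_scheme \<Rightarrow> 'h set
    \<Rightarrow> ('k, 'v::ab_group_add) vs \<Rightarrow> 'j set \<Rightarrow> ('j \<Rightarrow> 'v) \<Rightarrow> ('v \<Rightarrow> ('h \<times> 'h \<Rightarrow>\<^sub>0 'k))
    \<Rightarrow> ('k, 'w::ab_group_add) vs \<Rightarrow> ('w \<Rightarrow> ('w \<times> 'h \<Rightarrow>\<^sub>0 'k)) \<Rightarrow> (('v \<times> 'w \<Rightarrow>\<^sub>0 'k) \<Rightarrow> 'w)
    \<Rightarrow> ('h \<Rightarrow> ('h \<times> 'h \<Rightarrow>\<^sub>0 'k)) \<Rightarrow> ('h \<times> 'w \<Rightarrow>\<^sub>0 'k) \<Rightarrow> ('h \<times> 'w \<Rightarrow>\<^sub>0 'k)" where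
  "dirac H Q V J b e W \<delta>W \<gamma> A = lin_ext pscale (\<lambda>p w.
     \<Sum>a\<in>J. tens (hvs H) W (partial H Q J b e a p) (\<gamma> (tens V W (b a) w))
          - lin_ext pscale (\<lambda>w0 w1.
              tens (hvs H) W (p * comps H Q J b e (A (pi_tilde H Q (inv (antipode H) w1))) a)
                (\<gamma> (tens V W (b a) w0))) (\<delta>W w))"


section \<open>The calculus, framing and spinors defined by a finite-dimensional comodule\<close>

text \<open>A right comodule with a basis \<open>bvec \<alpha>\<close> for \<open>\<alpha> \<in> bidx\<close>, and its matrix \<open>\<rho>\<^sup>\<beta>\<^sub>\<alpha> = bmat \<beta> \<alpha>\<close>.\<close>

record (overloaded) ('k::zero, 'h, 'w, 'i) based_comod =
  bscale :: "'k \<Rightarrow> 'w \<Rightarrow> 'w"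
  bcoact :: "'w \<Rightarrow> ('w \<times> 'h \<Rightarrow>\<^sub>0 'k)"
  bidx :: "'i set"
  bvec :: "'i \<Rightarrow> 'w"
  bmat :: "'i \<Rightarrow> 'i \<Rightarrow> 'h"

definition wvs :: "('k::field, 'h, 'w, 'i) based_comod \<Rightarrow> ('k, 'w) vs" where
  "wvs W = \<lparr>car = UNIV, scl = bscale W\<rparr>"

locale based_comodule =
  fixes H :: "('k::field, 'h::ring_1, 'z) hopf_scheme"
    and W :: "('k, 'h, 'w::ab_group_add, 'i) based_comod"
  assumes comodule: "right_comodule H (wvs W) (bcoact W)"
    and finite_basis: "finite (bidx W)"
    and inj_basis: "inj_on (bvec W) (bidx W)"
    and independent_basis: "\<not> module.dependent (bscale W) (bvec W ` bidx W)"
    and span_basis: "module.span (bscale W) (bvec W ` bidx W) = UNIV"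
    and coact_basis: "\<alpha> \<in> bidx W \<Longrightarrow>
          bcoact W (bvec W \<alpha>) = (\<Sum>\<beta>\<in>bidx W. tens (wvs W) (hvs H) (bvec W \<beta>) (bmat W \<beta> \<alpha>))"

definition End :: "('k::field, 'h, 'w::ab_group_add, 'i) based_comod \<Rightarrow> ('k, 'w \<Rightarrow> 'w) vs" where
  "End W = \<lparr>car = {\<phi>. Vector_Spaces.linear (bscale W) (bscale W) \<phi>}, scl = (\<lambda>c \<phi> w. bscale W c (\<phi> w))\<rparr>"

text \<open>The predual \<open>W\<^sup>\<circ>\<close> is the dual space (\<open>W\<close> is finite dimensional), with dual basis \<open>f\<^sup>\<alpha>\<close>.\<close>

definition predual :: "('k::field, 'h, 'w::ab_group_add, 'i) based_comod \<Rightarrow> ('k, 'w \<Rightarrow> 'k) vs" where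
  "predual W = \<lparr>car = {f. Vector_Spaces.linear (bscale W) (*) f}, scl = (\<lambda>c f w. c * f w)\<rparr>"

definition dvec :: "('k::field, 'h, 'w::ab_group_add, 'i) based_comod \<Rightarrow> 'i \<Rightarrow> 'w \<Rightarrow> 'k" where
  "dvec W \<alpha> w = module.representation (bscale W) (bvec W ` bidx W) w (bvec W \<alpha>)"

text \<open>The linear extension of \<open>f\<^sup>\<alpha> \<mapsto> f\<^sup>\<beta> \<otimes> S\<rho>\<^sup>\<alpha>\<^sub>\<beta>\<close>.\<close>

definition predual_coact :: "('k::field, 'h::ring_1, 'z) hopf_scheme \<Rightarrow> ('k, 'h, 'w::ab_group_add, 'i) based_comod
    \<Rightarrow> ('w \<Rightarrow> 'k) \<Rightarrow> (('w \<Rightarrow> 'k) \<times> 'h \<Rightarrow>\<^sub>0 'k)" where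
  "predual_coact H W f = (\<Sum>\<alpha>\<in>bidx W. \<Sum>\<beta>\<in>bidx W.
     pscale (f (bvec W \<alpha>)) (tens (predual W) (hvs H) (dvec W \<beta>) (antipode H (bmat W \<alpha> \<beta>))))"

text \<open>The identification \<open>W \<otimes> W\<^sup>\<circ> = End W\<close> and the operator \<open>e\<^sub>\<alpha> \<otimes> f\<^sup>\<beta>\<close>.\<close>

definition as_End :: "('k::field, 'h, 'w::ab_group_add, 'i) based_comod \<Rightarrow> ('w \<times> ('w \<Rightarrow> 'k) \<Rightarrow>\<^sub>0 'k) \<Rightarrow> ('w \<Rightarrow> 'w)" where
  "as_End W = lin_ext (scl (End W)) (\<lambda>w f x. bscale W (f x) w)"

definition unit_op :: "('k::field, 'h, 'w::ab_group_add, 'i) based_comod \<Rightarrow> 'i \<times> 'i \<Rightarrow> 'w \<Rightarrow> 'w" where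
  "unit_op W = (\<lambda>(\<alpha>, \<beta>) x. bscale W (dvec W \<beta> x) (bvec W \<alpha>))"

definition mat_op :: "('k::field, 'h, 'w::ab_group_add, 'i) based_comod \<Rightarrow> ('i \<Rightarrow> 'i \<Rightarrow> 'k) \<Rightarrow> 'w \<Rightarrow> 'w" where
  "mat_op W \<phi> = (\<Sum>\<alpha>\<in>bidx W. \<Sum>\<beta>\<in>bidx W. scl (End W) (\<phi> \<alpha> \<beta>) (unit_op W (\<alpha>, \<beta>)))"

text \<open>The linear extension of \<open>e\<^sub>\<alpha> \<otimes> f\<^sup>\<beta> \<mapsto> e\<^sub>a \<otimes> f\<^sup>b \<otimes> \<rho>\<^sup>a\<^sub>\<alpha> S\<rho>\<^sup>\<beta>\<^sub>b\<close>; the matrix entry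
  \<open>\<phi>\<^sup>\<alpha>\<^sub>\<beta>\<close> is \<open>f\<^sup>\<alpha>(\<phi> e\<^sub>\<beta>)\<close>.\<close>

definition End_coact :: "('k::field, 'h::ring_1, 'z) hopf_scheme \<Rightarrow> ('k, 'h, 'w::ab_group_add, 'i) based_comod
    \<Rightarrow> ('w \<Rightarrow> 'w) \<Rightarrow> (('w \<Rightarrow> 'w) \<times> 'h \<Rightarrow>\<^sub>0 'k)" where
  "End_coact H W \<phi> = (\<Sum>\<alpha>\<in>bidx W. \<Sum>\<beta>\<in>bidx W. \<Sum>a\<in>bidx W. \<Sum>b\<in>bidx W.
     pscale (dvec W \<alpha> (\<phi> (bvec W \<beta>)))
       (tens (End W) (hvs H) (unit_op W (a, b)) (bmat W a \<alpha> * antipode H (bmat W \<beta> b))))"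

definition Qmap :: "('k::field, 'h::ring_1, 'z) dqt_hopf_scheme \<Rightarrow> 'h \<Rightarrow> 'h \<Rightarrow> 'k" where
  "Qmap H h g = sw H (*) (\<lambda>g1 g2. sw H (*) (\<lambda>h1 h2. rform H g1 h1 * rform H h2 g2) h) g"

definition rho_W :: "('k::field, 'h, 'w::ab_group_add, 'i) based_comod \<Rightarrow> ('h \<Rightarrow> 'k) \<Rightarrow> 'w \<Rightarrow> 'w" where
  "rho_W W x = mat_op W (\<lambda>\<alpha> \<beta>. x (bmat W \<alpha> \<beta>))"

definition rho_plus :: "('k::field, 'h::ring_1, 'z) dqt_hopf_scheme \<Rightarrow> ('k, 'h, 'w::ab_group_add, 'i) based_comod
    \<Rightarrow> 'h \<Rightarrow> 'w \<Rightarrow> 'w" where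
  "rho_plus H W h = mat_op W (\<lambda>\<alpha> \<beta>. rform H h (bmat W \<alpha> \<beta>))"

definition rho_minus :: "('k::field, 'h::ring_1, 'z) dqt_hopf_scheme \<Rightarrow> ('k, 'h, 'w::ab_group_add, 'i) based_comod
    \<Rightarrow> 'h \<Rightarrow> 'w \<Rightarrow> 'w" where
  "rho_minus H W h = mat_op W (\<lambda>\<alpha> \<beta>. rform_inv H (bmat W \<alpha> \<beta>) h)"

definition rho_Q :: "('k::field, 'h::ring_1, 'z) dqt_hopf_scheme \<Rightarrow> ('k, 'h, 'w::ab_group_add, 'i) based_comod
    \<Rightarrow> 'h \<Rightarrow> 'w \<Rightarrow> 'w" where
  "rho_Q H W = rho_W W \<circ> Qmap H"

definition QH :: "('k::field, 'h::ring_1, 'z) dqt_hopf_scheme \<Rightarrow> ('k, 'h, 'w::ab_group_add, 'i) based_comod \<Rightarrow> 'h set" where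
  "QH H W = {h. counit H h = 0 \<and> rho_Q H W h = 0}"

text \<open>\<open>e = e\<^sub>M\<^sub>C \<circ> (\<rho>\<^sub>W \<circ> \<Q>)\<^sup>-\<^sup>1\<close>.\<close>

definition vbein :: "('k::field, 'h::ring_1, 'z) dqt_hopf_scheme \<Rightarrow> ('k, 'h, 'w::ab_group_add, 'i) based_comod
    \<Rightarrow> ('w \<Rightarrow> 'w) \<Rightarrow> ('h \<times> 'h \<Rightarrow>\<^sub>0 'k)" where
  "vbein H W = e_MC H (QH H W) \<circ> the_inv_into (car (Omega0 H (QH H W))) (rho_Q H W)"

definition eval_gamma :: "('k::field, 'h, 'w::ab_group_add, 'i) based_comod \<Rightarrow> (('w \<Rightarrow> 'w) \<times> 'w \<Rightarrow>\<^sub>0 'k) \<Rightarrow> 'w" where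
  "eval_gamma W = lin_ext (bscale W) (\<lambda>\<phi> w. \<phi> w)"

abbreviation comps_W :: "('k::field, 'h::ring_1, 'z) dqt_hopf_scheme \<Rightarrow> ('k, 'h, 'w::ab_group_add, 'i) based_comod
    \<Rightarrow> ('h \<times> 'h \<Rightarrow>\<^sub>0 'k) \<Rightarrow> 'i \<times> 'i \<Rightarrow> 'h" where
  "comps_W H W \<equiv> comps H (QH H W) (bidx W \<times> bidx W) (unit_op W) (vbein H W)"

abbreviation partial_W :: "('k::field, 'h::ring_1, 'z) dqt_hopf_scheme \<Rightarrow> ('k, 'h, 'w::ab_group_add, 'i) based_comod
    \<Rightarrow> 'i \<times> 'i \<Rightarrow> 'h \<Rightarrow> 'h" where
  "partial_W H W \<equiv> partial H (QH H W) (bidx W \<times> bidx W) (unit_op W) (vbein H W)"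

abbreviation dirac_W :: "('k::field, 'h::ring_1, 'z) dqt_hopf_scheme \<Rightarrow> ('k, 'h, 'w::ab_group_add, 'i) based_comod
    \<Rightarrow> ('h \<Rightarrow> ('h \<times> 'h \<Rightarrow>\<^sub>0 'k)) \<Rightarrow> ('h \<times> 'w \<Rightarrow>\<^sub>0 'k) \<Rightarrow> ('h \<times> 'w \<Rightarrow>\<^sub>0 'k)" where
  "dirac_W H W \<equiv> dirac H (QH H W) (End W) (bidx W \<times> bidx W) (unit_op W) (vbein H W)
     (wvs W) (bcoact W) (eval_gamma W)"

end

theory Submission
  imports Defs
begin

text \<open>A class in \<open>\<Omega>\<^sup>1\<close> is determined by its matrix of left components
  \<open>\<theta>\<^sup>\<alpha>\<^sub>\<beta>(x \<otimes> y) = x y\<^sub>(\<^sub>1\<^sub>) \<langle>\<Q>(y\<^sub>(\<^sub>2\<^sub>)), \<rho>\<^sup>\<alpha>\<^sub>\<beta>\<rangle>\<close>, because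
  the relations of the calculus are exactly the common kernel of the \<open>\<theta>\<^sup>\<alpha>\<^sub>\<beta>\<close> on the kernel of the
  multiplication (\<open>\<rho>\<^sub>W \<circ> \<Q>\<close> being onto \<open>End W\<close>).  Every identity in \<open>\<Omega>\<^sup>1\<close> then becomes an identity
  in \<open>H\<close>.  The bimodule relation amounts to the formula for \<open>\<rho>\<^sub>W \<Q>(vg)\<close> that comes from
  multiplicativity of \<open>\<R>\<close>, together with \<open>\<R>\<^sup>-\<^sup>1(a \<otimes> Sb) = \<R>(a \<otimes> b)\<close>; equivariance of
  \<open>\<rho>\<^sub>W \<circ> \<Q>\<close> amounts to \<open>\<langle>\<Q>(h\<^sub>(\<^sub>1\<^sub>)), g\<^sub>(\<^sub>1\<^sub>)\<rangle> h\<^sub>(\<^sub>2\<^sub>) g\<^sub>(\<^sub>2\<^sub>) =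
  h\<^sub>(\<^sub>1\<^sub>) g\<^sub>(\<^sub>1\<^sub>) \<langle>\<Q>(h\<^sub>(\<^sub>2\<^sub>)), g\<^sub>(\<^sub>2\<^sub>)\<rangle>\<close>.\<close>

section \<open>Linear maps and tensor products\<close>

text \<open>Together, \<open>\<epsilon>\<close> and the matrix entries of
  \<open>\<rho>_W \<circ> \<Q>\<close> map \<open>H\<close> onto \<open>k \<times> End W\<close>
  with kernel \<open>Q_H\<close>, because \<open>\<rho>_W \<circ> \<Q>\<close> is onto already on
  \<open>ker \<epsilon>\<close>. The target is finite dimensional, so finitely many vectors of
  \<open>H\<close> split this map, and the splitting survives tensoring with \<open>H\<close>. This
  is why finitely many maps \<open>\<theta>\<close> can cut out a space that is given only as a
  span. \<open>\<Q>\<close> is only ever paired with matrix coefficients, whose coproduct is a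
  finite matrix product; the axioms on \<open>\<R>\<close> thereby turn into identities between
  matrices. The normalisation \<open>\<R>(1 \<otimes> \<rho>) = 1\<close> is not among the axioms.
  It holds because an idempotent invertible matrix is the identity, and it gives
  \<open>\<rho>_W \<Q>(1) = id\<close>, the origin of the term \<open>- h e(id)\<close> in
  \<open>dh\<close>. Carriers may be proper subsets of their types, but \<open>lin_ext\<close> is
  linear on the whole type. Linearity is therefore stated on whole types (\<open>lin\<close>), and
  carriers enter only when a map is evaluated on pure tensors.\<close>

abbreviation (input) uvs :: "('k \<Rightarrow> 'x \<Rightarrow> 'x) \<Rightarrow> ('k, 'x) vs" where
  "uvs s \<equiv> \<lparr>car = UNIV, scl = s\<rparr>"

abbreviation (input) lin :: "('k::field \<Rightarrow> 'x::ab_group_add \<Rightarrow> 'x) \<Rightarrow> ('k \<Rightarrow> 'y::ab_group_add \<Rightarrow> 'y) \<Rightarrow> ('x \<Rightarrow> 'y) \<Rightarrow> bool" where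
  "lin \<equiv> Vector_Spaces.linear"

lemma lin_iff: "lin s t f \<longleftrightarrow> vector_space s \<and> vector_space t \<and> (\<forall>x y. f (x + y) = f x + f y) \<and> (\<forall>c x. f (s c x) = t c (f x))"
  by (simp add: Vector_Spaces.linear_iff)

lemma lin_simps:
  assumes "lin s t f"
  shows lin_add: "f (x + y) = f x + f y" and lin_scale: "f (s c x) = t c (f x)"
    and lin_diff: "f (x - y) = f x - f y" and lin_zero: "f 0 = 0"
    and lin_sum: "f (sum g A) = (\<Sum>a\<in>A. f (g a))"
proof -
  interpret Vector_Spaces.linear s t f by fact
  show "f (x + y) = f x + f y" "f (s c x) = t c (f x)" "f (x - y) = f x - f y" "f 0 = 0"
    "f (sum g A) = (\<Sum>a\<in>A. f (g a))"
    by (simp_all add: add scale diff sum)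
qed

lemma scale_if:
  assumes "vector_space s"
  shows "s (if P then 1 else 0) x = (if P then x else 0)"
proof -
  interpret vector_space s by fact
  show ?thesis by simp
qed

lemma sum_fun_apply: "(\<Sum>i\<in>A. f i) x = (\<Sum>i\<in>A. f i x)"
  by (induction A rule: infinite_finite_induct) simp_all

lemma vector_space_mult: "vector_space ((*) :: 'k::field \<Rightarrow> 'k \<Rightarrow> 'k)"
  by unfold_locales (simp_all add: algebra_simps)

lemma lin_vs: assumes "lin s t f" shows lin_vs1: "vector_space s" and lin_vs2: "vector_space t"
  using assms by (simp_all add: lin_iff)

lemma lin_id: "vector_space s \<Longrightarrow> lin s s (\<lambda>x. x)"
  by (simp add: lin_iff)

lemma lin_compose: "lin s t f \<Longrightarrow> lin t u g \<Longrightarrow> lin s u (\<lambda>x. g (f x))"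
  by (simp add: lin_iff)

lemma lin_fadd: "lin s t f \<Longrightarrow> lin s t g \<Longrightarrow> lin s t (\<lambda>x. f x + g x)"
  by (simp add: lin_iff vector_space.vector_space_assms algebra_simps)

lemma lin_fdiff: "lin s t f \<Longrightarrow> lin s t g \<Longrightarrow> lin s t (\<lambda>x. f x - g x)"
  by (simp add: lin_iff module.scale_right_diff_distrib module_iff_vector_space algebra_simps)

lemma lin_fzero: "vector_space s \<Longrightarrow> vector_space t \<Longrightarrow> lin s t (\<lambda>x. 0)"
  by (simp add: lin_iff module.scale_zero_right module_iff_vector_space)

lemma lin_fsum: "vector_space s \<Longrightarrow> vector_space t \<Longrightarrow> (\<And>a. a \<in> A \<Longrightarrow> lin s t (f a)) \<Longrightarrow> lin s t (\<lambda>x. \<Sum>a\<in>A. f a x)"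
  by (induction A rule: infinite_finite_induct) (simp_all add: lin_fzero lin_fadd)

lemma lin_fscale: "lin s t f \<Longrightarrow> lin s t (\<lambda>x. t c (f x))"
proof (unfold lin_iff, intro conjI allI; (elim conjE)?)
  assume "vector_space t" and *: "\<forall>x y. f (x + y) = f x + f y" "\<forall>c x. f (s c x) = t c (f x)"
  then interpret vector_space t by simp
  show "t c (f (x + y)) = t c (f x) + t c (f y)" for x y using * by (simp add: scale_right_distrib)
  show "t c (f (s d x)) = t d (t c (f x))" for d x using * by (simp add: mult.commute)
qed

lemma lin_vec: "vector_space t \<Longrightarrow> lin s (*) f \<Longrightarrow> lin s t (\<lambda>x. t (f x) v)"
  by (simp add: lin_iff vector_space.vector_space_assms)

lemma lin_lin_ext: "lin r pscale g \<Longrightarrow> vector_space s \<Longrightarrow> lin r s (\<lambda>x. lin_ext s f (g x))"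
  by (rule lin_compose[OF _ linear_lin_ext])

text \<open>\<open>lin_ext\<close> is a finite sum over the keys of the fixed representative
  \<open>t\<close>, so linearity in the parameter \<open>x\<close> holds termwise. For the same
  reason linear maps pass inside \<open>lin_ext\<close> and nested extensions commute.\<close>

lemma lin_lin_ext_fun:
  assumes "vector_space r" "vector_space s" "\<And>a b. lin r s (\<lambda>x. f x a b)"
  shows "lin r s (\<lambda>x. lin_ext s (f x) t)"
  unfolding lin_ext_def by (intro lin_fsum lin_fscale assms)

lemma lin_of_lin_ext:
  assumes "lin s t L"
  shows "L (lin_ext s f u) = lin_ext t (\<lambda>a b. L (f a b)) u"
  unfolding lin_ext_def by (simp add: lin_sum[OF assms] lin_scale[OF assms])

lemma lin_ext_fun_simps:
  assumes "vector_space s"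
  shows lin_ext_fadd: "lin_ext s (\<lambda>a b. f a b + g a b) t = lin_ext s f t + lin_ext s g t"
    and lin_ext_fdiff: "lin_ext s (\<lambda>a b. f a b - g a b) t = lin_ext s f t - lin_ext s g t"
    and lin_ext_fzero: "lin_ext s (\<lambda>a b. 0) t = 0"
    and lin_ext_fscale: "lin_ext s (\<lambda>a b. s c (f a b)) t = s c (lin_ext s f t)"
proof -
  interpret vector_space s by fact
  show "lin_ext s (\<lambda>a b. f a b + g a b) t = lin_ext s f t + lin_ext s g t"
    "lin_ext s (\<lambda>a b. f a b - g a b) t = lin_ext s f t - lin_ext s g t"
    "lin_ext s (\<lambda>a b. 0) t = 0"
    "lin_ext s (\<lambda>a b. s c (f a b)) t = s c (lin_ext s f t)"
    unfolding lin_ext_def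
    by (simp_all add: scale_right_distrib scale_right_diff_distrib sum.distrib sum_subtractf scale_sum_right mult.commute)
qed

lemma lin_ext_fsum:
  assumes "vector_space s"
  shows "lin_ext s (\<lambda>a b. \<Sum>i\<in>I. f i a b) t = (\<Sum>i\<in>I. lin_ext s (f i) t)"
  by (induction I rule: infinite_finite_induct) (simp_all add: lin_ext_fun_simps[OF assms])

lemma lin_ext_swap:
  assumes "vector_space s"
  shows "lin_ext s (\<lambda>a b. lin_ext s (\<lambda>c d. f a b c d) u) t = lin_ext s (\<lambda>c d. lin_ext s (\<lambda>a b. f a b c d) t) u"
proof -
  interpret vector_space s by fact
  show ?thesis
    unfolding lin_ext_def scale_sum_right by (subst sum.swap) (simp add: mult.commute)
qed

lemma lin_cls: "vector_space s \<Longrightarrow> module.subspace s N \<Longrightarrow> lin s s (cls s N)"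
  by (rule cls_linear)

lemma vspace_uvs: "vector_space s \<Longrightarrow> vspace (uvs s)"
  by (simp add: vspace_def module.subspace_UNIV module_iff_vector_space)

lemma vs_vspace: "vspace M \<Longrightarrow> vector_space (scl M)"
  by (simp add: vspace_def)

lemma vspace_memb:
  assumes "vspace M"
  shows vspace_0: "0 \<in> car M" and vspace_add: "x \<in> car M \<Longrightarrow> y \<in> car M \<Longrightarrow> x + y \<in> car M"
    and vspace_scl: "x \<in> car M \<Longrightarrow> scl M c x \<in> car M"
    and vspace_diff: "x \<in> car M \<Longrightarrow> y \<in> car M \<Longrightarrow> x - y \<in> car M"
    and vspace_sum: "(\<And>i. i \<in> I \<Longrightarrow> f i \<in> car M) \<Longrightarrow> sum f I \<in> car M"
proof -
  interpret vector_space "scl M" using assms by (rule vs_vspace)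
  note * = assms[unfolded vspace_def, THEN conjunct2]
  show "0 \<in> car M" "x \<in> car M \<Longrightarrow> y \<in> car M \<Longrightarrow> x + y \<in> car M" "x \<in> car M \<Longrightarrow> scl M c x \<in> car M"
    "x \<in> car M \<Longrightarrow> y \<in> car M \<Longrightarrow> x - y \<in> car M" "(\<And>i. i \<in> I \<Longrightarrow> f i \<in> car M) \<Longrightarrow> sum f I \<in> car M"
    by (simp_all add: subspace_0[OF *] subspace_add[OF *] subspace_scale[OF *] subspace_diff[OF *] subspace_sum[OF *])
qed

lemma bilin_uvs: "(\<And>a. a \<in> car M \<Longrightarrow> lin (scl N) s (f a)) \<Longrightarrow> (\<And>b. b \<in> car N \<Longrightarrow> lin (scl M) s (\<lambda>a. f a b)) \<Longrightarrow> bilin M N (uvs s) f"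
  by (auto simp: bilin_def vlin_def lin_iff)

lemma vspace_tprod:
  fixes M :: "('k::field, 'v::ab_group_add) vs" and N :: "('k, 'w::ab_group_add) vs"
  shows "vspace (tprod M N)"
proof -
  interpret p: vector_space pscale by (rule vector_space_pscale)
  interpret p2: vector_space_pair pscale pscale ..
  have l: "lin pscale pscale (cls pscale (tens_rel M N))"
    by (rule lin_cls[OF vector_space_pscale subspace_tens_rel])
  have "p.subspace {t :: ('v \<times> 'w \<Rightarrow>\<^sub>0 'k). Poly_Mapping.keys t \<subseteq> car M \<times> car N}"
  proof (rule p.subspaceI)
    show "x + y \<in> {t. Poly_Mapping.keys t \<subseteq> car M \<times> car N}"
      if "x \<in> {t. Poly_Mapping.keys t \<subseteq> car M \<times> car N}" "y \<in> {t. Poly_Mapping.keys t \<subseteq> car M \<times> car N}"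
      for x y :: "'v \<times> 'w \<Rightarrow>\<^sub>0 'k"
      using that Poly_Mapping.keys_add[of x y] by blast
    show "pscale c x \<in> {t. Poly_Mapping.keys t \<subseteq> car M \<times> car N}"
      if "x \<in> {t. Poly_Mapping.keys t \<subseteq> car M \<times> car N}" for c and x :: "'v \<times> 'w \<Rightarrow>\<^sub>0 'k"
      using that by (force simp: in_keys_iff)
  qed simp
  from p2.linear_subspace_image[OF l this] show ?thesis
    by (simp add: vspace_def tprod_def quot_def free_vs_def vector_space_pscale)
qed

lemma scl_tprod: "scl (tprod M N) = pscale"
  by (simp add: tprod_def quot_def free_vs_def)

lemma tens_simps:
  assumes "vspace M" "vspace N"
  shows tens_in: "v \<in> car M \<Longrightarrow> w \<in> car N \<Longrightarrow> tens M N v w \<in> car (tprod M N)"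
    and tens_add_left: "v \<in> car M \<Longrightarrow> v' \<in> car M \<Longrightarrow> w \<in> car N \<Longrightarrow> tens M N (v + v') w = tens M N v w + tens M N v' w"
    and tens_add_right: "v \<in> car M \<Longrightarrow> w \<in> car N \<Longrightarrow> w' \<in> car N \<Longrightarrow> tens M N v (w + w') = tens M N v w + tens M N v w'"
    and tens_scale_left: "v \<in> car M \<Longrightarrow> w \<in> car N \<Longrightarrow> tens M N (scl M c v) w = pscale c (tens M N v w)"
    and tens_scale_right: "v \<in> car M \<Longrightarrow> w \<in> car N \<Longrightarrow> tens M N v (scl N c w) = pscale c (tens M N v w)"
  using tens_bilin[OF assms] by (simp_all add: bilin_def vlin_def scl_tprod image_subset_iff)

lemma tens_zero:
  assumes "vspace M" "vspace N"
  shows tens_zero_left: "w \<in> car N \<Longrightarrow> tens M N 0 w = 0"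
    and tens_zero_right: "v \<in> car M \<Longrightarrow> tens M N v 0 = 0"
  using tens_add_left[OF assms vspace_0[OF assms(1)] vspace_0[OF assms(1)], of w]
    tens_add_right[OF assms _ vspace_0[OF assms(2)] vspace_0[OF assms(2)], of v] by auto

lemma tens_sum_left:
  assumes "vspace M" "vspace N" "\<And>i. i \<in> I \<Longrightarrow> f i \<in> car M" "w \<in> car N"
  shows "tens M N (\<Sum>i\<in>I. f i) w = (\<Sum>i\<in>I. tens M N (f i) w)"
  using assms(3) by (induction I rule: infinite_finite_induct)
    (simp_all add: tens_zero[OF assms(1,2)] assms tens_add_left[OF assms(1,2)] vspace_sum[OF assms(1)])

lemma tens_sum_right:
  assumes "vspace M" "vspace N" "\<And>i. i \<in> I \<Longrightarrow> f i \<in> car N" "v \<in> car M"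
  shows "tens M N v (\<Sum>i\<in>I. f i) = (\<Sum>i\<in>I. tens M N v (f i))"
  using assms(3) by (induction I rule: infinite_finite_induct)
    (simp_all add: tens_zero[OF assms(1,2)] assms tens_add_right[OF assms(1,2)] vspace_sum[OF assms(2)])

lemma tens_lin_left: "vspace M \<Longrightarrow> vspace N \<Longrightarrow> car M = UNIV \<Longrightarrow> w \<in> car N \<Longrightarrow> lin (scl M) pscale (\<lambda>v. tens M N v w)"
  by (simp add: lin_iff tens_add_left tens_scale_left vs_vspace vector_space_pscale)

lemma tens_lin_right: "vspace M \<Longrightarrow> vspace N \<Longrightarrow> car N = UNIV \<Longrightarrow> v \<in> car M \<Longrightarrow> lin (scl N) pscale (\<lambda>w. tens M N v w)"
  by (simp add: lin_iff tens_add_right tens_scale_right vs_vspace vector_space_pscale)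

text \<open>The coefficients of a representative are absorbed into the left factors, so every
  element is a plain sum of pure tensors and no scaling case arises.\<close>

lemma tprod_induct [consumes 3, case_names zero add tens]:
  fixes M :: "('k::field, 'v::ab_group_add) vs" and N :: "('k, 'w::ab_group_add) vs"
  assumes "vspace M" "vspace N" "t \<in> car (tprod M N)"
    and zero: "P 0" and add: "\<And>x y. x \<in> car (tprod M N) \<Longrightarrow> y \<in> car (tprod M N) \<Longrightarrow> P x \<Longrightarrow> P y \<Longrightarrow> P (x + y)"
    and tens: "\<And>v w. v \<in> car M \<Longrightarrow> w \<in> car N \<Longrightarrow> P (tens M N v w)"
  shows "P t"
proof -
  have l: "lin pscale pscale (cls pscale (tens_rel M N))"
    by (rule lin_cls[OF vector_space_pscale subspace_tens_rel])
  obtain u where u: "Poly_Mapping.keys u \<subseteq> car M \<times> car N" "t = cls pscale (tens_rel M N) u"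
    using assms(3) by (auto simp: tprod_def quot_def free_vs_def)
  define c where "c = Poly_Mapping.lookup u"
  have "u = (\<Sum>p\<in>Poly_Mapping.keys u. Poly_Mapping.single p (c p))"
    by (rule poly_mapping_eqI) (simp add: c_def lookup_sum lookup_single when_def in_keys_iff)
  also have "\<dots> = (\<Sum>p\<in>Poly_Mapping.keys u. pscale (c p) (gen (fst p) (snd p)))"
    by (intro sum.cong refl poly_mapping_eqI) (simp add: lookup_single when_def)
  finally have "t = (\<Sum>p\<in>Poly_Mapping.keys u. pscale (c p) (tens M N (fst p) (snd p)))"
    unfolding u(2) tens_def by (metis (no_types, lifting) lin_sum[OF l] lin_scale[OF l] prod.collapse sum.cong)
  also have "\<dots> = (\<Sum>p\<in>Poly_Mapping.keys u. tens M N (scl M (c p) (fst p)) (snd p))"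
    using u(1) by (intro sum.cong refl) (auto simp: tens_scale_left[OF assms(1,2)])
  finally have t: "t = (\<Sum>p\<in>Poly_Mapping.keys u. tens M N (scl M (c p) (fst p)) (snd p))" .
  \<comment> \<open>Membership is carried along because \<open>add\<close> applies only to elements
    of the carrier.\<close>
  have "(\<Sum>p\<in>K. tens M N (scl M (c p) (fst p)) (snd p)) \<in> car (tprod M N) \<and> P (\<Sum>p\<in>K. tens M N (scl M (c p) (fst p)) (snd p))"
    if "finite K" "K \<subseteq> car M \<times> car N" for K
    using that
  proof (induction K rule: finite_induct)
    case empty
    then show ?case using zero vspace_0[OF vspace_tprod] by auto
  next
    case (insert p K)
    then have "tens M N (scl M (c p) (fst p)) (snd p) \<in> car (tprod M N)" "P (tens M N (scl M (c p) (fst p)) (snd p))"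
      by (auto intro!: tens tens_in assms(1,2) vspace_scl)
    with insert show ?case by (auto intro!: add vspace_add[OF vspace_tprod])
  qed
  from this[of "Poly_Mapping.keys u"] u(1) show ?thesis by (simp add: t[symmetric])
qed

lemma tprod_eqI:
  assumes "vspace M" "vspace N" "t \<in> car (tprod M N)" "lin pscale s f" "lin pscale s g"
    and "\<And>v w. v \<in> car M \<Longrightarrow> w \<in> car N \<Longrightarrow> f (tens M N v w) = g (tens M N v w)"
  shows "f t = g t"
  using assms(1-3)
  by (induction rule: tprod_induct)
    (simp_all add: assms(6) lin_add[OF assms(4)] lin_add[OF assms(5)] lin_zero[OF assms(4)] lin_zero[OF assms(5)])

text \<open>Agreement on the carriers makes \<open>g\<close> bilinear there as well. Both extensions
  can then be evaluated on pure tensors, and these determine them.\<close>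

lemma lin_ext_cong:
  assumes "vspace M" "vspace N" "t \<in> car (tprod M N)" "vector_space s" "bilin M N (uvs s) f"
    and fg: "\<And>v w. v \<in> car M \<Longrightarrow> w \<in> car N \<Longrightarrow> f v w = g v w"
  shows "lin_ext s f t = lin_ext s g t"
proof (rule tprod_eqI[OF assms(1-3) linear_lin_ext[OF assms(4)] linear_lin_ext[OF assms(4)]])
  fix v w assume vw: "v \<in> car M" "w \<in> car N"
  have "bilin M N (uvs s) g"
    unfolding bilin_def vlin_def
    using assms(5) vspace_add[OF assms(1)] vspace_add[OF assms(2)] vspace_scl[OF assms(1)] vspace_scl[OF assms(2)]
    by (simp add: bilin_def vlin_def fg[symmetric])
  then show "lin_ext s f (tens M N v w) = lin_ext s g (tens M N v w)"
    using lin_ext_tens[where X="uvs s" and f=f and M=M and N=N] lin_ext_tens[where X="uvs s" and f=g and M=M and N=N] assms fg[OF vw] by simp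
qed

lemma lin_ext_eval:
  assumes "vspace M" "vspace N" "vector_space s"
    and "\<And>a. a \<in> car M \<Longrightarrow> lin (scl N) s (f a)" "\<And>b. b \<in> car N \<Longrightarrow> lin (scl M) s (\<lambda>a. f a b)"
  shows "lin_ext s f (tens M N v w) = f v w"
  using lin_ext_tens[where X="uvs s" and f=f and M=M and N=N and v=v and w=w, OF _ bilin_uvs] assms by simp

section \<open>Sweedler calculus\<close>

context hopf_algebra
begin

lemma vspace_hvs: "vspace (hvs H)"
  unfolding hvs_def by (rule vspace_uvs[OF vs])

lemma scl_hvs [simp]: "scl (hvs H) = hscale H" and car_hvs [simp]: "car (hvs H) = UNIV"
  by (simp_all add: hvs_def)

lemma vspace_hh: "vspace (hh H)"
  by (rule vspace_tprod)

lemma lin_mult_left: "lin r (hscale H) f \<Longrightarrow> lin r (hscale H) (\<lambda>x. c * f x)"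
  and lin_mult_right: "lin r (hscale H) f \<Longrightarrow> lin r (hscale H) (\<lambda>x. f x * c)"
  using mult by (simp_all add: lin_iff bilin_def vlin_def)

lemma lin_comult: "lin (hscale H) pscale (comult H)"
  using comult_linear by (simp add: lin_iff vlin_def scl_tprod vs vector_space_pscale)

lemma comult_in: "comult H h \<in> car (hh H)"
  using comult_linear by (auto simp: vlin_def)

lemma lin_counit: "lin r (hscale H) f \<Longrightarrow> lin r (*) (\<lambda>x. counit H (f x))"
  using counit_linear by (simp add: lin_iff vlin_def vector_space_mult)

lemma lin_antipode: "lin r (hscale H) f \<Longrightarrow> lin r (hscale H) (\<lambda>x. antipode H (f x))"
  using antipode_linear by (simp add: lin_iff vlin_def)

lemma hscale_mult: "hscale H c a * b = hscale H c (a * b)" "a * hscale H c b = hscale H c (a * b)"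
  using lin_scale[OF lin_mult_left[OF lin_id[OF vs]]] lin_scale[OF lin_mult_right[OF lin_id[OF vs]]] by auto

lemma lin_sw: "lin r (hscale H) g \<Longrightarrow> vector_space s \<Longrightarrow> lin r s (\<lambda>x. sw H s f (g x))"
  unfolding sw_def by (intro lin_lin_ext lin_compose[OF _ lin_comult])

lemma lin_sw_fun: "vector_space r \<Longrightarrow> vector_space s \<Longrightarrow> (\<And>a b. lin r s (\<lambda>x. f x a b)) \<Longrightarrow> lin r s (\<lambda>x. sw H s (f x) h)"
  unfolding sw_def by (rule lin_lin_ext_fun)

lemma lin_sw3: "lin r (hscale H) g \<Longrightarrow> vector_space s \<Longrightarrow> lin r s (\<lambda>x. sw3 H s f (g x))"
  unfolding sw3_def by (rule lin_sw)

lemma lin_htens_left: "lin r (hscale H) f \<Longrightarrow> lin r pscale (\<lambda>x. htens H (f x) b)"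
  and lin_htens_right: "lin r (hscale H) f \<Longrightarrow> lin r pscale (\<lambda>x. htens H a (f x))"
  using lin_compose[OF _ tens_lin_left[OF vspace_hvs vspace_hvs]] lin_compose[OF _ tens_lin_right[OF vspace_hvs vspace_hvs]]
  by auto

text \<open>Almost every rearrangement of a Sweedler sum rests on linearity in each slot; these
  introduction rules derive it from the shape of the term.\<close>

lemmas lin_intros = lin_id lin_fadd lin_fdiff lin_fsum lin_fscale lin_vec lin_mult_left lin_mult_right lin_counit
  lin_antipode lin_sw lin_sw_fun lin_sw3 lin_htens_left lin_htens_right lin_lin_ext lin_lin_ext_fun
  vs vector_space_mult vector_space_pscale

lemma sw_cong: "(\<And>a b. f a b = g a b) \<Longrightarrow> sw H s f h = sw H s g h"
  by presburger

lemma sw_of_lin: "lin s t L \<Longrightarrow> L (sw H s f h) = sw H t (\<lambda>a b. L (f a b)) h"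
  unfolding sw_def by (rule lin_of_lin_ext)

lemma sw_swap:
  "vector_space s \<Longrightarrow> sw H s (\<lambda>a b. sw H s (\<lambda>c d. f a b c d) u) t = sw H s (\<lambda>c d. sw H s (\<lambda>a b. f a b c d) t) u"
  unfolding sw_def by (rule lin_ext_swap)

lemma sw_fun_simps:
  assumes "vector_space s"
  shows sw_fdiff: "sw H s (\<lambda>a b. f a b - g a b) h = sw H s f h - sw H s g h"
    and sw_fzero: "sw H s (\<lambda>a b. 0) h = 0"
    and sw_fscale: "sw H s (\<lambda>a b. s c (f a b)) h = s c (sw H s f h)"
  unfolding sw_def by (simp_all add: lin_ext_fun_simps[OF assms])

lemma sw_fsum: "vector_space s \<Longrightarrow> sw H s (\<lambda>a b. \<Sum>i\<in>I. f i a b) h = (\<Sum>i\<in>I. sw H s (f i) h)"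
  unfolding sw_def by (rule lin_ext_fsum)

lemma lin_ext_htens:
  assumes "vector_space s" "\<And>a. lin (hscale H) s (f a)" "\<And>b. lin (hscale H) s (\<lambda>a. f a b)"
  shows "lin_ext s f (htens H a b) = f a b"
  by (rule lin_ext_eval[OF vspace_hvs vspace_hvs]) (simp_all add: assms)

lemma hh_eqI:
  assumes "t \<in> car (hh H)" "lin pscale s f" "lin pscale s g" "\<And>a b. f (htens H a b) = g (htens H a b)"
  shows "f t = g t"
  by (rule tprod_eqI[OF vspace_hvs vspace_hvs assms(1-4)])

text \<open>The axiom \<open>coassoc\<close> is an equation in
  \<open>H \<otimes> (H \<otimes> H)\<close>. A trilinear \<open>f\<close> induces the linear map
  \<open>lin_ext s ?F\<close> on that space, and applying it transports the equation to an arbitrary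
  target.\<close>

lemma sw_assoc:
  assumes s: "vector_space s"
    and l1: "\<And>b c. lin (hscale H) s (\<lambda>a. f a b c)" and l2: "\<And>a c. lin (hscale H) s (\<lambda>b. f a b c)"
    and l3: "\<And>a b. lin (hscale H) s (\<lambda>c. f a b c)"
  shows "sw H s (\<lambda>a b. sw H s (\<lambda>a1 a2. f a1 a2 b) a) h = sw H s (\<lambda>a b. sw H s (\<lambda>b1 b2. f a b1 b2) b) h"
proof -
  let ?F = "\<lambda>x t. lin_ext s (f x) t"
  have L: "lin pscale s (lin_ext s ?F)" by (rule linear_lin_ext[OF s])
  have e: "lin_ext s ?F (tens (hvs H) (hh H) a t) = lin_ext s (f a) t" for a t
    by (rule lin_ext_eval[OF vspace_hvs vspace_hh s])
      (auto simp: scl_tprod intro!: linear_lin_ext[OF s] lin_lin_ext_fun s vs l1)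
  have "sw H s (\<lambda>a b. sw H s (\<lambda>a1 a2. f a1 a2 b) a) h
      = sw H s (\<lambda>a b. sw H s (\<lambda>a1 a2. lin_ext s ?F (tens (hvs H) (hh H) a1 (htens H a2 b))) a) h"
    by (intro sw_cong) (simp add: e lin_ext_htens[OF s l3 l2])
  also have "\<dots> = lin_ext s ?F (sw H pscale (\<lambda>a b. sw H pscale (\<lambda>a1 a2. tens (hvs H) (hh H) a1 (htens H a2 b)) a) h)"
    by (simp add: sw_of_lin[OF L])
  also have "\<dots> = sw H s (\<lambda>a b. lin_ext s ?F (tens (hvs H) (hh H) a (comult H b))) h"
    unfolding coassoc by (rule sw_of_lin[OF L])
  finally show ?thesis by (simp add: e sw_def)
qed

lemma sw_counit_left: "lin (hscale H) s f \<Longrightarrow> sw H s (\<lambda>a b. s (counit H a) (f b)) h = f h"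
  using sw_of_lin[of "hscale H" s f "\<lambda>h1 h2. hscale H (counit H h1) h2" h] by (simp add: counit_left lin_scale)

lemma sw_counit_right: "lin (hscale H) s f \<Longrightarrow> sw H s (\<lambda>a b. s (counit H b) (f a)) h = f h"
  using sw_of_lin[of "hscale H" s f "\<lambda>h1 h2. hscale H (counit H h2) h1" h] by (simp add: counit_right lin_scale)

lemma sw_antipode_left: "lin (hscale H) s f \<Longrightarrow> sw H s (\<lambda>a b. f (antipode H a * b)) h = s (counit H h) (f 1)"
  using sw_of_lin[of "hscale H" s f "\<lambda>h1 h2. antipode H h1 * h2" h] by (simp add: antipode_left lin_scale)

lemma sw_antipode_right: "lin (hscale H) s f \<Longrightarrow> sw H s (\<lambda>a b. f (a * antipode H b)) h = s (counit H h) (f 1)"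
  using sw_of_lin[of "hscale H" s f "\<lambda>h1 h2. h1 * antipode H h2" h] by (simp add: antipode_right lin_scale)

lemma sw_one:
  assumes "vector_space s" "\<And>a. lin (hscale H) s (f a)" "\<And>b. lin (hscale H) s (\<lambda>a. f a b)"
  shows "sw H s f 1 = f 1 1"
  unfolding sw_def comult_one by (rule lin_ext_htens[OF assms])

lemma sw_mult:
  assumes "vector_space s" "\<And>a. lin (hscale H) s (f a)" "\<And>b. lin (hscale H) s (\<lambda>a. f a b)"
  shows "sw H s f (a * b) = sw H s (\<lambda>a1 a2. sw H s (\<lambda>b1 b2. f (a1 * b1) (a2 * b2)) b) a"
proof -
  note L = linear_lin_ext[OF assms(1), of f]
  show ?thesis
    unfolding sw_def[of H s f] comult_mult by (simp add: sw_of_lin[OF L] lin_ext_htens[OF assms])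
qed

text \<open>Apply the multiplicative map \<open>\<epsilon>\<close> to
  \<open>S(h1) h2 = \<epsilon>(h) 1\<close> and absorb the factor \<open>\<epsilon>(h2)\<close> by
  the counit axiom.\<close>

lemma counit_antipode: "counit H (antipode H h) = counit H h"
proof -
  have "counit H h = sw H (*) (\<lambda>a b. counit H (antipode H a * b)) h"
    using sw_antipode_left[OF lin_counit[OF lin_id[OF vs]], of h] by (simp add: counit_one)
  also have "\<dots> = sw H (*) (\<lambda>a b. counit H b * counit H (antipode H a)) h"
    by (simp add: counit_mult mult.commute)
  also have "\<dots> = counit H (antipode H h)"
    by (rule sw_counit_right) (intro lin_intros)
  finally show ?thesis by simp
qed

text \<open>Both sides are convolution inverse to \<open>\<Delta>\<close>.\<close>

lemma sw_antipode:
  assumes s: "vector_space s" and f1: "\<And>a. lin (hscale H) s (f a)" and f2: "\<And>b. lin (hscale H) s (\<lambda>a. f a b)"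
  shows "sw H s f (antipode H h) = sw H s (\<lambda>a b. f (antipode H b) (antipode H a)) h"
proof -
  let ?S = "antipode H"
  \<comment> \<open>This says
    \<open>\<Delta>(S h1) \<Delta>(h2) = \<epsilon>(h) 1 \<otimes> 1\<close>, and \<open>L2\<close>
    is the analogue for \<open>\<Delta>(a)\<close> times \<open>S b2 \<otimes> S b1\<close>. The
    product of \<open>H \<otimes> H\<close> is written out inside a bilinear test function
    \<open>g\<close>.\<close>
  have L1: "sw H s (\<lambda>a b. sw H s (\<lambda>p q. sw H s (\<lambda>r t. g (p * r) (q * t)) b) (?S a)) h = s (counit H h) (g 1 1)"
    if g: "\<And>a. lin (hscale H) s (g a)" "\<And>b. lin (hscale H) s (\<lambda>a. g a b)" for g h
    by (simp add: sw_mult[OF s g, symmetric] sw_antipode_left[OF lin_sw[OF lin_id[OF vs] s]] sw_one[OF s g])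
  have L2: "sw H s (\<lambda>a b. sw H s (\<lambda>a1 a2. sw H s (\<lambda>b1 b2. g (a1 * ?S b2) (a2 * ?S b1)) b) a) h = s (counit H h) (g 1 1)"
    if g: "\<And>a. lin (hscale H) s (g a)" "\<And>b. lin (hscale H) s (\<lambda>a. g a b)" for g h
  proof -
    note li = lin_intros s lin_compose[OF _ g(1)] lin_compose[OF _ g(2)]
    have "sw H s (\<lambda>a b. sw H s (\<lambda>a1 a2. sw H s (\<lambda>b1 b2. g (a1 * ?S b2) (a2 * ?S b1)) b) a) h
        = sw H s (\<lambda>x y. sw H s (\<lambda>y1 y2. sw H s (\<lambda>b1 b2. g (x * ?S b2) (y1 * ?S b1)) y2) y) h"
      by (rule sw_assoc[OF s]) (intro li)+
    also have "\<dots> = sw H s (\<lambda>x y. sw H s (\<lambda>c d. sw H s (\<lambda>c1 c2. g (x * ?S d) (c1 * ?S c2)) c) y) h"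
      by (intro sw_cong sw_assoc[OF s, symmetric] li)
    also have "\<dots> = sw H s (\<lambda>x y. sw H s (\<lambda>c d. s (counit H c) (g (x * ?S d) 1)) y) h"
      by (intro sw_cong sw_antipode_right g)
    also have "\<dots> = sw H s (\<lambda>x y. g (x * ?S y) 1) h"
      by (intro sw_cong sw_counit_left li)
    also have "\<dots> = s (counit H h) (g 1 1)"
      by (intro sw_antipode_right g)
    finally show ?thesis .
  qed
  note li = lin_intros s lin_compose[OF _ f1] lin_compose[OF _ f2]
  \<comment> \<open>A left and a right inverse coincide: \<open>\<epsilon>(b)\<close> is replaced by
    means of the right inverse \<open>L2\<close>, the sum is rebracketed, and the left inverse
    \<open>L1\<close> cancels.\<close>
  have "sw H s f (?S h) = sw H s (\<lambda>a b. s (counit H b) (sw H s f (?S a))) h"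
    by (rule sw_counit_right[symmetric]) (intro li)
  also have "\<dots> = sw H s (\<lambda>a b. sw H s (\<lambda>p q. s (counit H b) (f p q)) (?S a)) h"
    by (simp add: sw_fscale[OF s])
  also have "\<dots> = sw H s (\<lambda>a b. sw H s (\<lambda>p q. sw H s (\<lambda>c d. sw H s (\<lambda>c1 c2. sw H s (\<lambda>d1 d2.
      f (p * (c1 * ?S d2)) (q * (c2 * ?S d1))) d) c) b) (?S a)) h"
    by (intro sw_cong, subst L2[where g="\<lambda>x y. f (_ * x) (_ * y)"]) (intro li | simp)+
  also have "\<dots> = sw H s (\<lambda>a b. sw H s (\<lambda>c d. sw H s (\<lambda>p q. sw H s (\<lambda>c1 c2. sw H s (\<lambda>d1 d2.
      f (p * (c1 * ?S d2)) (q * (c2 * ?S d1))) d) c) (?S a)) b) h"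
    by (intro sw_cong sw_swap s)
  also have "\<dots> = sw H s (\<lambda>a d. sw H s (\<lambda>a c. sw H s (\<lambda>p q. sw H s (\<lambda>c1 c2. sw H s (\<lambda>d1 d2.
      f (p * (c1 * ?S d2)) (q * (c2 * ?S d1))) d) c) (?S a)) a) h"
    by (rule sw_assoc[OF s, symmetric]) (intro li)+
  also have "\<dots> = sw H s (\<lambda>a d. sw H s (\<lambda>a c. sw H s (\<lambda>p q. sw H s (\<lambda>c1 c2. sw H s (\<lambda>d1 d2.
      f ((p * c1) * ?S d2) ((q * c2) * ?S d1)) d) c) (?S a)) a) h"
    by (simp add: mult.assoc)
  also have "\<dots> = sw H s (\<lambda>a d. s (counit H a) (sw H s (\<lambda>d1 d2. f (1 * ?S d2) (1 * ?S d1)) d)) h"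
    by (intro sw_cong L1 li)
  also have "\<dots> = sw H s (\<lambda>a b. f (?S b) (?S a)) h"
    by (subst sw_counit_left) (intro li | simp)+
  finally show ?thesis .
qed

lemma sw3_of_lin: "lin s t L \<Longrightarrow> L (sw3 H s f h) = sw3 H t (\<lambda>a b c. L (f a b c)) h"
  unfolding sw3_def by (subst sw_of_lin, assumption) (intro sw_cong sw_of_lin)

lemma sw3_fdiff: "vector_space s \<Longrightarrow> sw3 H s (\<lambda>a b c. f a b c - g a b c) h = sw3 H s f h - sw3 H s g h"
  unfolding sw3_def by (subst sw_fdiff[symmetric], assumption) (intro sw_cong sw_fdiff)

lemma sw3_fsum: "vector_space s \<Longrightarrow> sw3 H s (\<lambda>a b c. \<Sum>i\<in>I. f i a b c) h = (\<Sum>i\<in>I. sw3 H s (f i) h)"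
  unfolding sw3_def by (subst sw_fsum[symmetric], assumption) (intro sw_cong sw_fsum)

end

section \<open>Spanning families and linear identities on tensor products\<close>

definition spanned :: "('k::field, 'v::ab_group_add) vs \<Rightarrow> 'i set \<Rightarrow> ('i \<Rightarrow> 'v) \<Rightarrow> bool" where
  "spanned M I b \<longleftrightarrow> (\<forall>i\<in>I. b i \<in> car M) \<and> (\<forall>v\<in>car M. \<exists>c. v = (\<Sum>i\<in>I. scl M (c i) (b i)))"

lemma spanned_eqI:
  assumes "spanned M I b" "lin (scl M) s f" "lin (scl M) s g" "\<And>i. i \<in> I \<Longrightarrow> f (b i) = g (b i)" "v \<in> car M"
  shows "f v = g v"
proof -
  obtain c where "v = (\<Sum>i\<in>I. scl M (c i) (b i))" using assms(1,5) unfolding spanned_def by blast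
  then show ?thesis
    by (simp add: lin_sum[OF assms(2)] lin_sum[OF assms(3)] lin_scale[OF assms(2)] lin_scale[OF assms(3)] assms(4))
qed

lemma tprod_spanned_eqI:
  assumes M: "vspace M" "spanned M I b" and N: "vspace N" "spanned N J c"
    and fg: "lin pscale s f" "lin pscale s g" "\<And>i j. i \<in> I \<Longrightarrow> j \<in> J \<Longrightarrow> f (tens M N (b i) (c j)) = g (tens M N (b i) (c j))"
    and t: "t \<in> car (tprod M N)"
  shows "f t = g t"
proof (rule tprod_eqI[OF M(1) N(1) t fg(1,2)])
  fix v w assume vw: "v \<in> car M" "w \<in> car N"
  obtain x y where x: "v = (\<Sum>i\<in>I. scl M (x i) (b i))" and y: "w = (\<Sum>j\<in>J. scl N (y j) (c j))"
    using M(2) N(2) vw unfolding spanned_def by blast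
  have bc: "i \<in> I \<Longrightarrow> b i \<in> car M" "j \<in> J \<Longrightarrow> c j \<in> car N" for i j using M(2) N(2) unfolding spanned_def by auto
  have "tens M N v w = (\<Sum>i\<in>I. tens M N (scl M (x i) (b i)) w)"
    unfolding x by (rule tens_sum_left[OF M(1) N(1)]) (simp_all add: vspace_scl[OF M(1)] bc vw)
  also have "\<dots> = (\<Sum>i\<in>I. pscale (x i) (\<Sum>j\<in>J. pscale (y j) (tens M N (b i) (c j))))"
  proof (intro sum.cong refl)
    fix i assume i: "i \<in> I"
    have "tens M N (b i) w = (\<Sum>j\<in>J. tens M N (b i) (scl N (y j) (c j)))"
      unfolding y by (rule tens_sum_right[OF M(1) N(1)]) (simp_all add: vspace_scl[OF N(1)] bc i)
    then show "tens M N (scl M (x i) (b i)) w = pscale (x i) (\<Sum>j\<in>J. pscale (y j) (tens M N (b i) (c j)))"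
      by (simp add: tens_scale_left[OF M(1) N(1)] tens_scale_right[OF M(1) N(1)] bc i vw)
  qed
  finally have e: "tens M N v w = (\<Sum>i\<in>I. pscale (x i) (\<Sum>j\<in>J. pscale (y j) (tens M N (b i) (c j))))" .
  show "f (tens M N v w) = g (tens M N v w)"
    unfolding e by (simp add: lin_sum[OF fg(1)] lin_sum[OF fg(2)] lin_scale[OF fg(1)] lin_scale[OF fg(2)] fg(3))
qed

lemma lin_ext_eval_bilin:
  "vspace M \<Longrightarrow> vspace N \<Longrightarrow> vector_space s \<Longrightarrow> bilin M N (uvs s) f \<Longrightarrow> lin_ext s f (tens M N v w) = f v w"
  using lin_ext_tens[where X="uvs s" and f=f and M=M and N=N] by simp

lemma lin_ext_tens_id:
  assumes M: "vspace M" and N: "vspace N" and t: "t \<in> car (tprod M N)"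
  shows "lin_ext pscale (tens M N) t = t"
proof (rule tprod_eqI[OF M N t linear_lin_ext[OF vector_space_pscale] lin_id[OF vector_space_pscale]])
  have "bilin M N (uvs pscale) (tens M N)"
    using tens_bilin[OF M N] by (auto simp: bilin_def vlin_def scl_tprod)
  then show "lin_ext pscale (tens M N) (tens M N v w) = tens M N v w" for v w
    by (rule lin_ext_eval_bilin[OF M N vector_space_pscale])
qed

abbreviation entry :: "('k::field, 'h, 'w::ab_group_add, 'i) based_comod \<Rightarrow> ('w \<Rightarrow> 'w) \<Rightarrow> 'i \<Rightarrow> 'i \<Rightarrow> 'k" where
  "entry W \<phi> \<alpha> \<beta> \<equiv> dvec W \<alpha> (\<phi> (bvec W \<beta>))"

section \<open>Comodules with a basis\<close>

locale hopf_comodule = hopf_algebra H + based_comodule H W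
  for H :: "('k::field, 'h::ring_1, 'z) hopf_scheme" and W :: "('k, 'h, 'w::ab_group_add, 'i) based_comod"
begin

lemma vspace_wvs: "vspace (wvs W)"
  using comodule by (simp add: right_comodule_def)

lemma scl_wvs [simp]: "scl (wvs W) = bscale W" and car_wvs [simp]: "car (wvs W) = UNIV"
  by (simp_all add: wvs_def)

lemma vs_W: "vector_space (bscale W)"
  using vs_vspace[OF vspace_wvs] by simp

lemma lin_bcoact: "lin (bscale W) pscale (bcoact W)"
  using comodule by (simp add: right_comodule_def lin_iff vlin_def scl_tprod vs_W vector_space_pscale)

lemma lin_dvec: "lin (bscale W) (*) (dvec W \<alpha>)"
proof -
  interpret vector_space "bscale W" by (rule vs_W)
  show ?thesis
    unfolding lin_iff dvec_def
    using independent_basis span_basis by (simp add: vs_W vector_space_mult representation_add representation_scale)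
qed

lemma basis_expand: "w = (\<Sum>\<alpha>\<in>bidx W. bscale W (dvec W \<alpha> w) (bvec W \<alpha>))"
proof -
  interpret vector_space "bscale W" by (rule vs_W)
  have "w = (\<Sum>b\<in>bvec W ` bidx W. bscale W (representation (bvec W ` bidx W) w b) b)"
    by (rule sum_representation_eq[symmetric]) (use independent_basis span_basis finite_basis in auto)
  also have "\<dots> = (\<Sum>\<alpha>\<in>bidx W. bscale W (dvec W \<alpha> w) (bvec W \<alpha>))"
    by (simp add: sum.reindex inj_basis dvec_def)
  finally show ?thesis .
qed

lemma dvec_basis: "\<alpha> \<in> bidx W \<Longrightarrow> \<beta> \<in> bidx W \<Longrightarrow> dvec W \<alpha> (bvec W \<beta>) = (if \<alpha> = \<beta> then 1 else 0)"
proof -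
  assume ab: "\<alpha> \<in> bidx W" "\<beta> \<in> bidx W"
  interpret vector_space "bscale W" by (rule vs_W)
  show ?thesis
    using representation_basis[OF independent_basis, of "bvec W \<beta>"] ab inj_basis
    by (auto simp: dvec_def inj_on_def)
qed

lemma sum_delta_k: "i \<in> bidx W \<Longrightarrow> (\<Sum>j\<in>bidx W. (if i = j then 1 else 0) * f j) = (f i :: 'k)"
  "i \<in> bidx W \<Longrightarrow> (\<Sum>j\<in>bidx W. (if j = i then 1 else 0) * f j) = (f i :: 'k)"
  "i \<in> bidx W \<Longrightarrow> (\<Sum>j\<in>bidx W. f j * (if i = j then 1 else 0)) = (f i :: 'k)"
  "i \<in> bidx W \<Longrightarrow> (\<Sum>j\<in>bidx W. f j * (if j = i then 1 else 0)) = (f i :: 'k)"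
  using finite_basis by (simp_all add: if_distrib[of "\<lambda>x. x * _"] if_distrib[of "\<lambda>x. _ * x"] cong: if_cong)

lemma sum_delta_vs:
  assumes "vector_space s" "i \<in> bidx W"
  shows "(\<Sum>j\<in>bidx W. s (if i = j then 1 else 0) (f j)) = f i" "(\<Sum>j\<in>bidx W. s (if j = i then 1 else 0) (f j)) = f i"
  using finite_basis assms(2) by (simp_all add: scale_if[OF assms(1)] sum.delta sum.delta')

lemma vs_End: "vector_space (scl (End W))"
proof -
  interpret vector_space "bscale W" by (rule vs_W)
  show ?thesis by unfold_locales (auto simp: End_def fun_eq_iff algebra_simps)
qed

lemma End_scale: "scl (End W) c \<phi> x = bscale W c (\<phi> x)"
  by (simp add: End_def)

lemma in_End: "\<phi> \<in> car (End W) \<longleftrightarrow> lin (bscale W) (bscale W) \<phi>"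
  by (simp add: End_def)

lemma vspace_End: "vspace (End W)"
proof -
  interpret vector_space "scl (End W)" by (rule vs_End)
  show ?thesis
    unfolding vspace_def
  proof (intro conjI vs_End subspaceI)
    show "0 \<in> car (End W)" using lin_fzero[OF vs_W vs_W] by (simp add: in_End zero_fun_def)
    show "x + y \<in> car (End W)" if "x \<in> car (End W)" "y \<in> car (End W)" for x y
      using that by (simp add: in_End plus_fun_def lin_fadd)
    show "scl (End W) c x \<in> car (End W)" if "x \<in> car (End W)" for c x
      using lin_fscale[of _ _ x c] that by (simp add: in_End End_def)
  qed
qed

lemma lin_entry: "lin (scl (End W)) (*) (\<lambda>\<phi>. entry W \<phi> \<alpha> \<beta>)"
  by (simp add: lin_iff vs_End vector_space_mult lin_add[OF lin_dvec] lin_scale[OF lin_dvec] End_scale)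

lemma End_eqI:
  assumes "\<phi> \<in> car (End W)" "\<psi> \<in> car (End W)"
    "\<And>\<alpha> \<beta>. \<alpha> \<in> bidx W \<Longrightarrow> \<beta> \<in> bidx W \<Longrightarrow> entry W \<phi> \<alpha> \<beta> = entry W \<psi> \<alpha> \<beta>"
  shows "\<phi> = \<psi>"
proof
  have b: "\<phi> (bvec W \<beta>) = \<psi> (bvec W \<beta>)" if "\<beta> \<in> bidx W" for \<beta>
    using basis_expand[of "\<phi> (bvec W \<beta>)"] basis_expand[of "\<psi> (bvec W \<beta>)"] assms(3)[OF _ that] by (metis (no_types, lifting) sum.cong)
  have l: "lin (bscale W) (bscale W) \<phi>" "lin (bscale W) (bscale W) \<psi>" using assms by (simp_all add: in_End)
  have "\<phi> (\<Sum>\<alpha>\<in>bidx W. bscale W (dvec W \<alpha> x) (bvec W \<alpha>)) = \<psi> (\<Sum>\<alpha>\<in>bidx W. bscale W (dvec W \<alpha> x) (bvec W \<alpha>))" for x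
    by (simp add: lin_sum[OF l(1)] lin_sum[OF l(2)] lin_scale[OF l(1)] lin_scale[OF l(2)] b)
  then show "\<phi> x = \<psi> x" for x
    by (simp only: basis_expand[symmetric])
qed

lemma unit_op_in: "unit_op W p \<in> car (End W)"
  by (cases p) (simp add: in_End unit_op_def lin_vec[OF vs_W lin_dvec])

lemma unit_op_basis: "\<beta> \<in> bidx W \<Longrightarrow> \<gamma> \<in> bidx W \<Longrightarrow> unit_op W (\<alpha>, \<beta>) (bvec W \<gamma>) = (if \<beta> = \<gamma> then bvec W \<alpha> else 0)"
  by (simp add: unit_op_def dvec_basis scale_if[OF vs_W])

lemma entry_unit_op:
  "\<alpha> \<in> bidx W \<Longrightarrow> \<beta> \<in> bidx W \<Longrightarrow> a \<in> bidx W \<Longrightarrow> b \<in> bidx W \<Longrightarrow>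
   entry W (unit_op W (a, b)) \<alpha> \<beta> = (if \<alpha> = a then 1 else 0) * (if b = \<beta> then 1 else 0)"
  by (simp add: unit_op_basis dvec_basis lin_zero[OF lin_dvec])

lemma mat_op_in: "mat_op W m \<in> car (End W)"
  unfolding mat_op_def by (intro vspace_sum[OF vspace_End] vspace_scl[OF vspace_End] unit_op_in)

lemma entry_mat_op: "\<alpha> \<in> bidx W \<Longrightarrow> \<beta> \<in> bidx W \<Longrightarrow> entry W (mat_op W m) \<alpha> \<beta> = m \<alpha> \<beta>"
  unfolding mat_op_def
  by (subst lin_sum[OF lin_entry], subst lin_sum[OF lin_entry], subst lin_scale[OF lin_entry])
    (simp add: entry_unit_op mult.assoc[symmetric] sum_delta_k)

lemma End_expand: "\<phi> \<in> car (End W) \<Longrightarrow> \<phi> = mat_op W (entry W \<phi>)"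
  by (rule End_eqI) (simp_all add: mat_op_in entry_mat_op)

lemma spanned_W: "spanned (wvs W) (bidx W) (bvec W)"
  unfolding spanned_def
proof (intro conjI ballI)
  show "\<exists>c. v = (\<Sum>i\<in>bidx W. scl (wvs W) (c i) (bvec W i))" for v
    using basis_expand[of v] by (intro exI[of _ "\<lambda>\<alpha>. dvec W \<alpha> v"]) simp
qed simp

lemma spanned_End: "spanned (End W) (bidx W \<times> bidx W) (unit_op W)"
  unfolding spanned_def
proof (intro conjI ballI unit_op_in)
  fix \<phi> assume "\<phi> \<in> car (End W)"
  then show "\<exists>c. \<phi> = (\<Sum>i\<in>bidx W \<times> bidx W. scl (End W) (c i) (unit_op W i))"
    by (intro exI[of _ "\<lambda>(\<alpha>, \<beta>). entry W \<phi> \<alpha> \<beta>"], subst End_expand, assumption)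
      (simp add: mat_op_def sum.cartesian_product split_def)
qed

lemma entry_comp:
  assumes "\<phi> \<in> car (End W)"
  shows "entry W (\<phi> \<circ> \<psi>) \<alpha> \<beta> = (\<Sum>\<gamma>\<in>bidx W. entry W \<phi> \<alpha> \<gamma> * entry W \<psi> \<gamma> \<beta>)"
proof -
  have l: "lin (bscale W) (bscale W) \<phi>" using assms by (simp add: in_End)
  show ?thesis
    by (subst comp_apply, subst basis_expand[of "\<psi> (bvec W \<beta>)"])
      (simp add: lin_sum[OF l] lin_scale[OF l] lin_sum[OF lin_dvec] lin_scale[OF lin_dvec] mult.commute)
qed

lemma comp_in_End: "\<phi> \<in> car (End W) \<Longrightarrow> \<psi> \<in> car (End W) \<Longrightarrow> \<phi> \<circ> \<psi> \<in> car (End W)"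
  unfolding in_End comp_def by (rule lin_compose)

lemma id_in_End: "id \<in> car (End W)"
  using lin_id[OF vs_W] by (simp add: in_End id_def)

lemma vs_predual: "vector_space (scl (predual W))"
  by unfold_locales (auto simp: predual_def fun_eq_iff algebra_simps)

lemma in_predual: "f \<in> car (predual W) \<longleftrightarrow> lin (bscale W) (*) f"
  by (simp add: predual_def)

lemma predual_scale: "scl (predual W) c f x = c * f x"
  by (simp add: predual_def)

lemma vspace_predual: "vspace (predual W)"
proof -
  interpret vector_space "scl (predual W)" by (rule vs_predual)
  show ?thesis
    unfolding vspace_def
  proof (intro conjI vs_predual subspaceI)
    show "0 \<in> car (predual W)" using lin_fzero[OF vs_W vector_space_mult] by (simp add: in_predual zero_fun_def)
    show "x + y \<in> car (predual W)" if "x \<in> car (predual W)" "y \<in> car (predual W)" for x y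
      using that by (simp add: in_predual plus_fun_def lin_fadd)
    show "scl (predual W) c x \<in> car (predual W)" if "x \<in> car (predual W)" for c x
      using lin_fscale[of _ _ x c] that by (simp add: in_predual predual_def)
  qed
qed

lemma dvec_in: "dvec W \<alpha> \<in> car (predual W)"
  by (simp add: in_predual lin_dvec)

lemma spanned_predual: "spanned (predual W) (bidx W) (dvec W)"
  unfolding spanned_def
proof (intro conjI ballI dvec_in)
  fix f assume "f \<in> car (predual W)"
  then have l: "lin (bscale W) (*) f" by (simp add: in_predual)
  have e: "f x = (\<Sum>\<alpha>\<in>bidx W. f (bvec W \<alpha>) * dvec W \<alpha> x)" for x
    by (subst basis_expand[of x]) (simp add: lin_sum[OF l] lin_scale[OF l] mult.commute)
  show "\<exists>c. f = (\<Sum>i\<in>bidx W. scl (predual W) (c i) (dvec W i))"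
    by (intro exI[of _ "\<lambda>\<alpha>. f (bvec W \<alpha>)"] ext) (simp only: sum_fun_apply predual_scale, rule e)
qed

subsection \<open>The matrix coalgebra of the comodule\<close>

lemma lin_ext_bcoact:
  assumes "vector_space s" "\<And>u. lin (hscale H) s (f u)" "\<And>h. lin (bscale W) s (\<lambda>u. f u h)" "\<beta> \<in> bidx W"
  shows "lin_ext s f (bcoact W (bvec W \<beta>)) = (\<Sum>\<gamma>\<in>bidx W. f (bvec W \<gamma>) (bmat W \<gamma> \<beta>))"
  unfolding coact_basis[OF assms(4)]
  by (simp add: lin_sum[OF linear_lin_ext[OF assms(1)]]
      lin_ext_eval[OF vspace_wvs vspace_hvs assms(1), simplified, OF assms(2,3)])

text \<open>Take the counit axiom of the coaction at \<open>e_\<beta>\<close> and read off its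
  coordinate \<open>f^\<alpha>\<close>.\<close>

lemma counit_bmat:
  assumes "\<alpha> \<in> bidx W" "\<beta> \<in> bidx W"
  shows "counit H (bmat W \<alpha> \<beta>) = (if \<alpha> = \<beta> then 1 else 0)"
proof -
  have "(if \<alpha> = \<beta> then 1 else 0) = dvec W \<alpha> (bvec W \<beta>)" using assms by (simp add: dvec_basis)
  also have "bvec W \<beta> = lin_ext (bscale W) (\<lambda>u h. bscale W (counit H h) u) (bcoact W (bvec W \<beta>))"
    using comodule by (simp add: right_comodule_def)
  also have "\<dots> = (\<Sum>\<gamma>\<in>bidx W. bscale W (counit H (bmat W \<gamma> \<beta>)) (bvec W \<gamma>))"
    by (rule lin_ext_bcoact) (intro vs_W lin_intros assms)+
  also have "dvec W \<alpha> \<dots> = counit H (bmat W \<alpha> \<beta>)"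
    using assms by (simp add: lin_sum[OF lin_dvec] lin_scale[OF lin_dvec] dvec_basis sum_delta_k)
  finally show ?thesis by simp
qed

text \<open>Coassociativity of the coaction at \<open>e_\<beta>\<close>, with
  \<open>f^\<alpha>\<close> applied to the factor in \<open>W\<close> and \<open>f\<close> to the
  factor in \<open>H \<otimes> H\<close>: the entries of \<open>\<rho>\<close> span a matrix
  coalgebra. From here on, a Sweedler sum of a matrix coefficient becomes a finite sum over a middle
  index.\<close>

lemma sw_bmat:
  assumes s: "vector_space s" and f1: "\<And>a. lin (hscale H) s (f a)" and f2: "\<And>b. lin (hscale H) s (\<lambda>a. f a b)"
    and ab: "\<alpha> \<in> bidx W" "\<beta> \<in> bidx W"
  shows "sw H s f (bmat W \<alpha> \<beta>) = (\<Sum>\<gamma>\<in>bidx W. f (bmat W \<alpha> \<gamma>) (bmat W \<gamma> \<beta>))"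
proof -
  let ?G = "\<lambda>u t. s (dvec W \<alpha> u) (lin_ext s f t)"
  let ?t = "tens (wvs W) (hh H)"
  have L: "lin pscale s (lin_ext s ?G)" by (rule linear_lin_ext[OF s])
  have e: "lin_ext s ?G (?t u t) = ?G u t" for u t
    by (rule lin_ext_eval[OF vspace_wvs vspace_hh s])
      (auto simp: scl_tprod intro!: lin_fscale lin_vec[OF s] linear_lin_ext[OF s] lin_dvec)
  note li = lin_intros s lin_compose[OF _ f1] lin_compose[OF _ f2] lin_compose[OF _ lin_dvec] lin_compose[OF _ lin_bcoact] vs_W
  have tl: "lin (bscale W) pscale (\<lambda>u. ?t u t)" if "t \<in> car (hh H)" for t
    using tens_lin_left[OF vspace_wvs vspace_hh _ that] by simp
  have "lin_ext pscale (\<lambda>u h. lin_ext pscale (\<lambda>u0 u1. ?t u0 (htens H u1 h)) (bcoact W u)) (bcoact W (bvec W \<beta>))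
      = lin_ext pscale (\<lambda>u h. ?t u (comult H h)) (bcoact W (bvec W \<beta>))"
    using comodule by (simp add: right_comodule_def)
  then have "lin_ext s ?G (lin_ext pscale (\<lambda>u h. lin_ext pscale (\<lambda>u0 u1. ?t u0 (htens H u1 h)) (bcoact W u)) (bcoact W (bvec W \<beta>)))
      = lin_ext s ?G (lin_ext pscale (\<lambda>u h. ?t u (comult H h)) (bcoact W (bvec W \<beta>)))"
    by simp
  then have "lin_ext s (\<lambda>u h. lin_ext s (\<lambda>u0 u1. s (dvec W \<alpha> u0) (f u1 h)) (bcoact W u)) (bcoact W (bvec W \<beta>))
      = lin_ext s (\<lambda>u h. s (dvec W \<alpha> u) (sw H s f h)) (bcoact W (bvec W \<beta>))"
    by (simp add: lin_of_lin_ext[OF L] e lin_ext_htens[OF s f1 f2] sw_def)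
  moreover have "lin_ext s (\<lambda>u h. lin_ext s (\<lambda>u0 u1. s (dvec W \<alpha> u0) (f u1 h)) (bcoact W u)) (bcoact W (bvec W \<beta>))
     = (\<Sum>\<gamma>\<in>bidx W. lin_ext s (\<lambda>u0 u1. s (dvec W \<alpha> u0) (f u1 (bmat W \<gamma> \<beta>))) (bcoact W (bvec W \<gamma>)))"
    by (rule lin_ext_bcoact) (intro li ab)+
  moreover have "\<dots> = (\<Sum>\<gamma>\<in>bidx W. \<Sum>\<delta>\<in>bidx W. s (dvec W \<alpha> (bvec W \<delta>)) (f (bmat W \<delta> \<gamma>) (bmat W \<gamma> \<beta>)))"
    by (intro sum.cong refl lin_ext_bcoact li)
  moreover have "lin_ext s (\<lambda>u h. s (dvec W \<alpha> u) (sw H s f h)) (bcoact W (bvec W \<beta>))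
     = (\<Sum>\<gamma>\<in>bidx W. s (dvec W \<alpha> (bvec W \<gamma>)) (sw H s f (bmat W \<gamma> \<beta>)))"
    by (rule lin_ext_bcoact) (intro li ab)+
  ultimately show ?thesis
    using ab by (simp add: dvec_basis sum_delta_vs[OF s])
qed

text \<open>This makes the rules for \<open>sw\<close> available for the coproduct itself, as in
  \<open>comult_End\<close>.\<close>

lemma comult_sw: "comult H h = sw H pscale (htens H) h"
  unfolding sw_def by (rule lin_ext_tens_id[OF vspace_hvs vspace_hvs comult_in, symmetric])

lemma sw_antipode_bmat:
  assumes "vector_space s" "\<And>a. lin (hscale H) s (f a)" "\<And>b. lin (hscale H) s (\<lambda>a. f a b)" "\<alpha> \<in> bidx W" "\<beta> \<in> bidx W"
  shows "sw H s f (antipode H (bmat W \<alpha> \<beta>)) = (\<Sum>\<gamma>\<in>bidx W. f (antipode H (bmat W \<gamma> \<beta>)) (antipode H (bmat W \<alpha> \<gamma>)))"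
  unfolding sw_antipode[OF assms(1-3)]
  by (rule sw_bmat) (intro assms lin_intros lin_compose[OF _ assms(2)] lin_compose[OF _ assms(3)])+

text \<open>The antipode axiom at a matrix coefficient: \<open>S\<rho>\<close> is the inverse of
  \<open>\<rho>\<close> as a matrix over \<open>H\<close>. This cancellation makes evaluation
  equivariant.\<close>

lemma antipode_bmat_left:
  assumes "\<alpha> \<in> bidx W" "\<beta> \<in> bidx W"
  shows "(\<Sum>\<gamma>\<in>bidx W. antipode H (bmat W \<alpha> \<gamma>) * bmat W \<gamma> \<beta>) = (if \<alpha> = \<beta> then 1 else 0)"
proof -
  have "sw H (hscale H) (\<lambda>a b. antipode H a * b) (bmat W \<alpha> \<beta>) = (if \<alpha> = \<beta> then 1 else 0)"
    by (simp only: antipode_left counit_bmat[OF assms] scale_if[OF vs])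
  moreover have "sw H (hscale H) (\<lambda>a b. antipode H a * b) (bmat W \<alpha> \<beta>)
      = (\<Sum>\<gamma>\<in>bidx W. antipode H (bmat W \<alpha> \<gamma>) * bmat W \<gamma> \<beta>)"
    by (rule sw_bmat) (intro lin_intros assms)+
  ultimately show ?thesis by simp
qed

lemma antipode_bmat_right:
  assumes "\<alpha> \<in> bidx W" "\<beta> \<in> bidx W"
  shows "(\<Sum>\<gamma>\<in>bidx W. bmat W \<alpha> \<gamma> * antipode H (bmat W \<gamma> \<beta>)) = (if \<alpha> = \<beta> then 1 else 0)"
proof -
  have "sw H (hscale H) (\<lambda>a b. a * antipode H b) (bmat W \<alpha> \<beta>) = (if \<alpha> = \<beta> then 1 else 0)"
    by (simp only: antipode_right counit_bmat[OF assms] scale_if[OF vs])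
  moreover have "sw H (hscale H) (\<lambda>a b. a * antipode H b) (bmat W \<alpha> \<beta>)
      = (\<Sum>\<gamma>\<in>bidx W. bmat W \<alpha> \<gamma> * antipode H (bmat W \<gamma> \<beta>))"
    by (rule sw_bmat) (intro lin_intros assms)+
  ultimately show ?thesis by simp
qed

text \<open>\<open>\<Delta>\<close> is multiplicative and \<open>S\<close> reverses it, so the
  coefficients of \<open>End W\<close> form a matrix coalgebra again, indexed by pairs. This is
  coassociativity of \<open>End_coact\<close> in coordinates.\<close>

lemma comult_End:
  assumes "a \<in> bidx W" "\<alpha> \<in> bidx W" "\<beta> \<in> bidx W" "b \<in> bidx W"
  shows "comult H (bmat W a \<alpha> * antipode H (bmat W \<beta> b))
    = (\<Sum>c\<in>bidx W. \<Sum>d\<in>bidx W. htens H (bmat W a c * antipode H (bmat W d b)) (bmat W c \<alpha> * antipode H (bmat W \<beta> d)))"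
proof -
  have "comult H (bmat W a \<alpha> * antipode H (bmat W \<beta> b))
    = sw H pscale (\<lambda>a1 a2. sw H pscale (\<lambda>b1 b2. htens H (a1 * b1) (a2 * b2)) (antipode H (bmat W \<beta> b))) (bmat W a \<alpha>)"
    unfolding comult_sw by (rule sw_mult) (intro lin_intros)+
  also have "\<dots> = (\<Sum>c\<in>bidx W. sw H pscale (\<lambda>b1 b2. htens H (bmat W a c * b1) (bmat W c \<alpha> * b2)) (antipode H (bmat W \<beta> b)))"
    by (rule sw_bmat) (intro lin_intros assms)+
  also have "\<dots> = (\<Sum>c\<in>bidx W. \<Sum>d\<in>bidx W. htens H (bmat W a c * antipode H (bmat W d b)) (bmat W c \<alpha> * antipode H (bmat W \<beta> d)))"
    by (intro sum.cong refl sw_antipode_bmat lin_intros assms)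
  finally show ?thesis .
qed

end

lemma sum_swap4:
  fixes f :: "_ \<Rightarrow> _ \<Rightarrow> _ \<Rightarrow> _ \<Rightarrow> 'x::comm_monoid_add"
  shows "(\<Sum>a\<in>A. \<Sum>b\<in>B. \<Sum>c\<in>C. \<Sum>d\<in>D. f a b c d) = (\<Sum>c\<in>C. \<Sum>d\<in>D. \<Sum>a\<in>A. \<Sum>b\<in>B. f a b c d)"
proof -
  have *: "(\<Sum>b\<in>B. \<Sum>c\<in>C. \<Sum>d\<in>D. g b c d) = (\<Sum>c\<in>C. \<Sum>d\<in>D. \<Sum>b\<in>B. g b c d)" for g :: "_ \<Rightarrow> _ \<Rightarrow> _ \<Rightarrow> 'x::comm_monoid_add" and B
    by (subst sum.swap) (intro sum.cong refl sum.swap)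
  show ?thesis by (simp only: *[of _ B] *[of _ A])
qed

lemma vlin_lin: "lin (scl M) (scl N) f \<Longrightarrow> f ` car M \<subseteq> car N \<Longrightarrow> vlin M N f"
  by (auto simp: vlin_def lin_iff)

lemma vlin_id: "vlin M M (\<lambda>x. x)"
  by (simp add: vlin_def)

lemma vlin_tens_left: "vspace M \<Longrightarrow> vspace N \<Longrightarrow> w \<in> car N \<Longrightarrow> vlin M (tprod M N) (\<lambda>v. tens M N v w)"
  and vlin_tens_right: "vspace M \<Longrightarrow> vspace N \<Longrightarrow> v \<in> car M \<Longrightarrow> vlin N (tprod M N) (tens M N v)"
  using tens_bilin[of M N] by (simp_all add: bilin_def)

lemma bilin_tens:
  assumes "vspace L" "vspace K" "vspace M" "vspace N" "vlin M L f" "vlin N K g"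
  shows "bilin M N (uvs pscale) (\<lambda>u v. tens L K (f u) (g v))"
  using assms(5,6) tens_simps[OF assms(1,2)]
  by (simp add: bilin_def vlin_def image_subset_iff)

lemma bilin_sum:
  assumes "vector_space s" "\<And>i. i \<in> I \<Longrightarrow> bilin M N (uvs s) (f i)"
  shows "bilin M N (uvs s) (\<lambda>u v. \<Sum>i\<in>I. f i u v)"
proof -
  interpret vector_space s by fact
  show ?thesis using assms(2) by (simp add: bilin_def vlin_def sum.distrib scale_sum_right)
qed

text \<open>Here \<open>f\<close> is linear in \<open>x\<close> only at arguments from the carriers,
  so the termwise argument over keys is replaced by induction on \<open>t\<close>. The case in view
  is \<open>tens\<close> over \<open>End W\<close>, whose bilinearity is guaranteed for linear
  operators but not for arbitrary functions.\<close>

lemma lin_lin_ext_fun_car: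
  assumes M: "vspace M" and N: "vspace N" and t: "t \<in> car (tprod M N)" and r: "vector_space r" and s: "vector_space s"
    and b: "\<And>x. bilin M N (uvs s) (f x)" and l: "\<And>u v. u \<in> car M \<Longrightarrow> v \<in> car N \<Longrightarrow> lin r s (\<lambda>x. f x u v)"
  shows "lin r s (\<lambda>x. lin_ext s (f x) t)"
  using M N t
proof (induction t rule: tprod_induct)
  case zero
  then show ?case by (simp add: lin_zero[OF linear_lin_ext[OF s]] lin_fzero r s)
next
  case (add x y)
  then show ?case by (simp add: lin_add[OF linear_lin_ext[OF s]] lin_fadd)
next
  case (tens v w)
  then show ?case by (simp add: lin_ext_eval_bilin[OF M N s b] l)
qed

section \<open>Coactions on \<open>End W\<close> and on the predual, and evaluation as an
  equivariant map\<close>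

context hopf_comodule
begin

lemma lin_ext_bcoact_bilin:
  assumes "vector_space s" "bilin (wvs W) (hvs H) (uvs s) f" "\<beta> \<in> bidx W"
  shows "lin_ext s f (bcoact W (bvec W \<beta>)) = (\<Sum>\<gamma>\<in>bidx W. f (bvec W \<gamma>) (bmat W \<gamma> \<beta>))"
  unfolding coact_basis[OF assms(3)]
  by (simp add: lin_sum[OF linear_lin_ext[OF assms(1)]] lin_ext_eval_bilin[OF vspace_wvs vspace_hvs assms(1,2)])

lemma lin_End_coact: "lin (scl (End W)) pscale (End_coact H W)"
  unfolding End_coact_def by (intro lin_fsum lin_vec lin_entry vs_End vector_space_pscale)

lemma End_coact_unit_op:
  assumes "\<alpha> \<in> bidx W" "\<beta> \<in> bidx W"
  shows "End_coact H W (unit_op W (\<alpha>, \<beta>))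
    = (\<Sum>a\<in>bidx W. \<Sum>b\<in>bidx W. tens (End W) (hvs H) (unit_op W (a, b)) (bmat W a \<alpha> * antipode H (bmat W \<beta> b)))"
    (is "_ = ?T \<alpha> \<beta>")
proof -
  interpret vector_space "pscale :: 'k \<Rightarrow> (('w \<Rightarrow> 'w) \<times> 'h \<Rightarrow>\<^sub>0 'k) \<Rightarrow> _" by (rule vector_space_pscale)
  have "End_coact H W (unit_op W (\<alpha>, \<beta>))
      = (\<Sum>\<alpha>'\<in>bidx W. \<Sum>\<beta>'\<in>bidx W. pscale (entry W (unit_op W (\<alpha>, \<beta>)) \<alpha>' \<beta>') (?T \<alpha>' \<beta>'))"
    by (simp add: End_coact_def scale_sum_right)
  also have "\<dots> = (\<Sum>\<alpha>'\<in>bidx W. pscale (if \<alpha>' = \<alpha> then 1 else 0) (\<Sum>\<beta>'\<in>bidx W. pscale (if \<beta> = \<beta>' then 1 else 0) (?T \<alpha>' \<beta>')))"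
    unfolding scale_sum_right scale_scale by (intro sum.cong refl) (simp only: entry_unit_op assms)
  also have "\<dots> = ?T \<alpha> \<beta>"
    by (simp only: sum_delta_vs[OF vector_space_pscale] assms)
  finally show ?thesis .
qed

lemma End_coact_in:
  assumes "\<phi> \<in> car (End W)"
  shows "End_coact H W \<phi> \<in> car (tprod (End W) (hvs H))"
  unfolding End_coact_def
  by (intro vspace_sum[OF vspace_tprod] vspace_scl[OF vspace_tprod, unfolded scl_tprod] tens_in[OF vspace_End vspace_hvs] unit_op_in)
    simp

lemma lin_ext_End_coact:
  assumes "vector_space s" "bilin (End W) (hvs H) (uvs s) f" "\<alpha> \<in> bidx W" "\<beta> \<in> bidx W"
  shows "lin_ext s f (End_coact H W (unit_op W (\<alpha>, \<beta>)))
    = (\<Sum>a\<in>bidx W. \<Sum>b\<in>bidx W. f (unit_op W (a, b)) (bmat W a \<alpha> * antipode H (bmat W \<beta> b)))"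
  unfolding End_coact_unit_op[OF assms(3,4)]
  by (simp add: lin_sum[OF linear_lin_ext[OF assms(1)]] lin_ext_eval_bilin[OF vspace_End vspace_hvs assms(1,2)])

lemma vlin_hvs: "lin (hscale H) (hscale H) f \<Longrightarrow> vlin (hvs H) (hvs H) f"
  by (rule vlin_lin) auto

text \<open>Both axioms are linear in the operator and are checked on matrix units. There
  coassociativity is \<open>comult_End\<close>, and the counit axiom reduces to
  \<open>counit_bmat\<close>.\<close>

lemma right_comodule_End: "right_comodule H (End W) (End_coact H W)"
  unfolding right_comodule_def
proof (intro conjI ballI vspace_End)
  show "vlin (End W) (tprod (End W) (hvs H)) (End_coact H W)"
    by (rule vlin_lin) (auto simp: lin_End_coact scl_tprod End_coact_in)
next
  fix \<phi> assume \<phi>: "\<phi> \<in> car (End W)"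
  let ?t = "tens (End W) (hh H)"
  let ?F = "\<lambda>u h. lin_ext pscale (\<lambda>u0 u1. ?t u0 (htens H u1 h)) (End_coact H W u)"
  have b1: "bilin (End W) (hvs H) (uvs pscale) (\<lambda>u0 u1. ?t u0 (htens H u1 h))" for h
    by (intro bilin_tens vspace_End vspace_hh vspace_hvs vlin_id vlin_tens_left) simp
  have bF: "bilin (End W) (hvs H) (uvs pscale) ?F"
  proof (rule bilin_uvs)
    show "lin (scl (hvs H)) pscale (?F u)" if "u \<in> car (End W)" for u
    proof (rule lin_lin_ext_fun_car[OF vspace_End vspace_hvs End_coact_in[OF that] _ _ b1])
      show "lin (scl (hvs H)) pscale (\<lambda>h. ?t u0 (htens H u1 h))" if "u0 \<in> car (End W)" for u0 u1
        using tens_simps[OF vspace_End vspace_hh] tens_simps[OF vspace_hvs vspace_hvs] that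
        by (simp add: lin_iff vs vector_space_pscale scl_tprod)
    qed (simp_all add: vs vector_space_pscale)
    show "lin (scl (End W)) pscale (\<lambda>u. ?F u h)" for h
      by (rule lin_lin_ext[OF lin_End_coact vector_space_pscale])
  qed
  have bD: "bilin (End W) (hvs H) (uvs pscale) (\<lambda>u h. ?t u (comult H h))"
    by (intro bilin_tens vspace_End vspace_hh vspace_hvs vlin_id comult_linear)
  show "lin_ext pscale ?F (End_coact H W \<phi>) = lin_ext pscale (\<lambda>u h. ?t u (comult H h)) (End_coact H W \<phi>)"
  proof (rule spanned_eqI[OF spanned_End lin_lin_ext[OF lin_End_coact vector_space_pscale] lin_lin_ext[OF lin_End_coact vector_space_pscale] _ \<phi>])
    fix p assume "p \<in> bidx W \<times> bidx W"
    then obtain \<alpha> \<beta> where p: "p = (\<alpha>, \<beta>)" and ab: "\<alpha> \<in> bidx W" "\<beta> \<in> bidx W" by auto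
    have "lin_ext pscale ?F (End_coact H W (unit_op W (\<alpha>, \<beta>)))
       = (\<Sum>a\<in>bidx W. \<Sum>b\<in>bidx W. \<Sum>c\<in>bidx W. \<Sum>d\<in>bidx W. ?t (unit_op W (c, d))
           (htens H (bmat W c a * antipode H (bmat W b d)) (bmat W a \<alpha> * antipode H (bmat W \<beta> b))))"
      unfolding lin_ext_End_coact[OF vector_space_pscale bF ab]
      by (intro sum.cong refl lin_ext_End_coact[OF vector_space_pscale b1])
    \<comment> \<open>The remaining matrix unit carries \<open>c\<close> and \<open>d\<close>; with
      these outside, the inner sum over \<open>a\<close> and \<open>b\<close> is a
      coproduct.\<close>
    also have "\<dots> = (\<Sum>c\<in>bidx W. \<Sum>d\<in>bidx W. \<Sum>a\<in>bidx W. \<Sum>b\<in>bidx W. ?t (unit_op W (c, d))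
           (htens H (bmat W c a * antipode H (bmat W b d)) (bmat W a \<alpha> * antipode H (bmat W \<beta> b))))"
      by (rule sum_swap4)
    also have "\<dots> = (\<Sum>c\<in>bidx W. \<Sum>d\<in>bidx W. ?t (unit_op W (c, d)) (comult H (bmat W c \<alpha> * antipode H (bmat W \<beta> d))))"
      by (intro sum.cong refl)
        (simp add: comult_End ab tens_sum_right[OF vspace_End vspace_hh] vspace_sum[OF vspace_hh] unit_op_in tens_in[OF vspace_hvs vspace_hvs])
    also have "\<dots> = lin_ext pscale (\<lambda>u h. ?t u (comult H h)) (End_coact H W (unit_op W (\<alpha>, \<beta>)))"
      by (rule lin_ext_End_coact[OF vector_space_pscale bD ab, symmetric])
    finally show "lin_ext pscale ?F (End_coact H W (unit_op W p)) = lin_ext pscale (\<lambda>u h. ?t u (comult H h)) (End_coact H W (unit_op W p))"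
      unfolding p .
  qed
  let ?e = "\<lambda>u h. scl (End W) (counit H h) u"
  have be: "bilin (End W) (hvs H) (uvs (scl (End W))) ?e"
    by (rule bilin_uvs) (auto intro!: lin_vec lin_fscale lin_id lin_counit vs vs_End)
  show "lin_ext (scl (End W)) ?e (End_coact H W \<phi>) = \<phi>"
  proof (rule spanned_eqI[OF spanned_End lin_lin_ext[OF lin_End_coact vs_End] lin_id[OF vs_End] _ \<phi>])
    fix p assume "p \<in> bidx W \<times> bidx W"
    then obtain \<alpha> \<beta> where p: "p = (\<alpha>, \<beta>)" and ab: "\<alpha> \<in> bidx W" "\<beta> \<in> bidx W" by auto
    interpret E: vector_space "scl (End W)" by (rule vs_End)
    have "lin_ext (scl (End W)) ?e (End_coact H W (unit_op W (\<alpha>, \<beta>)))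
      = (\<Sum>a\<in>bidx W. scl (End W) (if a = \<alpha> then 1 else 0) (\<Sum>b\<in>bidx W. scl (End W) (if \<beta> = b then 1 else 0) (unit_op W (a, b))))"
      unfolding lin_ext_End_coact[OF vs_End be ab] E.scale_sum_right E.scale_scale
      by (intro sum.cong refl) (simp only: counit_mult counit_antipode counit_bmat ab)
    also have "\<dots> = unit_op W (\<alpha>, \<beta>)"
      by (simp only: sum_delta_vs[OF vs_End] ab)
    finally show "lin_ext (scl (End W)) ?e (End_coact H W (unit_op W p)) = unit_op W p"
      unfolding p .
  qed
qed

lemma lin_predual_coact: "lin (scl (predual W)) pscale (predual_coact H W)"
  unfolding predual_coact_def
  by (intro lin_fsum lin_vec vs_predual vector_space_pscale) (simp add: lin_iff vs_predual vector_space_mult predual_scale)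

lemma predual_coact_dvec:
  assumes "\<beta> \<in> bidx W"
  shows "predual_coact H W (dvec W \<beta>) = (\<Sum>b\<in>bidx W. tens (predual W) (hvs H) (dvec W b) (antipode H (bmat W \<beta> b)))"
proof -
  interpret vector_space "pscale :: 'k \<Rightarrow> (('w \<Rightarrow> 'k) \<times> 'h \<Rightarrow>\<^sub>0 'k) \<Rightarrow> _" by (rule vector_space_pscale)
  show ?thesis
    unfolding predual_coact_def scale_sum_right[symmetric]
    by (simp add: dvec_basis assms sum_delta_vs[OF vector_space_pscale] cong: sum.cong)
qed

lemma bilin_as_End: "bilin (wvs W) (predual W) (End W) (\<lambda>w f x. bscale W (f x) w)"
proof -
  interpret vector_space "bscale W" by (rule vs_W)
  show ?thesis
    unfolding bilin_def
    by (intro conjI ballI vlin_lin)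
      (auto simp: in_predual in_End lin_iff[of "scl (predual W)"] lin_iff[of "bscale W" "scl (End W)"] vs_W vs_End vs_predual
        fun_eq_iff End_scale predual_scale scale_right_distrib scale_left_distrib mult.commute intro!: lin_vec vs_W)
qed

lemma lin_as_End: "lin pscale (scl (End W)) (as_End W)"
  unfolding as_End_def by (rule linear_lin_ext[OF vs_End])

lemma as_End_tens: "as_End W (tens (wvs W) (predual W) w f) = (\<lambda>x. bscale W (f x) w)"
  unfolding as_End_def by (rule lin_ext_tens[OF vs_End bilin_as_End vspace_wvs vspace_predual])

lemma as_End_basis: "as_End W (tens (wvs W) (predual W) (bvec W \<alpha>) (dvec W \<beta>)) = unit_op W (\<alpha>, \<beta>)"
  by (simp add: as_End_tens unit_op_def)

lemma vlin_as_End: "vlin (tprod (wvs W) (predual W)) (End W) (as_End W)"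
  unfolding as_End_def by (rule lin_ext_vlin[OF vspace_End bilin_as_End vspace_wvs vspace_predual])

lemma viso_as_End: "viso (tprod (wvs W) (predual W)) (End W) (as_End W)"
  unfolding viso_def
proof (intro conjI vlin_as_End)
  let ?T = "tprod (wvs W) (predual W)" and ?t = "tens (wvs W) (predual W)"
  \<comment> \<open>The inverse of \<open>as_End\<close>: each matrix entry of the operator is put
    in front of \<open>e_\<alpha> \<otimes> f^\<beta>\<close>.\<close>
  define g where "g \<phi> = (\<Sum>\<alpha>\<in>bidx W. \<Sum>\<beta>\<in>bidx W. pscale (entry W \<phi> \<alpha> \<beta>) (?t (bvec W \<alpha>) (dvec W \<beta>)))" for \<phi>
  have lg: "lin (scl (End W)) pscale g"
    unfolding g_def by (intro lin_fsum lin_vec lin_entry vs_End vector_space_pscale)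
  have agE: "as_End W (g \<phi>) = \<phi>" if "\<phi> \<in> car (End W)" for \<phi>
    by (subst (2) End_expand[OF that]) (simp add: g_def mat_op_def lin_sum[OF lin_as_End] lin_scale[OF lin_as_End] as_End_basis)
  have gin: "g \<phi> \<in> car ?T" for \<phi>
    unfolding g_def
    by (intro vspace_sum[OF vspace_tprod] vspace_scl[OF vspace_tprod, unfolded scl_tprod] tens_in[OF vspace_wvs vspace_predual] dvec_in) simp
  have gas: "g (as_End W t) = t" if "t \<in> car ?T" for t
  proof (rule tprod_spanned_eqI[OF vspace_wvs spanned_W vspace_predual spanned_predual lin_compose[OF lin_as_End lg] lin_id[OF vector_space_pscale] _ that])
    fix i j assume ij: "i \<in> bidx W" "j \<in> bidx W"
    interpret vector_space "pscale :: 'k \<Rightarrow> ('w \<times> ('w \<Rightarrow> 'k) \<Rightarrow>\<^sub>0 'k) \<Rightarrow> _" by (rule vector_space_pscale)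
    have "g (as_End W (?t (bvec W i) (dvec W j)))
      = (\<Sum>\<alpha>\<in>bidx W. pscale (if \<alpha> = i then 1 else 0) (\<Sum>\<beta>\<in>bidx W. pscale (if j = \<beta> then 1 else 0) (?t (bvec W \<alpha>) (dvec W \<beta>))))"
      unfolding as_End_basis g_def scale_sum_right scale_scale by (intro sum.cong refl) (simp only: entry_unit_op ij)
    also have "\<dots> = ?t (bvec W i) (dvec W j)"
      by (simp only: sum_delta_vs[OF vector_space_pscale] ij)
    finally show "g (as_End W (?t (bvec W i) (dvec W j))) = ?t (bvec W i) (dvec W j)" .
  qed
  show "bij_betw (as_End W) (car ?T) (car (End W))"
    by (rule bij_betw_byWitness[where f'=g]) (use vlin_as_End in \<open>auto simp: agE gas gin vlin_def\<close>)
qed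

text \<open>On \<open>e_\<alpha> \<otimes> f^\<beta>\<close> the tensor product coaction multiplies
  \<open>\<rho>^a_\<alpha>\<close> by \<open>S\<rho>^\<beta>_b\<close> in this order, which is the
  coefficient that \<open>End_coact\<close> attaches to the matrix unit
  \<open>(a, b)\<close>.\<close>

lemma comodule_map_as_End:
  "comodule_map H (tprod (wvs W) (predual W)) (tens_coact H (wvs W) (bcoact W) (predual W) (predual_coact H W))
     (End W) (End_coact H W) (as_End W)"
  unfolding comodule_map_def
proof (intro conjI ballI vlin_as_End)
  let ?T = "tprod (wvs W) (predual W)" and ?t = "tens (wvs W) (predual W)" and ?c = "tens_coact H (wvs W) (bcoact W) (predual W) (predual_coact H W)"
  let ?F = "\<lambda>u h. tens (End W) (hvs H) (as_End W u) h"
  fix t assume t: "t \<in> car ?T"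
  have lc: "lin pscale pscale ?c"
    unfolding tens_coact_def by (rule linear_lin_ext[OF vector_space_pscale])
  have bF: "bilin ?T (hvs H) (uvs pscale) ?F"
    by (intro bilin_tens vspace_End vspace_hvs vspace_tprod vlin_as_End vlin_id)
  show "End_coact H W (as_End W t) = lin_ext pscale ?F (?c t)"
  proof (rule tprod_spanned_eqI[OF vspace_wvs spanned_W vspace_predual spanned_predual
        lin_compose[OF lin_as_End lin_End_coact] lin_lin_ext[OF lc vector_space_pscale] _ t])
    fix \<alpha> \<beta> assume ab: "\<alpha> \<in> bidx W" "\<beta> \<in> bidx W"
    let ?G = "\<lambda>v0 v1 w0 w1. tens ?T (hvs H) (?t v0 w0) (v1 * w1)"
    let ?X = "\<lambda>v w. lin_ext pscale (\<lambda>v0 v1. lin_ext pscale (?G v0 v1) (predual_coact H W w)) (bcoact W v)"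
    have X: "bilin (wvs W) (predual W) (uvs pscale) ?X"
      by (rule bilin_uvs) (auto intro!: lin_lin_ext lin_lin_ext_fun lin_bcoact lin_predual_coact vector_space_pscale vs_predual)
    have bG: "bilin (predual W) (hvs H) (uvs pscale) (?G v0 v1)" for v0 v1
      by (intro bilin_tens vspace_tprod vspace_hvs vspace_predual vlin_tens_right vspace_wvs vlin_hvs lin_intros) simp
    have inner: "lin_ext pscale (?G v0 v1) (predual_coact H W (dvec W \<beta>)) = (\<Sum>b\<in>bidx W. ?G v0 v1 (dvec W b) (antipode H (bmat W \<beta> b)))" for v0 v1
      unfolding predual_coact_dvec[OF ab(2)]
      by (simp add: lin_sum[OF linear_lin_ext[OF vector_space_pscale]] lin_ext_eval_bilin[OF vspace_predual vspace_hvs vector_space_pscale bG])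
    have b2: "bilin (wvs W) (hvs H) (uvs pscale) (\<lambda>v0 v1. \<Sum>b\<in>bidx W. ?G v0 v1 (dvec W b) (antipode H (bmat W \<beta> b)))"
      by (intro bilin_sum vector_space_pscale bilin_tens vspace_tprod vspace_hvs vspace_wvs vspace_predual vlin_tens_left dvec_in vlin_hvs lin_intros)
    have "?c (?t (bvec W \<alpha>) (dvec W \<beta>)) = ?X (bvec W \<alpha>) (dvec W \<beta>)"
      unfolding tens_coact_def by (rule lin_ext_eval_bilin[OF vspace_wvs vspace_predual vector_space_pscale X])
    also have "\<dots> = (\<Sum>a\<in>bidx W. \<Sum>b\<in>bidx W. ?G (bvec W a) (bmat W a \<alpha>) (dvec W b) (antipode H (bmat W \<beta> b)))"
      unfolding inner by (rule lin_ext_bcoact_bilin[OF vector_space_pscale b2 ab(1)])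
    finally show "End_coact H W (as_End W (?t (bvec W \<alpha>) (dvec W \<beta>))) = lin_ext pscale ?F (?c (?t (bvec W \<alpha>) (dvec W \<beta>)))"
      by (simp add: as_End_basis End_coact_unit_op ab lin_sum[OF linear_lin_ext[OF vector_space_pscale]]
          lin_ext_eval_bilin[OF vspace_tprod vspace_hvs vector_space_pscale bF])
  qed
qed

lemma bilin_eval: "bilin (End W) (wvs W) (wvs W) (\<lambda>\<phi> w. \<phi> w)"
  unfolding bilin_def
  by (intro conjI ballI vlin_lin) (auto simp: in_End lin_iff[of "scl (End W)"] vs_End vs_W End_scale)

lemma eval_gamma_tens: "eval_gamma W (tens (End W) (wvs W) \<phi> w) = \<phi> w"
  using lin_ext_tens[OF _ bilin_eval vspace_End vspace_wvs] by (simp add: eval_gamma_def vs_W)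

lemma vlin_eval_gamma: "vlin (tprod (End W) (wvs W)) (wvs W) (eval_gamma W)"
  using lin_ext_vlin[OF vspace_wvs bilin_eval vspace_End vspace_wvs] by (simp add: eval_gamma_def)

lemma lin_eval_gamma: "lin pscale (bscale W) (eval_gamma W)"
  unfolding eval_gamma_def by (rule linear_lin_ext[OF vs_W])

text \<open>On \<open>e_\<alpha> \<otimes> f^\<beta> \<otimes> e_\<gamma>\<close> the coaction
  produces \<open>\<rho>^a_\<alpha> S\<rho>^\<beta>_b \<rho>^d_\<gamma>\<close>. Evaluation forces
  \<open>b = d\<close>, after which \<open>S\<rho>\<close> cancels \<open>\<rho>\<close>; what
  remains is the coaction of \<open>e_\<alpha>\<close> if \<open>\<beta> = \<gamma>\<close>, and
  \<open>0\<close> otherwise.\<close>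

lemma spinor_space_eval: "spinor_space H (End W) (End_coact H W) (wvs W) (bcoact W) (eval_gamma W)"
  unfolding spinor_space_def comodule_map_def
proof (intro conjI ballI comodule vlin_eval_gamma)
  let ?T = "tprod (End W) (wvs W)" and ?t = "tens (End W) (wvs W)" and ?c = "tens_coact H (End W) (End_coact H W) (wvs W) (bcoact W)"
  let ?F = "\<lambda>u h. tens (wvs W) (hvs H) (eval_gamma W u) h"
  fix t assume t: "t \<in> car ?T"
  have lc: "lin pscale pscale ?c"
    unfolding tens_coact_def by (rule linear_lin_ext[OF vector_space_pscale])
  have bF: "bilin ?T (hvs H) (uvs pscale) ?F"
    by (intro bilin_tens vspace_wvs vspace_hvs vspace_tprod vlin_eval_gamma vlin_id)
  show "bcoact W (eval_gamma W t) = lin_ext pscale ?F (?c t)"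
  proof (rule tprod_spanned_eqI[OF vspace_End spanned_End vspace_wvs spanned_W
        lin_compose[OF lin_eval_gamma lin_bcoact] lin_lin_ext[OF lc vector_space_pscale] _ t])
    fix p \<gamma> assume "p \<in> bidx W \<times> bidx W" and c: "\<gamma> \<in> bidx W"
    then obtain \<alpha> \<beta> where p: "p = (\<alpha>, \<beta>)" and ab: "\<alpha> \<in> bidx W" "\<beta> \<in> bidx W" by auto
    let ?G = "\<lambda>v0 v1 w0 w1. tens ?T (hvs H) (?t v0 w0) (v1 * w1)"
    let ?X = "\<lambda>v w. lin_ext pscale (\<lambda>v0 v1. lin_ext pscale (?G v0 v1) (bcoact W w)) (End_coact H W v)"
    let ?h = "tens (wvs W) (hvs H)"
    have X: "bilin (End W) (wvs W) (uvs pscale) ?X"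
      by (rule bilin_uvs) (auto intro!: lin_lin_ext lin_lin_ext_fun lin_bcoact lin_End_coact vector_space_pscale vs_W)
    have bG: "bilin (wvs W) (hvs H) (uvs pscale) (?G v0 v1)" if "v0 \<in> car (End W)" for v0 v1
      by (intro bilin_tens vspace_tprod vspace_hvs vspace_End vlin_tens_right vspace_wvs vlin_hvs lin_intros that)
    have bG': "bilin (End W) (hvs H) (uvs pscale) (\<lambda>v0 v1. ?G v0 v1 w0 w1)" for w0 w1
      by (intro bilin_tens vspace_tprod vspace_hvs vspace_End vlin_tens_left vspace_wvs vlin_hvs lin_intros) simp
    have inner: "lin_ext pscale (?G v0 v1) (bcoact W (bvec W \<gamma>)) = (\<Sum>d\<in>bidx W. ?G v0 v1 (bvec W d) (bmat W d \<gamma>))"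
      if "v0 \<in> car (End W)" for v0 v1
      by (rule lin_ext_bcoact_bilin[OF vector_space_pscale bG[OF that] c])
    have b2: "bilin (End W) (hvs H) (uvs pscale) (\<lambda>v0 v1. \<Sum>d\<in>bidx W. ?G v0 v1 (bvec W d) (bmat W d \<gamma>))"
      by (intro bilin_sum vector_space_pscale bG')
    have "?c (?t (unit_op W (\<alpha>, \<beta>)) (bvec W \<gamma>)) = ?X (unit_op W (\<alpha>, \<beta>)) (bvec W \<gamma>)"
      unfolding tens_coact_def by (rule lin_ext_eval_bilin[OF vspace_End vspace_wvs vector_space_pscale X])
    \<comment> \<open>The inner coaction is expanded only for \<open>v0\<close> in
      \<open>End W\<close>, so the two extensions are compared through agreement on the
      carriers.\<close>
    also have "\<dots> = lin_ext pscale (\<lambda>v0 v1. \<Sum>d\<in>bidx W. ?G v0 v1 (bvec W d) (bmat W d \<gamma>)) (End_coact H W (unit_op W (\<alpha>, \<beta>)))"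
      by (rule lin_ext_cong[OF vspace_End vspace_hvs End_coact_in[OF unit_op_in] vector_space_pscale b2 inner[symmetric], symmetric])
    also have "\<dots> = (\<Sum>a\<in>bidx W. \<Sum>b\<in>bidx W. \<Sum>d\<in>bidx W. ?G (unit_op W (a, b)) (bmat W a \<alpha> * antipode H (bmat W \<beta> b)) (bvec W d) (bmat W d \<gamma>))"
      by (rule lin_ext_End_coact[OF vector_space_pscale b2 ab])
    finally have "lin_ext pscale ?F (?c (?t (unit_op W (\<alpha>, \<beta>)) (bvec W \<gamma>)))
      = (\<Sum>a\<in>bidx W. \<Sum>b\<in>bidx W. \<Sum>d\<in>bidx W. ?h (unit_op W (a, b) (bvec W d)) (bmat W a \<alpha> * antipode H (bmat W \<beta> b) * bmat W d \<gamma>))"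
      by (simp add: lin_sum[OF linear_lin_ext[OF vector_space_pscale]]
          lin_ext_eval_bilin[OF vspace_tprod vspace_hvs vector_space_pscale bF] eval_gamma_tens)
    also have "\<dots> = (\<Sum>a\<in>bidx W. \<Sum>b\<in>bidx W. \<Sum>d\<in>bidx W. if b = d then ?h (bvec W a) (bmat W a \<alpha> * antipode H (bmat W \<beta> b) * bmat W d \<gamma>) else 0)"
      by (intro sum.cong refl) (simp add: unit_op_basis tens_zero_left[OF vspace_wvs vspace_hvs])
    also have "\<dots> = (\<Sum>a\<in>bidx W. \<Sum>b\<in>bidx W. ?h (bvec W a) (bmat W a \<alpha> * (antipode H (bmat W \<beta> b) * bmat W b \<gamma>)))"
      by (intro sum.cong refl) (simp add: finite_basis mult.assoc)
    also have "\<dots> = (\<Sum>a\<in>bidx W. ?h (bvec W a) (bmat W a \<alpha> * (if \<beta> = \<gamma> then 1 else 0)))"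
      by (simp add: tens_sum_right[OF vspace_wvs vspace_hvs, symmetric] sum_distrib_left[symmetric] antipode_bmat_left ab c)
    also have "\<dots> = bcoact W (eval_gamma W (?t (unit_op W (\<alpha>, \<beta>)) (bvec W \<gamma>)))"
      by (simp add: eval_gamma_tens unit_op_basis ab c coact_basis tens_zero_right[OF vspace_wvs vspace_hvs] lin_zero[OF lin_bcoact])
    finally show "bcoact W (eval_gamma W (?t (unit_op W p) (bvec W \<gamma>))) = lin_ext pscale ?F (?c (?t (unit_op W p) (bvec W \<gamma>)))"
      unfolding p ..
  qed
qed

end

section \<open>The quantum Killing form on the matrix coalgebra\<close>

locale dqt_comodule = dual_quasitriangular H + hopf_comodule H W
  for H :: "('k::field, 'h::ring_1, 'z) dqt_hopf_scheme" and W :: "('k, 'h, 'w::ab_group_add, 'i) based_comod"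
begin

lemma lin_rform:
  shows lin_rform_left: "lin r (hscale H) f \<Longrightarrow> lin r (*) (\<lambda>x. rform H (f x) c)"
    and lin_rform_right: "lin r (hscale H) f \<Longrightarrow> lin r (*) (\<lambda>x. rform H c (f x))"
    and lin_rform_inv_left: "lin r (hscale H) f \<Longrightarrow> lin r (*) (\<lambda>x. rform_inv H (f x) c)"
    and lin_rform_inv_right: "lin r (hscale H) f \<Longrightarrow> lin r (*) (\<lambda>x. rform_inv H c (f x))"
  using rform_bilin rform_inv_bilin by (simp_all add: lin_iff bilin_def vlin_def vector_space_mult)

lemmas lin_intros_dqt = lin_intros lin_rform

text \<open>\<open>F = F (F G) = (F F) G = F G = 1\<close>. This supplies the normalisation of
  \<open>\<R>\<close> at the unit of \<open>H\<close> in either argument.\<close>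

lemma idempotent_invertible_matrix:
  fixes F G :: "'i \<Rightarrow> 'i \<Rightarrow> 'k"
  assumes "\<And>a b. a \<in> bidx W \<Longrightarrow> b \<in> bidx W \<Longrightarrow> F a b = (\<Sum>c\<in>bidx W. F a c * F c b)"
    and "\<And>a b. a \<in> bidx W \<Longrightarrow> b \<in> bidx W \<Longrightarrow> (\<Sum>c\<in>bidx W. F a c * G c b) = (if a = b then 1 else 0)"
    and ab: "a \<in> bidx W" "b \<in> bidx W"
  shows "F a b = (if a = b then 1 else 0)"
proof -
  have "F a b = (\<Sum>c\<in>bidx W. F a c * (if c = b then 1 else 0))" by (simp only: sum_delta_k ab)
  also have "\<dots> = (\<Sum>c\<in>bidx W. F a c * (\<Sum>d\<in>bidx W. F c d * G d b))" by (intro sum.cong refl) (simp only: assms(2) ab)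
  also have "\<dots> = (\<Sum>c\<in>bidx W. \<Sum>d\<in>bidx W. F a c * F c d * G d b)" by (simp add: sum_distrib_left mult.assoc)
  also have "\<dots> = (\<Sum>d\<in>bidx W. \<Sum>c\<in>bidx W. F a c * F c d * G d b)" by (rule sum.swap)
  also have "\<dots> = (\<Sum>d\<in>bidx W. F a d * G d b)"
    by (intro sum.cong refl) (simp only: sum_distrib_right[symmetric] assms(1)[OF ab(1), symmetric])
  also have "\<dots> = (if a = b then 1 else 0)" by (rule assms(2)[OF ab])
  finally show ?thesis .
qed

text \<open>Multiplicativity at \<open>1 * 1\<close> makes the matrix idempotent, and the
  convolution inverse, taken at \<open>1\<close> in the first argument, inverts it.\<close>

lemma rform_one_left:
  assumes "a \<in> bidx W" "b \<in> bidx W"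
  shows "rform H 1 (bmat W a b) = (if a = b then 1 else 0)"
proof (rule idempotent_invertible_matrix[where F="\<lambda>a b. rform H 1 (bmat W a b)" and G="\<lambda>a b. rform_inv H 1 (bmat W a b)"])
  fix a b assume ab: "a \<in> bidx W" "b \<in> bidx W"
  have "rform H (1 * 1) (bmat W a b) = (\<Sum>c\<in>bidx W. rform H 1 (bmat W a c) * rform H 1 (bmat W c b))"
    unfolding rform_mult_left by (rule sw_bmat) (intro lin_intros_dqt ab)+
  then show "rform H 1 (bmat W a b) = (\<Sum>c\<in>bidx W. rform H 1 (bmat W a c) * rform H 1 (bmat W c b))" by simp
  have "(if a = b then 1 else 0)
      = sw H (*) (\<lambda>a1 a2. sw H (*) (\<lambda>b1 b2. rform H a1 b1 * rform_inv H a2 b2) (bmat W a b)) 1"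
    by (simp add: rform_rform_inv counit_one counit_bmat ab)
  also have "\<dots> = sw H (*) (\<lambda>b1 b2. rform H 1 b1 * rform_inv H 1 b2) (bmat W a b)"
    by (rule sw_one) (intro lin_intros_dqt)+
  also have "\<dots> = (\<Sum>c\<in>bidx W. rform H 1 (bmat W a c) * rform_inv H 1 (bmat W c b))"
    by (rule sw_bmat) (intro lin_intros_dqt ab)+
  finally show "(\<Sum>c\<in>bidx W. rform H 1 (bmat W a c) * rform_inv H 1 (bmat W c b)) = (if a = b then 1 else 0)" by simp
qed (rule assms)+

lemma rform_bmat_simps:
  assumes "a \<in> bidx W" "b \<in> bidx W"
  shows rform_bmat_mult: "rform H (bmat W a b) (h * k) = (\<Sum>c\<in>bidx W. rform H (bmat W a c) k * rform H (bmat W c b) h)"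
    and rform_mult_bmat: "rform H (h * k) (bmat W a b) = (\<Sum>c\<in>bidx W. rform H h (bmat W a c) * rform H k (bmat W c b))"
  unfolding rform_mult_left rform_mult_right by (rule sw_bmat; intro lin_intros_dqt assms)+

lemma rform_one_right:
  assumes "a \<in> bidx W" "b \<in> bidx W"
  shows "rform H (bmat W a b) 1 = (if a = b then 1 else 0)"
proof (rule idempotent_invertible_matrix[where F="\<lambda>a b. rform H (bmat W a b) 1" and G="\<lambda>a b. rform_inv H (bmat W a b) 1"])
  fix a b assume ab: "a \<in> bidx W" "b \<in> bidx W"
  show "rform H (bmat W a b) 1 = (\<Sum>c\<in>bidx W. rform H (bmat W a c) 1 * rform H (bmat W c b) 1)"
    using rform_bmat_mult[OF ab, of 1 1] by simp
  have "(if a = b then 1 else 0)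
      = sw H (*) (\<lambda>a1 a2. sw H (*) (\<lambda>b1 b2. rform H a1 b1 * rform_inv H a2 b2) 1) (bmat W a b)"
    by (simp add: rform_rform_inv counit_one counit_bmat ab)
  also have "\<dots> = sw H (*) (\<lambda>a1 a2. rform H a1 1 * rform_inv H a2 1) (bmat W a b)"
    by (intro sw_cong sw_one lin_intros_dqt)
  also have "\<dots> = (\<Sum>c\<in>bidx W. rform H (bmat W a c) 1 * rform_inv H (bmat W c b) 1)"
    by (rule sw_bmat) (intro lin_intros_dqt ab)+
  finally show "(\<Sum>c\<in>bidx W. rform H (bmat W a c) 1 * rform_inv H (bmat W c b) 1) = (if a = b then 1 else 0)" by simp
qed (rule assms)+

lemma rform_inv_rform_bmat:
  assumes "a \<in> bidx W" "b \<in> bidx W"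
  shows "(\<Sum>c\<in>bidx W. sw H (*) (\<lambda>h1 h2. rform_inv H (bmat W a c) h1 * rform H (bmat W c b) h2) h) = (if a = b then 1 else 0) * counit H h"
proof -
  have "(if a = b then 1 else 0) * counit H h
      = sw H (*) (\<lambda>a1 a2. sw H (*) (\<lambda>b1 b2. rform_inv H a1 b1 * rform H a2 b2) h) (bmat W a b)"
    by (simp add: rform_inv_rform counit_bmat assms)
  also have "\<dots> = (\<Sum>c\<in>bidx W. sw H (*) (\<lambda>h1 h2. rform_inv H (bmat W a c) h1 * rform H (bmat W c b) h2) h)"
    by (rule sw_bmat) (intro lin_intros_dqt assms)+
  finally show ?thesis by simp
qed

text \<open>Let \<open>X(h)\<close> and \<open>Y(h)\<close> be the matrices of
  \<open>\<R>(\<rho> \<otimes> h)\<close> and of its convolution inverse. Since \<open>X\<close>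
  reverses products, \<open>X(S h2) X(h1) = \<epsilon>(h)\<close> (fact \<open>A\<close>). Since
  \<open>\<Delta>(S h) = S h2 \<otimes> S h1\<close>, also
  \<open>Y(S h2) X(S h1) = \<epsilon>(h)\<close> (fact \<open>B\<close>). Hence
  \<open>Y(S h) = Y(S h3) X(S h2) X(h1) = X(h)\<close>.\<close>

lemma rform_inv_antipode:
  assumes ab: "a \<in> bidx W" "b \<in> bidx W"
  shows "rform_inv H (bmat W a b) (antipode H h) = rform H (bmat W a b) h"
proof -
  let ?S = "antipode H" and ?X = "\<lambda>a b. rform H (bmat W a b)" and ?Y = "\<lambda>a b. rform_inv H (bmat W a b)"
  note k = vector_space_mult[where 'k='k]
  have A: "(\<Sum>d\<in>bidx W. sw H (*) (\<lambda>p q. ?X c d (?S q) * ?X d b p) h) = (if c = b then 1 else 0) * counit H h"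
    if c: "c \<in> bidx W" for c h
  proof -
    have "(\<Sum>d\<in>bidx W. sw H (*) (\<lambda>p q. ?X c d (?S q) * ?X d b p) h) = sw H (*) (\<lambda>p q. ?X c b (p * ?S q)) h"
      by (simp add: rform_bmat_mult c ab sw_fsum[OF k])
    also have "\<dots> = counit H h * ?X c b 1"
      by (rule sw_antipode_right) (intro lin_intros_dqt)
    finally show ?thesis by (simp add: rform_one_right c ab)
  qed
  have B: "(\<Sum>c\<in>bidx W. sw H (*) (\<lambda>q r. ?Y a c (?S r) * ?X c d (?S q)) h) = (if a = d then 1 else 0) * counit H h"
    if d: "d \<in> bidx W" for d h
  proof -
    have "(\<Sum>c\<in>bidx W. sw H (*) (\<lambda>q r. ?Y a c (?S r) * ?X c d (?S q)) h) = (\<Sum>c\<in>bidx W. sw H (*) (\<lambda>h1 h2. ?Y a c h1 * ?X c d h2) (?S h))"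
      by (intro sum.cong refl sw_antipode[symmetric] lin_intros_dqt)
    then show ?thesis by (simp only: rform_inv_rform_bmat ab d counit_antipode)
  qed
  have "?Y a b (?S h) = sw H (*) (\<lambda>x y. counit H x * ?Y a b (?S y)) h"
    by (rule sw_counit_left[symmetric]) (intro lin_intros_dqt)
  also have "\<dots> = sw H (*) (\<lambda>x y. \<Sum>c\<in>bidx W. ?Y a c (?S y) * ((if c = b then 1 else 0) * counit H x)) h"
    by (simp only: mult.assoc[symmetric] sum_distrib_right[symmetric] sum_delta_k ab mult.commute[of "counit H _"])
  also have "\<dots> = sw H (*) (\<lambda>x y. \<Sum>c\<in>bidx W. ?Y a c (?S y) * (\<Sum>d\<in>bidx W. sw H (*) (\<lambda>p q. ?X c d (?S q) * ?X d b p) x)) h"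
    by (intro sw_cong sum.cong refl) (simp only: A)
  also have "\<dots> = (\<Sum>c\<in>bidx W. \<Sum>d\<in>bidx W. sw H (*) (\<lambda>x y. sw H (*) (\<lambda>p q. ?Y a c (?S y) * (?X c d (?S q) * ?X d b p)) x) h)"
    by (simp add: sum_distrib_left sw_fsum[OF k] sw_fscale[OF k])
  also have "\<dots> = (\<Sum>c\<in>bidx W. \<Sum>d\<in>bidx W. sw H (*) (\<lambda>x y. sw H (*) (\<lambda>p q. ?Y a c (?S q) * (?X c d (?S p) * ?X d b x)) y) h)"
    by (intro sum.cong refl sw_assoc lin_intros_dqt)
  also have "\<dots> = (\<Sum>d\<in>bidx W. sw H (*) (\<lambda>x y. ?X d b x * (\<Sum>c\<in>bidx W. sw H (*) (\<lambda>p q. ?Y a c (?S q) * ?X c d (?S p)) y)) h)"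
    by (subst sum.swap) (simp add: sum_distrib_left sw_fsum[OF k] sw_fscale[OF k, symmetric] mult_ac)
  also have "\<dots> = (\<Sum>d\<in>bidx W. sw H (*) (\<lambda>x y. (if a = d then 1 else 0) * (counit H y * ?X d b x)) h)"
    by (intro sum.cong refl sw_cong) (simp only: B, simp)
  also have "\<dots> = (\<Sum>d\<in>bidx W. (if a = d then 1 else 0) * ?X d b h)"
    by (simp only: sw_fscale[OF k]) (intro sum.cong refl arg_cong[of _ _ "(*) _"] sw_counit_right lin_intros_dqt)
  also have "\<dots> = ?X a b h" by (simp only: sum_delta_k ab)
  finally show ?thesis .
qed

lemma lin_Qmap: "lin r (hscale H) f \<Longrightarrow> lin r (*) (\<lambda>x. Qmap H (f x) g)"
  unfolding Qmap_def by (intro lin_sw_fun lin_sw vector_space_mult) (auto dest: lin_vs1)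

lemmas lin_intros_Q = lin_intros_dqt lin_Qmap

lemma Qmap_bmat:
  assumes "a \<in> bidx W" "b \<in> bidx W"
  shows "Qmap H h (bmat W a b) = (\<Sum>c\<in>bidx W. sw H (*) (\<lambda>h1 h2. rform H (bmat W a c) h1 * rform H h2 (bmat W c b)) h)"
  unfolding Qmap_def by (rule sw_bmat) (intro lin_intros_dqt assms)+

lemma Qmap_one:
  assumes "a \<in> bidx W" "b \<in> bidx W"
  shows "Qmap H 1 (bmat W a b) = (if a = b then 1 else 0)"
proof -
  have "Qmap H 1 (bmat W a b) = (\<Sum>c\<in>bidx W. rform H (bmat W a c) 1 * rform H 1 (bmat W c b))"
    unfolding Qmap_bmat[OF assms] by (intro sum.cong refl sw_one lin_intros_dqt)
  then show ?thesis by (simp add: rform_one_left rform_one_right assms sum_delta_k cong: sum.cong)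
qed

text \<open>In \<open>\<R>(\<rho> \<otimes> v g)\<close> the matrix of \<open>g\<close> comes before
  that of \<open>v\<close>, in \<open>\<R>(v g \<otimes> \<rho>)\<close> after it. The two matrices
  of \<open>v\<close> therefore meet at the inner index \<open>c\<close> and form
  \<open>\<Q>(v)\<close>, with \<open>g\<close> on both sides. This sandwich is what becomes
  conjugation by \<open>\<rho>_-\<close> and \<open>\<rho>_+\<close>.\<close>

lemma Qmap_mult:
  assumes ab: "a \<in> bidx W" "b \<in> bidx W"
  shows "Qmap H (v * g) (bmat W a b)
    = (\<Sum>d\<in>bidx W. \<Sum>e\<in>bidx W. Qmap H v (bmat W d e) * sw H (*) (\<lambda>g1 g2. rform H (bmat W a d) g1 * rform H g2 (bmat W e b)) g)"
proof -
  note k = vector_space_mult[where 'k='k]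
  have "Qmap H (v * g) (bmat W a b) = (\<Sum>c\<in>bidx W. sw H (*) (\<lambda>v1 v2. sw H (*) (\<lambda>g1 g2.
      rform H (bmat W a c) (v1 * g1) * rform H (v2 * g2) (bmat W c b)) g) v)"
    unfolding Qmap_bmat[OF ab] by (intro sum.cong refl sw_mult lin_intros_dqt)
  also have "\<dots> = (\<Sum>c\<in>bidx W. sw H (*) (\<lambda>v1 v2. sw H (*) (\<lambda>g1 g2. \<Sum>d\<in>bidx W. \<Sum>e\<in>bidx W.
      (rform H (bmat W d c) v1 * rform H v2 (bmat W c e)) * (rform H (bmat W a d) g1 * rform H g2 (bmat W e b))) g) v)"
    by (intro sum.cong refl sw_cong) (simp add: rform_bmat_mult rform_mult_bmat ab sum_product mult_ac, rule sum.swap)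
  also have "\<dots> = (\<Sum>c\<in>bidx W. \<Sum>d\<in>bidx W. \<Sum>e\<in>bidx W. sw H (*) (\<lambda>v1 v2.
      (rform H (bmat W d c) v1 * rform H v2 (bmat W c e)) * sw H (*) (\<lambda>g1 g2. rform H (bmat W a d) g1 * rform H g2 (bmat W e b)) g) v)"
    by (simp only: sw_fsum[OF k] sw_fscale[OF k])
  also have "\<dots> = (\<Sum>c\<in>bidx W. \<Sum>d\<in>bidx W. \<Sum>e\<in>bidx W. sw H (*) (\<lambda>v1 v2.
      rform H (bmat W d c) v1 * rform H v2 (bmat W c e)) v * sw H (*) (\<lambda>g1 g2. rform H (bmat W a d) g1 * rform H g2 (bmat W e b)) g)"
    by (intro sum.cong refl sw_of_lin[symmetric] lin_intros_dqt)
  also have "\<dots> = (\<Sum>d\<in>bidx W. \<Sum>e\<in>bidx W. \<Sum>c\<in>bidx W. sw H (*) (\<lambda>v1 v2.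
      rform H (bmat W d c) v1 * rform H v2 (bmat W c e)) v * sw H (*) (\<lambda>g1 g2. rform H (bmat W a d) g1 * rform H g2 (bmat W e b)) g)"
    by (subst sum.swap) (intro sum.cong refl sum.swap)
  also have "\<dots> = (\<Sum>d\<in>bidx W. \<Sum>e\<in>bidx W. Qmap H v (bmat W d e) * sw H (*) (\<lambda>g1 g2. rform H (bmat W a d) g1 * rform H g2 (bmat W e b)) g)"
    by (intro sum.cong refl) (simp only: Qmap_bmat sum_distrib_right)
  finally show ?thesis .
qed

text \<open>One argument of \<open>quasi_comm\<close> is a matrix coefficient, so its coproduct
  becomes a sum over \<open>c\<close>. Both positions are covered because \<open>\<Q>\<close> has
  one factor \<open>\<R>\<close> with the coefficient on the left and one with it on the
  right.\<close>

lemma quasi_comm_bmat: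
  assumes ab: "a \<in> bidx W" "b \<in> bidx W"
  shows quasi_comm_bmat_right: "(\<Sum>c\<in>bidx W. sw H (hscale H) (\<lambda>h1 h2. hscale H (rform H h2 (bmat W c b)) (bmat W a c * h1)) h)
       = (\<Sum>c\<in>bidx W. sw H (hscale H) (\<lambda>h1 h2. hscale H (rform H h1 (bmat W a c)) (h2 * bmat W c b)) h)"
    and quasi_comm_bmat_left: "(\<Sum>c\<in>bidx W. sw H (hscale H) (\<lambda>h1 h2. hscale H (rform H (bmat W c b) h2) (h1 * bmat W a c)) h)
       = (\<Sum>c\<in>bidx W. sw H (hscale H) (\<lambda>h1 h2. hscale H (rform H (bmat W a c) h1) (bmat W c b * h2)) h)"
proof -
  have "(\<Sum>c\<in>bidx W. sw H (hscale H) (\<lambda>h1 h2. hscale H (rform H h2 (bmat W c b)) (bmat W a c * h1)) h)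
    = sw H (hscale H) (\<lambda>a1 a2. \<Sum>c\<in>bidx W. hscale H (rform H a2 (bmat W c b)) (bmat W a c * a1)) h"
    by (simp only: sw_fsum[OF vs])
  also have "\<dots> = sw H (hscale H) (\<lambda>a1 a2. sw H (hscale H) (\<lambda>b1 b2. hscale H (rform H a2 b2) (b1 * a1)) (bmat W a b)) h"
    by (intro sw_cong sw_bmat[symmetric] lin_intros_dqt ab)
  also have "\<dots> = sw H (hscale H) (\<lambda>a1 a2. sw H (hscale H) (\<lambda>b1 b2. hscale H (rform H a1 b1) (a2 * b2)) (bmat W a b)) h"
    by (rule quasi_comm)
  also have "\<dots> = sw H (hscale H) (\<lambda>a1 a2. \<Sum>c\<in>bidx W. hscale H (rform H a1 (bmat W a c)) (a2 * bmat W c b)) h"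
    by (intro sw_cong sw_bmat lin_intros_dqt ab)
  also have "\<dots> = (\<Sum>c\<in>bidx W. sw H (hscale H) (\<lambda>h1 h2. hscale H (rform H h1 (bmat W a c)) (h2 * bmat W c b)) h)"
    by (simp only: sw_fsum[OF vs])
  finally show "(\<Sum>c\<in>bidx W. sw H (hscale H) (\<lambda>h1 h2. hscale H (rform H h2 (bmat W c b)) (bmat W a c * h1)) h)
       = (\<Sum>c\<in>bidx W. sw H (hscale H) (\<lambda>h1 h2. hscale H (rform H h1 (bmat W a c)) (h2 * bmat W c b)) h)" .
  have "(\<Sum>c\<in>bidx W. sw H (hscale H) (\<lambda>h1 h2. hscale H (rform H (bmat W c b) h2) (h1 * bmat W a c)) h)
    = sw H (hscale H) (\<lambda>a1 a2. sw H (hscale H) (\<lambda>b1 b2. hscale H (rform H a2 b2) (b1 * a1)) h) (bmat W a b)"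
    by (rule sw_bmat[symmetric]) (intro lin_intros_dqt ab)+
  also have "\<dots> = sw H (hscale H) (\<lambda>a1 a2. sw H (hscale H) (\<lambda>b1 b2. hscale H (rform H a1 b1) (a2 * b2)) h) (bmat W a b)"
    by (rule quasi_comm)
  also have "\<dots> = (\<Sum>c\<in>bidx W. sw H (hscale H) (\<lambda>h1 h2. hscale H (rform H (bmat W a c) h1) (bmat W c b * h2)) h)"
    by (rule sw_bmat) (intro lin_intros_dqt ab)+
  finally show "(\<Sum>c\<in>bidx W. sw H (hscale H) (\<lambda>h1 h2. hscale H (rform H (bmat W c b) h2) (h1 * bmat W a c)) h)
       = (\<Sum>c\<in>bidx W. sw H (hscale H) (\<lambda>h1 h2. hscale H (rform H (bmat W a c) h1) (bmat W c b * h2)) h)" .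
qed

text \<open>Quasi-commutativity is applied once for each of the two factors \<open>\<R>\<close> of \<open>\<Q>\<close>.\<close>

lemma Qmap_exchange:
  assumes ab: "a \<in> bidx W" "b \<in> bidx W"
  shows "(\<Sum>c\<in>bidx W. sw H (hscale H) (\<lambda>h1 h2. hscale H (Qmap H h1 (bmat W a c)) (h2 * bmat W c b)) h)
    = (\<Sum>c\<in>bidx W. sw H (hscale H) (\<lambda>h1 h2. hscale H (Qmap H h2 (bmat W c b)) (h1 * bmat W a c)) h)"
proof -
  let ?r = "bmat W" and ?s = "hscale H" and ?I = "bidx W"
  interpret V: vector_space "hscale H" by (rule vs)
  have vl: "lin (*) ?s (\<lambda>k. ?s k x)" for x by (intro lin_vec lin_id vector_space_mult vs)
  have "(\<Sum>c\<in>?I. sw H ?s (\<lambda>x y. ?s (Qmap H x (?r a c)) (y * ?r c b)) h)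
     = (\<Sum>c\<in>?I. \<Sum>d\<in>?I. sw H ?s (\<lambda>x y. sw H ?s (\<lambda>x1 x2. ?s (rform H (?r a d) x1 * rform H x2 (?r d c)) (y * ?r c b)) x) h)"
    by (intro sum.cong refl) (simp only: Qmap_bmat ab V.scale_sum_left sw_fsum[OF vs] sw_of_lin[OF vl])
  also have "\<dots> = (\<Sum>c\<in>?I. \<Sum>d\<in>?I. sw H ?s (\<lambda>x y. sw H ?s (\<lambda>y1 y2. ?s (rform H (?r a d) x * rform H y1 (?r d c)) (y2 * ?r c b)) y) h)"
    by (intro sum.cong refl sw_assoc lin_intros_dqt)
  also have "\<dots> = (\<Sum>d\<in>?I. sw H ?s (\<lambda>x y. ?s (rform H (?r a d) x) (\<Sum>c\<in>?I. sw H ?s (\<lambda>y1 y2. ?s (rform H y1 (?r d c)) (y2 * ?r c b)) y)) h)"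
    by (subst sum.swap) (simp only: V.scale_sum_right sw_fsum[OF vs] sw_fscale[OF vs, symmetric] V.scale_scale)
  also have "\<dots> = (\<Sum>d\<in>?I. sw H ?s (\<lambda>x y. ?s (rform H (?r a d) x) (\<Sum>c\<in>?I. sw H ?s (\<lambda>y1 y2. ?s (rform H y2 (?r c b)) (?r d c * y1)) y)) h)"
    by (intro sum.cong refl sw_cong) (simp only: quasi_comm_bmat_right ab)
  also have "\<dots> = (\<Sum>d\<in>?I. \<Sum>c\<in>?I. sw H ?s (\<lambda>x y. sw H ?s (\<lambda>y1 y2. ?s (rform H (?r a d) x * rform H y2 (?r c b)) (?r d c * y1)) y) h)"
    by (simp only: V.scale_sum_right sw_fsum[OF vs] sw_fscale[OF vs, symmetric] V.scale_scale)
  also have "\<dots> = (\<Sum>d\<in>?I. \<Sum>c\<in>?I. sw H ?s (\<lambda>z y. sw H ?s (\<lambda>z1 z2. ?s (rform H (?r a d) z1 * rform H y (?r c b)) (?r d c * z2)) z) h)"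
    by (intro sum.cong refl sw_assoc[symmetric] lin_intros_dqt)
  also have "\<dots> = (\<Sum>c\<in>?I. sw H ?s (\<lambda>z y. ?s (rform H y (?r c b)) (\<Sum>d\<in>?I. sw H ?s (\<lambda>z1 z2. ?s (rform H (?r a d) z1) (?r d c * z2)) z)) h)"
    by (subst sum.swap) (simp only: V.scale_sum_right sw_fsum[OF vs] sw_fscale[OF vs, symmetric] V.scale_scale mult.commute)
  also have "\<dots> = (\<Sum>c\<in>?I. sw H ?s (\<lambda>z y. ?s (rform H y (?r c b)) (\<Sum>d\<in>?I. sw H ?s (\<lambda>z1 z2. ?s (rform H (?r d c) z2) (z1 * ?r a d)) z)) h)"
    by (intro sum.cong refl sw_cong) (simp only: quasi_comm_bmat_left ab)
  also have "\<dots> = (\<Sum>c\<in>?I. \<Sum>d\<in>?I. sw H ?s (\<lambda>z y. sw H ?s (\<lambda>z1 z2. ?s (rform H (?r d c) z2 * rform H y (?r c b)) (z1 * ?r a d)) z) h)"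
    by (simp only: V.scale_sum_right sw_fsum[OF vs] sw_fscale[OF vs, symmetric] V.scale_scale mult.commute)
  also have "\<dots> = (\<Sum>d\<in>?I. \<Sum>c\<in>?I. sw H ?s (\<lambda>z y. sw H ?s (\<lambda>z1 z2. ?s (rform H (?r d c) z2 * rform H y (?r c b)) (z1 * ?r a d)) z) h)"
    by (rule sum.swap)
  also have "\<dots> = (\<Sum>d\<in>?I. \<Sum>c\<in>?I. sw H ?s (\<lambda>z y. sw H ?s (\<lambda>y1 y2. ?s (rform H (?r d c) y1 * rform H y2 (?r c b)) (z * ?r a d)) y) h)"
    by (intro sum.cong refl sw_assoc lin_intros_dqt)
  also have "\<dots> = (\<Sum>d\<in>?I. sw H ?s (\<lambda>z y. ?s (Qmap H y (?r d b)) (z * ?r a d)) h)"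
    by (intro sum.cong refl) (simp only: Qmap_bmat ab V.scale_sum_left sw_fsum[OF vs] sw_of_lin[OF vl])
  finally show ?thesis .
qed

text \<open>Insert \<open>\<rho> S\<rho> = 1\<close> to the right of
  \<open>S(h1) \<Q>(h2) h3\<close>. \<open>Qmap_exchange\<close> then moves \<open>\<Q>\<close> from
  the middle to the last coproduct factor of \<open>h\<close>, so that \<open>S(h1)\<close> meets
  \<open>h2\<close> and cancels. In coordinates this is the equivariance of
  \<open>\<rho>_W \<circ> \<Q>\<close>.\<close>

lemma Qmap_Ad:
  assumes ab: "a \<in> bidx W" "b \<in> bidx W"
  shows "sw3 H (hscale H) (\<lambda>h1 h2 h3. hscale H (Qmap H h2 (bmat W a b)) (antipode H h1 * h3)) h
    = (\<Sum>\<alpha>\<in>bidx W. \<Sum>\<beta>\<in>bidx W. hscale H (Qmap H h (bmat W \<alpha> \<beta>)) (bmat W a \<alpha> * antipode H (bmat W \<beta> b)))"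
proof -
  let ?r = "bmat W" and ?s = "hscale H" and ?I = "bidx W" and ?S = "antipode H"
  interpret V: vector_space "hscale H" by (rule vs)
  have one: "sw H ?s (\<lambda>y1 y2. ?s (Qmap H y1 (?r a b)) y2) y
      = (\<Sum>d\<in>?I. \<Sum>c\<in>?I. sw H ?s (\<lambda>y1 y2. ?s (Qmap H y2 (?r c d)) (y1 * ?r a c * ?S (?r d b))) y)" for y
  proof -
    have l: "lin ?s ?s (\<lambda>x. x * c)" for c by (intro lin_intros)
    \<comment> \<open>The sum over \<open>c\<close> with a Kronecker delta makes room for
      \<open>\<rho>^c_d S\<rho>^d_b\<close>, which sums over \<open>d\<close> to that delta.\<close>
    have "sw H ?s (\<lambda>y1 y2. ?s (Qmap H y1 (?r a b)) y2) y
       = (\<Sum>c\<in>?I. if c = b then sw H ?s (\<lambda>y1 y2. ?s (Qmap H y1 (?r a c)) y2) y else 0)"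
      using ab finite_basis by simp
    also have "\<dots> = (\<Sum>c\<in>?I. sw H ?s (\<lambda>y1 y2. ?s (Qmap H y1 (?r a c)) (y2 * (\<Sum>d\<in>?I. ?r c d * ?S (?r d b)))) y)"
      by (intro sum.cong refl) (simp add: antipode_bmat_right ab sw_fzero[OF vs])
    also have "\<dots> = (\<Sum>d\<in>?I. \<Sum>c\<in>?I. sw H ?s (\<lambda>y1 y2. ?s (Qmap H y1 (?r a c)) (y2 * ?r c d)) y * ?S (?r d b))"
      by (subst sum.swap) (simp only: sum_distrib_left V.scale_sum_right sw_fsum[OF vs] sw_of_lin[OF l] hscale_mult mult.assoc)
    also have "\<dots> = (\<Sum>d\<in>?I. \<Sum>c\<in>?I. sw H ?s (\<lambda>y1 y2. ?s (Qmap H y2 (?r c d)) (y1 * ?r a c)) y * ?S (?r d b))"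
      by (rule sum.cong[OF refl]) (simp only: sum_distrib_right[symmetric] Qmap_exchange ab)
    also have "\<dots> = (\<Sum>d\<in>?I. \<Sum>c\<in>?I. sw H ?s (\<lambda>y1 y2. ?s (Qmap H y2 (?r c d)) (y1 * ?r a c * ?S (?r d b))) y)"
      by (simp only: sw_of_lin[OF l] hscale_mult)
    finally show ?thesis .
  qed
  have l: "lin ?s ?s (\<lambda>x. c * x)" for c by (intro lin_intros)
  have "sw3 H ?s (\<lambda>h1 h2 h3. ?s (Qmap H h2 (?r a b)) (?S h1 * h3)) h
     = sw H ?s (\<lambda>x y. ?S x * sw H ?s (\<lambda>y1 y2. ?s (Qmap H y1 (?r a b)) y2) y) h"
    by (simp only: sw3_def sw_of_lin[OF l] hscale_mult)
  also have "\<dots> = (\<Sum>d\<in>?I. \<Sum>c\<in>?I. sw H ?s (\<lambda>x y. sw H ?s (\<lambda>y1 y2. ?s (Qmap H y2 (?r c d)) ((?S x * y1) * (?r a c * ?S (?r d b)))) y) h)"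
    by (simp only: one sum_distrib_left sw_fsum[OF vs] sw_of_lin[OF l] hscale_mult mult.assoc)
  also have "\<dots> = (\<Sum>d\<in>?I. \<Sum>c\<in>?I. sw H ?s (\<lambda>x y. sw H ?s (\<lambda>x1 x2. ?s (Qmap H y (?r c d)) ((?S x1 * x2) * (?r a c * ?S (?r d b)))) x) h)"
    by (intro sum.cong refl sw_assoc[symmetric] lin_intros_Q)
  also have "\<dots> = (\<Sum>d\<in>?I. \<Sum>c\<in>?I. sw H ?s (\<lambda>x y. ?s (counit H x) (?s (Qmap H y (?r c d)) (1 * (?r a c * ?S (?r d b))))) h)"
    by (intro sum.cong refl sw_cong sw_antipode_left lin_intros_Q)
  also have "\<dots> = (\<Sum>d\<in>?I. \<Sum>c\<in>?I. ?s (Qmap H h (?r c d)) (1 * (?r a c * ?S (?r d b))))"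
    by (intro sum.cong refl sw_counit_left lin_intros_Q)
  finally show ?thesis by (subst sum.swap) simp
qed

end

section \<open>Quotients and kernels of spaces with carriers\<close>

lemma quot_simps:
  assumes M: "vspace M" and N: "module.subspace (scl M) N" "N \<subseteq> car M"
  shows vspace_quot: "vspace (quot M N)" and quot_sub: "car (quot M N) \<subseteq> car M"
    and cls_in_quot: "x \<in> car M \<Longrightarrow> cls (scl M) N x \<in> car (quot M N)"
    and cls_quot: "x \<in> car (quot M N) \<Longrightarrow> cls (scl M) N x = x"
proof -
  interpret vector_space "scl M" using M by (rule vs_vspace)
  interpret vector_space_pair "scl M" "scl M" ..
  note c = cls_props[OF vector_space_axioms N(1)]
  show "vspace (quot M N)"
    using linear_subspace_image[OF c(1) M[unfolded vspace_def, THEN conjunct2]]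
    by (simp add: vspace_def quot_def vector_space_axioms)
  \<comment> \<open>A class differs from its argument by an element of \<open>N\<close>, so the
    chosen representatives stay inside \<open>M\<close>.\<close>
  have "cls (scl M) N x \<in> car M" if "x \<in> car M" for x
    using vspace_add[OF M that subsetD[OF N(2) c(5)[of x]]] by simp
  then show "car (quot M N) \<subseteq> car M" by (auto simp: quot_def)
  show "x \<in> car M \<Longrightarrow> cls (scl M) N x \<in> car (quot M N)" by (simp add: quot_def)
  show "x \<in> car (quot M N) \<Longrightarrow> cls (scl M) N x = x" using c(2) by (auto simp: quot_def)
qed

lemma lin_ext_in:
  assumes "vspace M" "\<And>a b. f a b \<in> car M"
  shows "lin_ext (scl M) f t \<in> car M"
  unfolding lin_ext_def by (intro vspace_sum[OF assms(1)] vspace_scl[OF assms(1)] assms(2))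

lemma vspace_kernel:
  assumes M: "vspace M" and L: "lin (scl M) s L"
  shows "vspace \<lparr>car = {x \<in> car M. L x = 0}, scl = scl M\<rparr>"
proof -
  interpret vector_space "scl M" using M by (rule vs_vspace)
  interpret s: vector_space s using lin_vs2[OF L] .
  show ?thesis
    unfolding vspace_def using vspace_memb[OF M]
    by (auto intro!: vector_space_axioms subspaceI simp: lin_zero[OF L] lin_add[OF L] lin_scale[OF L])
qed

section \<open>The calculus defined by the comodule\<close>

locale comodule_calculus = dqt_comodule H W
  for H :: "('k::field, 'h::ring_1, 'z) dqt_hopf_scheme" and W :: "('k, 'h, 'w::ab_group_add, 'i) based_comod" +
  assumes surj: "rho_Q H W ` car (ker_eps H) = car (End W)"
begin

lemma rho_Q_mat: "rho_Q H W h = mat_op W (\<lambda>\<alpha> \<beta>. Qmap H h (bmat W \<alpha> \<beta>))"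
  by (simp add: rho_Q_def rho_W_def)

lemma rho_Q_in: "rho_Q H W h \<in> car (End W)"
  unfolding rho_Q_mat by (rule mat_op_in)

lemma entry_rho_Q: "\<alpha> \<in> bidx W \<Longrightarrow> \<beta> \<in> bidx W \<Longrightarrow> entry W (rho_Q H W h) \<alpha> \<beta> = Qmap H h (bmat W \<alpha> \<beta>)"
  unfolding rho_Q_mat by (rule entry_mat_op)

lemma lin_rho_Q: "lin (hscale H) (scl (End W)) (rho_Q H W)"
  unfolding rho_Q_mat mat_op_def by (intro lin_fsum lin_vec lin_Qmap lin_id vs vs_End)

lemma rho_Q_one: "rho_Q H W 1 = id"
  by (rule End_eqI[OF rho_Q_in id_in_End]) (simp add: entry_rho_Q Qmap_one dvec_basis)

lemma QH_iff: "h \<in> QH H W \<longleftrightarrow> counit H h = 0 \<and> rho_Q H W h = 0"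
  by (simp add: QH_def)

lemma lin_counit': "lin (hscale H) (*) (counit H)"
  by (intro lin_counit lin_id vs)

lemma subspace_QH: "module.subspace (hscale H) (QH H W)"
proof -
  interpret vector_space "hscale H" by (rule vs)
  interpret E: vector_space "scl (End W)" by (rule vs_End)
  show ?thesis
    by (rule subspaceI)
      (simp_all add: QH_iff lin_zero[OF lin_rho_Q] lin_add[OF lin_rho_Q] lin_scale[OF lin_rho_Q]
        lin_zero[OF lin_counit'] lin_add[OF lin_counit'] lin_scale[OF lin_counit'])
qed

lemma vspace_ker_eps: "vspace (ker_eps H)"
  using vspace_kernel[OF vspace_hvs lin_counit'[folded scl_hvs]] by (simp add: ker_eps_def)

lemma scl_ker_eps [simp]: "scl (ker_eps H) = hscale H"
  by (simp add: ker_eps_def)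

lemma in_ker_eps: "x \<in> car (ker_eps H) \<longleftrightarrow> counit H x = 0"
  by (simp add: ker_eps_def)

lemma QH_sub: "QH H W \<subseteq> car (ker_eps H)"
  by (auto simp: QH_iff in_ker_eps)

lemmas Omega0_quot = quot_simps[OF vspace_ker_eps, unfolded scl_ker_eps, OF subspace_QH QH_sub, folded Omega0_def]

lemma scl_Omega0 [simp]: "scl (Omega0 H Q) = hscale H"
  by (simp add: Omega0_def quot_def)

lemma rho_Q_cls: "rho_Q H W (cls (hscale H) (QH H W) x) = rho_Q H W x"
  using cls_in_coset[OF vs subspace_QH, of x] by (simp add: QH_iff lin_diff[OF lin_rho_Q])

text \<open>The first isomorphism theorem: \<open>Q_H\<close> is the kernel on
  \<open>ker \<epsilon>\<close>, and an element of the quotient is a representative in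
  \<open>ker \<epsilon>\<close> that is fixed by \<open>cls\<close>.\<close>

lemma viso_rho_Q: "viso (Omega0 H (QH H W)) (End W) (rho_Q H W)"
  unfolding viso_def bij_betw_def
proof (intro conjI)
  show "vlin (Omega0 H (QH H W)) (End W) (rho_Q H W)"
    by (rule vlin_lin) (auto simp: lin_rho_Q rho_Q_in)
  show "inj_on (rho_Q H W) (car (Omega0 H (QH H W)))"
  proof (rule inj_onI)
    fix x y assume xy: "x \<in> car (Omega0 H (QH H W))" "y \<in> car (Omega0 H (QH H W))" "rho_Q H W x = rho_Q H W y"
    then have "x - y \<in> QH H W"
      using subsetD[OF Omega0_quot(2)] by (auto simp: QH_iff in_ker_eps lin_diff[OF lin_rho_Q] lin_diff[OF lin_counit'])
    then have "cls (hscale H) (QH H W) x = cls (hscale H) (QH H W) y"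
      using cls_eq_iff[OF vs subspace_QH] by blast
    then show "x = y" using xy by (simp add: Omega0_quot(4))
  qed
  have "car (Omega0 H (QH H W)) = cls (hscale H) (QH H W) ` car (ker_eps H)"
    by (simp add: Omega0_def quot_def)
  then show "rho_Q H W ` car (Omega0 H (QH H W)) = car (End W)"
    using surj by (simp add: image_image rho_Q_cls)
qed

text \<open>This is the inner factor of \<open>vbein\<close>. Its values on operators lie in
  \<open>ker \<epsilon>\<close>, as is required for the components of \<open>e_MC\<close>.\<close>

definition lift :: "('w \<Rightarrow> 'w) \<Rightarrow> 'h" where
  "lift = the_inv_into (car (Omega0 H (QH H W))) (rho_Q H W)"

lemma lift:
  assumes "\<phi> \<in> car (End W)"
  shows lift_in: "lift \<phi> \<in> car (Omega0 H (QH H W))" and rho_Q_lift: "rho_Q H W (lift \<phi>) = \<phi>"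
    and counit_lift: "counit H (lift \<phi>) = 0"
proof -
  have b: "bij_betw (rho_Q H W) (car (Omega0 H (QH H W))) (car (End W))" using viso_rho_Q by (simp add: viso_def)
  show *: "lift \<phi> \<in> car (Omega0 H (QH H W))"
    using bij_betwE[OF bij_betw_the_inv_into[OF b]] assms by (simp add: lift_def)
  show "rho_Q H W (lift \<phi>) = \<phi>" unfolding lift_def by (rule f_the_inv_into_f_bij_betw[OF b]) (use assms in simp)
  show "counit H (lift \<phi>) = 0" using subsetD[OF Omega0_quot(2) *] by (simp add: in_ker_eps)
qed

lemma pi_tilde_in: "pi_tilde H (QH H W) h \<in> car (Omega0 H (QH H W))"
  unfolding pi_tilde_def
  by (rule Omega0_quot(3)) (simp add: in_ker_eps lin_diff[OF lin_counit'] lin_scale[OF lin_counit'] counit_one)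

lemma lin_pi_tilde: "lin r (hscale H) f \<Longrightarrow> lin r (hscale H) (\<lambda>x. pi_tilde H (QH H W) (f x))"
  unfolding pi_tilde_def by (intro lin_compose[OF _ lin_cls[OF vs subspace_QH]] lin_intros)

lemma rho_Q_pi_tilde: "rho_Q H W (pi_tilde H (QH H W) h) = rho_Q H W h - scl (End W) (counit H h) id"
  by (simp add: pi_tilde_def rho_Q_cls lin_diff[OF lin_rho_Q] lin_scale[OF lin_rho_Q] rho_Q_one)

lemma vlin_rho_Q: "vlin (Omega0 H (QH H W)) (End W) (rho_Q H W)"
  using viso_rho_Q by (simp add: viso_def)

text \<open>\<open>pi_tilde\<close> replaces \<open>g\<close> by \<open>g - \<epsilon>(g) 1\<close>.
  As \<open>\<rho>_W \<Q>(1) = id\<close>, this adds only a multiple of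
  \<open>id \<otimes> S(v1) \<epsilon>(v2) v3\<close>, and that vanishes on
  \<open>ker \<epsilon>\<close>. The rest is \<open>Qmap_Ad\<close>, entry by entry.\<close>

lemma comodule_map_rho_Q: "comodule_map H (Omega0 H (QH H W)) (Ad0 H (QH H W)) (End W) (End_coact H W) (rho_Q H W)"
  unfolding comodule_map_def
proof (intro conjI ballI vlin_rho_Q)
  fix v assume "v \<in> car (Omega0 H (QH H W))"
  then have v: "counit H v = 0" using subsetD[OF Omega0_quot(2)] by (auto simp: in_ker_eps)
  let ?t = "tens (End W) (hvs H)" and ?S = "antipode H" and ?s = "hscale H" and ?r = "bmat W" and ?I = "bidx W"
  let ?F = "\<lambda>u h. ?t (rho_Q H W u) h"
  interpret h: vector_space "hscale H" by (rule vs)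
  interpret p: vector_space "pscale :: 'k \<Rightarrow> (('w \<Rightarrow> 'w) \<times> 'h \<Rightarrow>\<^sub>0 'k) \<Rightarrow> _" by (rule vector_space_pscale)
  note tl = tens_lin_right[OF vspace_End vspace_hvs car_hvs, unfolded scl_hvs]
  have bF: "bilin (Omega0 H (QH H W)) (hvs H) (uvs pscale) ?F"
    by (intro bilin_tens vspace_End vspace_hvs Omega0_quot(1) vlin_rho_Q vlin_id)
  \<comment> \<open>The dependence on \<open>g\<close> is moved into the factor \<open>H\<close>,
    whose carrier is the whole type, so that linearity in \<open>g\<close> follows from the rules
    for \<open>tens\<close> in its right slot.\<close>
  have t1: "?t (rho_Q H W (pi_tilde H (QH H W) g)) k
      = (\<Sum>a\<in>?I. \<Sum>b\<in>?I. ?t (unit_op W (a, b)) (?s (Qmap H g (?r a b)) k)) - ?t id (?s (counit H g) k)" for g k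
  proof -
    have "?t (rho_Q H W (pi_tilde H (QH H W) g)) k + ?t (scl (End W) (counit H g) id) k = ?t (rho_Q H W g) k"
      by (subst tens_add_left[OF vspace_End vspace_hvs, symmetric])
        (simp_all add: rho_Q_pi_tilde rho_Q_in vspace_diff[OF vspace_End] vspace_scl[OF vspace_End] id_in_End)
    moreover have "?t (rho_Q H W g) k = (\<Sum>a\<in>?I. \<Sum>b\<in>?I. ?t (scl (End W) (Qmap H g (?r a b)) (unit_op W (a, b))) k)"
      by (simp add: rho_Q_mat mat_op_def tens_sum_left[OF vspace_End vspace_hvs] vspace_sum[OF vspace_End] vspace_scl[OF vspace_End] unit_op_in)
    ultimately show ?thesis
      by (simp add: tens_scale_left[OF vspace_End vspace_hvs] tens_scale_right[OF vspace_End vspace_hvs, unfolded scl_hvs]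
          unit_op_in id_in_End algebra_simps)
  qed
  have lt1: "lin pscale pscale (lin_ext pscale (\<lambda>g k. ?t (rho_Q H W (pi_tilde H (QH H W) g)) k))"
    by (rule linear_lin_ext[OF vector_space_pscale])
  have "lin_ext pscale ?F (Ad0 H (QH H W) v) = lin_ext pscale (\<lambda>g k. ?t (rho_Q H W (pi_tilde H (QH H W) g)) k) (Ad H v)"
    unfolding Ad0_def lin_of_lin_ext[OF linear_lin_ext[OF vector_space_pscale]]
    by (simp add: lin_ext_eval_bilin[OF Omega0_quot(1) vspace_hvs vector_space_pscale bF])
  also have "\<dots> = sw3 H pscale (\<lambda>h1 h2 h3. ?t (rho_Q H W (pi_tilde H (QH H W) h2)) (?S h1 * h3)) v"
    unfolding Ad_def sw3_def sw_of_lin[OF lt1]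
  proof (intro sw_cong lin_ext_htens vector_space_pscale)
    show "lin ?s pscale (\<lambda>k. ?t (rho_Q H W (pi_tilde H (QH H W) a)) k)" for a
      by (intro tl rho_Q_in)
    show "lin ?s pscale (\<lambda>a. ?t (rho_Q H W (pi_tilde H (QH H W) a)) b)" for b
      unfolding t1 by (intro lin_fdiff lin_fsum lin_compose[OF _ tl[OF unit_op_in]] lin_compose[OF _ tl[OF id_in_End]] lin_intros_Q)
  qed
  also have "\<dots> = (\<Sum>a\<in>?I. \<Sum>b\<in>?I. ?t (unit_op W (a, b)) (sw3 H ?s (\<lambda>h1 h2 h3. ?s (Qmap H h2 (?r a b)) (?S h1 * h3)) v))
       - ?t id (sw3 H ?s (\<lambda>h1 h2 h3. ?s (counit H h2) (?S h1 * h3)) v)"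
    by (simp only: t1 sw3_fdiff[OF vector_space_pscale] sw3_fsum[OF vector_space_pscale] sw3_of_lin[OF tl[OF unit_op_in]] sw3_of_lin[OF tl[OF id_in_End]])
  also have "sw3 H ?s (\<lambda>h1 h2 h3. ?s (counit H h2) (?S h1 * h3)) v = sw H ?s (\<lambda>h1 h2. ?S h1 * h2) v"
    unfolding sw3_def by (intro sw_cong sw_counit_left lin_intros)
  also have "\<dots> = 0"
    by (simp only: antipode_left v h.scale_zero_left)
  also have "(\<Sum>a\<in>?I. \<Sum>b\<in>?I. ?t (unit_op W (a, b)) (sw3 H ?s (\<lambda>h1 h2 h3. ?s (Qmap H h2 (?r a b)) (?S h1 * h3)) v))
      = (\<Sum>a\<in>?I. \<Sum>b\<in>?I. \<Sum>\<alpha>\<in>?I. \<Sum>\<beta>\<in>?I. pscale (Qmap H v (?r \<alpha> \<beta>)) (?t (unit_op W (a, b)) (?r a \<alpha> * ?S (?r \<beta> b))))"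
    by (intro sum.cong refl) (simp only: Qmap_Ad lin_sum[OF tl[OF unit_op_in]] lin_scale[OF tl[OF unit_op_in]])
  also have "\<dots> = End_coact H W (rho_Q H W v)"
    unfolding End_coact_def by (subst sum_swap4) (intro sum.cong refl, simp only: entry_rho_Q)
  finally show "End_coact H W (rho_Q H W v) = lin_ext pscale ?F (Ad0 H (QH H W) v)"
    by (simp only: tens_zero_right[OF vspace_End vspace_hvs id_in_End] diff_zero)
qed

section \<open>Left components computed on representatives, and the bimodule structure in terms of
  them\<close>

definition mu :: "('h \<times> 'h \<Rightarrow>\<^sub>0 'k) \<Rightarrow> 'h" where
  "mu = lin_ext (hscale H) (*)"

text \<open>The left components of a one-form with respect to the basis \<open>unit_op\<close> of \<open>End W\<close>, computed on
  representatives in \<open>H \<otimes> H\<close>.\<close>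

definition theta :: "'i \<Rightarrow> 'i \<Rightarrow> ('h \<times> 'h \<Rightarrow>\<^sub>0 'k) \<Rightarrow> 'h" where
  "theta \<alpha> \<beta> = lin_ext (hscale H) (\<lambda>x y. sw H (hscale H) (\<lambda>y1 y2. hscale H (Qmap H y2 (bmat W \<alpha> \<beta>)) (x * y1)) y)"

lemma lin_mu: "lin pscale (hscale H) mu"
  unfolding mu_def by (rule linear_lin_ext[OF vs])

lemma lin_theta: "lin pscale (hscale H) (theta \<alpha> \<beta>)"
  unfolding theta_def by (rule linear_lin_ext[OF vs])

lemma mu_htens: "mu (htens H a b) = a * b"
  unfolding mu_def by (rule lin_ext_htens[OF vs]) (intro lin_intros)+

lemma theta_htens: "theta \<alpha> \<beta> (htens H x y) = sw H (hscale H) (\<lambda>y1 y2. hscale H (Qmap H y2 (bmat W \<alpha> \<beta>)) (x * y1)) y"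
  unfolding theta_def by (rule lin_ext_htens[OF vs]) (intro lin_intros_Q)+

lemma lin_can: "lin pscale pscale (can H)"
  unfolding can_def by (rule linear_lin_ext[OF vector_space_pscale])

lemma can_htens: "can H (htens H h g) = sw H pscale (\<lambda>g1 g2. htens H (h * g1) g2) g"
  unfolding can_def by (rule lin_ext_htens[OF vector_space_pscale]) (intro lin_intros)+

lemma htens_in: "htens H a b \<in> car (hh H)"
  by (rule tens_in[OF vspace_hvs vspace_hvs]) simp_all

lemma lin_ext_hh_in: "(\<And>a b. f a b \<in> car (hh H)) \<Longrightarrow> lin_ext pscale f t \<in> car (hh H)"
  using lin_ext_in[OF vspace_hh, of f t] by (simp add: scl_tprod)

lemma sw_hh_in: "(\<And>a b. f a b \<in> car (hh H)) \<Longrightarrow> sw H pscale f t \<in> car (hh H)"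
  unfolding sw_def by (rule lin_ext_hh_in)

lemma can_in: "can H t \<in> car (hh H)"
  unfolding can_def by (intro lin_ext_hh_in sw_hh_in htens_in)

lemma in_ker_mult: "t \<in> car (ker_mult H) \<longleftrightarrow> t \<in> car (hh H) \<and> mu t = 0"
  by (simp add: ker_mult_def mu_def)

lemma scl_ker_mult [simp]: "scl (ker_mult H) = pscale"
  by (simp add: ker_mult_def)

lemma vspace_ker_mult: "vspace (ker_mult H)"
  using vspace_kernel[OF vspace_hh, of "hscale H" mu] lin_mu by (simp add: ker_mult_def mu_def scl_tprod)

lemma subspace_Omega1_rel: "module.subspace pscale (Omega1_rel H Q)"
proof -
  interpret vector_space "pscale :: 'k \<Rightarrow> ('h \<times> 'h \<Rightarrow>\<^sub>0 'k) \<Rightarrow> _" by (rule vector_space_pscale)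
  note s = subspace_span[of "{htens H h q |h q. q \<in> Q}"]
  show ?thesis
    unfolding Omega1_rel_def using vspace_memb[OF vspace_ker_mult]
    by (intro subspaceI) (simp_all add: lin_zero[OF lin_can] lin_add[OF lin_can] lin_scale[OF lin_can]
        subspace_0[OF s] subspace_add[OF s] subspace_scale[OF s])
qed

lemma Omega1_rel_sub: "Omega1_rel H Q \<subseteq> car (ker_mult H)"
  by (auto simp: Omega1_rel_def)

lemmas Omega1_quot = quot_simps[OF vspace_ker_mult, unfolded scl_ker_mult, OF subspace_Omega1_rel Omega1_rel_sub, folded Omega1_def]

lemma scl_Omega1 [simp]: "scl (Omega1 H Q) = pscale"
  by (simp add: Omega1_def quot_def)

text \<open>\<open>id \<otimes> \<rho>\<^sub>W \<circ> \<Q>\<close> has kernel \<open>H \<otimes> Q\<^sub>H\<close> on \<open>H \<otimes> ker \<epsilon>\<close>: the map \<open>P\<close> below projects onto \<open>Q\<^sub>H\<close>, and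
  the correction terms are read off from \<open>id \<otimes> \<epsilon>\<close> and \<open>id \<otimes> \<rho>\<^sub>W \<circ> \<Q>\<close>.\<close>

lemma Omega1_rel_iff:
  assumes t: "t \<in> car (ker_mult H)"
  shows "t \<in> Omega1_rel H (QH H W) \<longleftrightarrow> (\<forall>\<alpha>\<in>bidx W. \<forall>\<beta>\<in>bidx W. theta \<alpha> \<beta> t = 0)"
proof -
  interpret p: vector_space "pscale :: 'k \<Rightarrow> ('h \<times> 'h \<Rightarrow>\<^sub>0 'k) \<Rightarrow> _" by (rule vector_space_pscale)
  interpret h: vector_space "hscale H" by (rule vs)
  interpret E: vector_space "scl (End W)" by (rule vs_End)
  interpret ph: vector_space_pair "pscale :: 'k \<Rightarrow> ('h \<times> 'h \<Rightarrow>\<^sub>0 'k) \<Rightarrow> _" "hscale H"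
    by (intro vector_space_pair.intro vector_space_pscale vs)
  have t': "t \<in> car (hh H)" "mu t = 0" using t by (simp_all add: in_ker_mult)
  \<comment> \<open>\<open>E\<close> is \<open>id \<otimes> \<epsilon>\<close>, and \<open>D\<close>
    is \<open>id\<close> tensored with a matrix entry of \<open>\<rho>_W \<circ> \<Q>\<close>.
    Composed with \<open>can\<close> they become \<open>mu\<close> and \<open>theta\<close>, which
    is how the hypotheses on \<open>t\<close> reach \<open>can H t\<close>.\<close>
  define E where "E = lin_ext (hscale H) (\<lambda>h g. hscale H (counit H g) h)"
  define D where "D \<alpha> \<beta> = lin_ext (hscale H) (\<lambda>h g. hscale H (Qmap H g (bmat W \<alpha> \<beta>)) h)" for \<alpha> \<beta>
  have lE: "lin pscale (hscale H) E" unfolding E_def by (rule linear_lin_ext[OF vs])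
  have lD: "lin pscale (hscale H) (D \<alpha> \<beta>)" for \<alpha> \<beta> unfolding D_def by (rule linear_lin_ext[OF vs])
  have Et: "E (htens H h g) = hscale H (counit H g) h" for h g
    unfolding E_def by (rule lin_ext_htens[OF vs]) (intro lin_intros)+
  have Dt: "D \<alpha> \<beta> (htens H h g) = hscale H (Qmap H g (bmat W \<alpha> \<beta>)) h" for \<alpha> \<beta> h g
    unfolding D_def by (rule lin_ext_htens[OF vs]) (intro lin_intros_Q)+
  have "E (can H t) = mu t"
  proof (rule hh_eqI[OF t'(1) lin_compose[OF lin_can lE] lin_mu])
    fix a b
    have "E (can H (htens H a b)) = sw H (hscale H) (\<lambda>g1 g2. hscale H (counit H g2) (a * g1)) b"
      by (simp add: can_htens sw_of_lin[OF lE] Et)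
    also have "\<dots> = a * b" by (rule sw_counit_right) (intro lin_intros)
    finally show "E (can H (htens H a b)) = mu (htens H a b)" by (simp add: mu_htens)
  qed
  then have E0: "E (can H t) = 0" using t' by simp
  have D: "D \<alpha> \<beta> (can H t) = theta \<alpha> \<beta> t" for \<alpha> \<beta>
    by (rule hh_eqI[OF t'(1) lin_compose[OF lin_can lD] lin_theta]) (simp add: can_htens sw_of_lin[OF lD] Dt theta_htens)
  show ?thesis
  proof
    assume "t \<in> Omega1_rel H (QH H W)"
    then have sp: "can H t \<in> p.span {htens H h q |h q. q \<in> QH H W}" by (simp add: Omega1_rel_def)
    show "\<forall>\<alpha>\<in>bidx W. \<forall>\<beta>\<in>bidx W. theta \<alpha> \<beta> t = 0"
    proof (intro ballI)
      fix \<alpha> \<beta> assume ab: "\<alpha> \<in> bidx W" "\<beta> \<in> bidx W"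
      have "D \<alpha> \<beta> (can H t) = 0"
        by (rule ph.linear_eq_0_on_span[OF lD _ sp])
          (auto simp: Dt QH_iff ab entry_rho_Q[symmetric] lin_zero[OF lin_dvec])
      then show "theta \<alpha> \<beta> t = 0" by (simp add: D)
    qed
  next
    assume th: "\<forall>\<alpha>\<in>bidx W. \<forall>\<beta>\<in>bidx W. theta \<alpha> \<beta> t = 0"
    \<comment> \<open>Dual vectors for the functionals in \<open>E\<close> and \<open>D\<close>:
      \<open>u0\<close> has \<open>\<epsilon> = 1\<close> and is killed by
      \<open>\<rho>_W \<circ> \<Q>\<close>, while \<open>v \<alpha> \<beta>\<close> has
      \<open>\<epsilon> = 0\<close> and is sent to a matrix unit. Subtracting the corresponding
      multiples from \<open>g\<close> leaves an element of \<open>Q_H\<close>.\<close>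
    define u0 where "u0 = 1 - lift id"
    define v where "v \<alpha> \<beta> = lift (unit_op W (\<alpha>, \<beta>))" for \<alpha> \<beta>
    define P where "P g = g - hscale H (counit H g) u0 - (\<Sum>\<alpha>\<in>bidx W. \<Sum>\<beta>\<in>bidx W. hscale H (Qmap H g (bmat W \<alpha> \<beta>)) (v \<alpha> \<beta>))" for g
    have PQ: "P g \<in> QH H W" for g
      by (simp add: QH_iff P_def u0_def v_def lin_diff[OF lin_counit'] lin_scale[OF lin_counit'] lin_sum[OF lin_counit']
          counit_one counit_lift id_in_End unit_op_in lin_diff[OF lin_rho_Q] lin_scale[OF lin_rho_Q] lin_sum[OF lin_rho_Q]
          rho_Q_one rho_Q_lift)
        (simp add: rho_Q_mat mat_op_def E.scale_zero_right)
    have lP: "lin (hscale H) (hscale H) P"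
      unfolding P_def by (intro lin_intros_Q)
    define u where "u = can H t"
    have u: "u \<in> car (hh H)" by (simp add: u_def can_in)
    have "u = lin_ext pscale (\<lambda>h g. htens H h (P g)) u + htens H (E u) u0 + (\<Sum>\<alpha>\<in>bidx W. \<Sum>\<beta>\<in>bidx W. htens H (D \<alpha> \<beta> u) (v \<alpha> \<beta>))"
    proof (rule hh_eqI[OF u lin_id[OF vector_space_pscale]])
      show "lin pscale pscale (\<lambda>u. lin_ext pscale (\<lambda>h g. htens H h (P g)) u + htens H (E u) u0 + (\<Sum>\<alpha>\<in>bidx W. \<Sum>\<beta>\<in>bidx W. htens H (D \<alpha> \<beta> u) (v \<alpha> \<beta>)))"
        by (intro lin_intros lin_htens_left lE lD)
      fix a b
      have l1: "lin (hscale H) pscale (htens H a)" by (intro lin_intros)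
      have "lin_ext pscale (\<lambda>h g. htens H h (P g)) (htens H a b) = htens H a (P b)"
        by (rule lin_ext_htens[OF vector_space_pscale]) (intro lin_intros lP lin_compose[OF lP])+
      moreover have "htens H (hscale H c x) y = htens H x (hscale H c y)" for c x y
        using tens_scale_left[OF vspace_hvs vspace_hvs, of x y c] tens_scale_right[OF vspace_hvs vspace_hvs, of x y c] by simp
      ultimately show "htens H a b = lin_ext pscale (\<lambda>h g. htens H h (P g)) (htens H a b) + htens H (E (htens H a b)) u0
          + (\<Sum>\<alpha>\<in>bidx W. \<Sum>\<beta>\<in>bidx W. htens H (D \<alpha> \<beta> (htens H a b)) (v \<alpha> \<beta>))"
        by (simp add: P_def Et Dt lin_diff[OF l1] lin_sum[OF l1])
    qed
    also have "\<dots> = lin_ext pscale (\<lambda>h g. htens H h (P g)) u"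
      using th E0 by (simp add: D u_def tens_zero_left[OF vspace_hvs vspace_hvs])
    also have "\<dots> \<in> p.span {htens H h q |h q. q \<in> QH H W}"
      unfolding lin_ext_def by (intro p.span_sum p.span_scale p.span_base) (use PQ in blast)
    finally show "t \<in> Omega1_rel H (QH H W)" using t by (simp add: Omega1_rel_def u_def)
  qed
qed

text \<open>Passing to a class changes \<open>t\<close> by a relation, and \<open>theta\<close>
  kills relations. Forms can therefore be evaluated on the representatives from which they are
  built.\<close>

lemma theta_cls1: "\<alpha> \<in> bidx W \<Longrightarrow> \<beta> \<in> bidx W \<Longrightarrow> theta \<alpha> \<beta> (cls1 H (QH H W) t) = theta \<alpha> \<beta> t"
  using cls_in_coset[OF vector_space_pscale subspace_Omega1_rel, of "QH H W" t] Omega1_rel_iff Omega1_rel_sub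
  by (force simp: lin_diff[OF lin_theta])

lemma Omega1_eqI:
  assumes "x \<in> car (Omega1 H (QH H W))" "y \<in> car (Omega1 H (QH H W))"
    and "\<And>\<alpha> \<beta>. \<alpha> \<in> bidx W \<Longrightarrow> \<beta> \<in> bidx W \<Longrightarrow> theta \<alpha> \<beta> x = theta \<alpha> \<beta> y"
  shows "x = y"
proof -
  have "x - y \<in> car (ker_mult H)" using assms subsetD[OF Omega1_quot(2)] by (blast intro: vspace_diff[OF vspace_ker_mult])
  then have "x - y \<in> Omega1_rel H (QH H W)" using assms(3) by (simp add: Omega1_rel_iff lin_diff[OF lin_theta])
  then have "cls1 H (QH H W) x = cls1 H (QH H W) y" using cls_eq_iff[OF vector_space_pscale subspace_Omega1_rel] by blast
  then show ?thesis using assms by (simp add: Omega1_quot(4))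
qed

text \<open>Left multiplication acts on the first tensor factor, which both \<open>mu\<close> and
  \<open>theta\<close> carry out on the left.\<close>

lemma lact:
  assumes t: "t \<in> car (Omega1 H (QH H W))"
  shows lact_in: "lact H (QH H W) h t \<in> car (Omega1 H (QH H W))"
    and theta_lact: "\<alpha> \<in> bidx W \<Longrightarrow> \<beta> \<in> bidx W \<Longrightarrow> theta \<alpha> \<beta> (lact H (QH H W) h t) = h * theta \<alpha> \<beta> t"
proof -
  let ?L = "lin_ext pscale (\<lambda>a b. htens H (h * a) b)"
  have tk: "t \<in> car (hh H)" "mu t = 0" using subsetD[OF Omega1_quot(2) t] by (simp_all add: in_ker_mult)
  have lL: "lin pscale pscale ?L" by (rule linear_lin_ext[OF vector_space_pscale])
  have Lt: "?L (htens H a b) = htens H (h * a) b" for a b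
    by (rule lin_ext_htens[OF vector_space_pscale]) (intro lin_intros)+
  have lh: "lin (hscale H) (hscale H) (\<lambda>x. h * x)" by (intro lin_intros)
  have "mu (?L t) = h * mu t"
    by (rule hh_eqI[OF tk(1) lin_compose[OF lL lin_mu] lin_compose[OF lin_mu lh]]) (simp only: Lt mu_htens mult.assoc)
  then have "?L t \<in> car (ker_mult H)" by (simp add: in_ker_mult tk lin_ext_hh_in htens_in)
  then show "lact H (QH H W) h t \<in> car (Omega1 H (QH H W))" unfolding lact_def by (rule Omega1_quot(3))
  have "theta \<alpha> \<beta> (?L t) = h * theta \<alpha> \<beta> t"
    by (rule hh_eqI[OF tk(1) lin_compose[OF lL lin_theta] lin_compose[OF lin_theta lh]])
      (simp only: Lt theta_htens sw_of_lin[OF lh] hscale_mult mult.assoc)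
  then show "\<alpha> \<in> bidx W \<Longrightarrow> \<beta> \<in> bidx W \<Longrightarrow> theta \<alpha> \<beta> (lact H (QH H W) h t) = h * theta \<alpha> \<beta> t"
    by (simp add: lact_def theta_cls1)
qed

lemma lin_lact: "lin pscale pscale (lact H (QH H W) h)"
  and lin_lact_left: "lin (hscale H) pscale (\<lambda>h. lact H (QH H W) h t)"
proof -
  note l = lin_cls[OF vector_space_pscale subspace_Omega1_rel[of "QH H W"]]
  show "lin pscale pscale (lact H (QH H W) h)" "lin (hscale H) pscale (\<lambda>h. lact H (QH H W) h t)"
    unfolding lact_def by (rule lin_compose[OF _ l], intro lin_intros)+
qed

text \<open>On \<open>x \<otimes> y h\<close> the component is \<open>x y1 h1\<close> times an entry
  of \<open>\<rho>_W \<Q>(y2 h2)\<close>. \<open>Qmap_mult\<close> separates \<open>y2\<close> from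
  \<open>h2\<close>: the part with \<open>y\<close> reassembles to \<open>theta d e\<close>, and the
  part with \<open>h\<close> is the bracket on the right.\<close>

lemma ract:
  assumes t: "t \<in> car (Omega1 H (QH H W))"
  shows ract_in: "ract H (QH H W) t h \<in> car (Omega1 H (QH H W))"
    and theta_ract: "\<alpha> \<in> bidx W \<Longrightarrow> \<beta> \<in> bidx W \<Longrightarrow> theta \<alpha> \<beta> (ract H (QH H W) t h)
      = (\<Sum>d\<in>bidx W. \<Sum>e\<in>bidx W. theta d e t * sw H (hscale H) (\<lambda>h1 h'. hscale H
          (sw H (*) (\<lambda>g1 g2. rform H (bmat W \<alpha> d) g1 * rform H g2 (bmat W e \<beta>)) h') h1) h)"
proof -
  interpret V: vector_space "hscale H" by (rule vs)
  let ?L = "lin_ext pscale (\<lambda>a b. htens H a (b * h))"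
  have tk: "t \<in> car (hh H)" "mu t = 0" using subsetD[OF Omega1_quot(2) t] by (simp_all add: in_ker_mult)
  have lL: "lin pscale pscale ?L" by (rule linear_lin_ext[OF vector_space_pscale])
  have Lt: "?L (htens H a b) = htens H a (b * h)" for a b
    by (rule lin_ext_htens[OF vector_space_pscale]) (intro lin_intros)+
  have rh: "lin (hscale H) (hscale H) (\<lambda>x. x * c)" for c by (intro lin_intros)
  have lh: "lin (hscale H) (hscale H) (\<lambda>x. c * x)" for c by (intro lin_intros)
  have "mu (?L t) = mu t * h"
    by (rule hh_eqI[OF tk(1) lin_compose[OF lL lin_mu] lin_compose[OF lin_mu rh]]) (simp only: Lt mu_htens mult.assoc)
  then have "?L t \<in> car (ker_mult H)" by (simp add: in_ker_mult tk lin_ext_hh_in htens_in)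
  then show "ract H (QH H W) t h \<in> car (Omega1 H (QH H W))" unfolding ract_def by (rule Omega1_quot(3))
  assume ab: "\<alpha> \<in> bidx W" "\<beta> \<in> bidx W"
  let ?k = "\<lambda>d e. sw H (*) (\<lambda>g1 g2. rform H (bmat W \<alpha> d) g1 * rform H g2 (bmat W e \<beta>))"
  let ?K = "\<lambda>d e. sw H (hscale H) (\<lambda>h1 h'. hscale H (?k d e h') h1) h"
  have "theta \<alpha> \<beta> (?L t) = (\<Sum>d\<in>bidx W. \<Sum>e\<in>bidx W. theta d e t * ?K d e)"
  proof (rule hh_eqI[OF tk(1) lin_compose[OF lL lin_theta]])
    show "lin pscale (hscale H) (\<lambda>t. \<Sum>d\<in>bidx W. \<Sum>e\<in>bidx W. theta d e t * ?K d e)"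
      by (intro lin_fsum lin_mult_right lin_theta vs vector_space_pscale)
    fix x y
    have "theta \<alpha> \<beta> (?L (htens H x y)) = sw H (hscale H) (\<lambda>y1 y2. sw H (hscale H) (\<lambda>h1 h'.
        hscale H (Qmap H (y2 * h') (bmat W \<alpha> \<beta>)) (x * (y1 * h1))) h) y"
      unfolding Lt theta_htens by (rule sw_mult[OF vs]) (intro lin_intros_Q)+
    also have "\<dots> = sw H (hscale H) (\<lambda>y1 y2. sw H (hscale H) (\<lambda>h1 h'. \<Sum>d\<in>bidx W. \<Sum>e\<in>bidx W.
        hscale H (Qmap H y2 (bmat W d e)) (x * y1) * hscale H (?k d e h') h1) h) y"
      by (simp only: Qmap_mult ab V.scale_sum_left hscale_mult V.scale_scale mult.assoc mult.commute[of "Qmap H _ _"])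
    also have "\<dots> = (\<Sum>d\<in>bidx W. \<Sum>e\<in>bidx W. sw H (hscale H) (\<lambda>y1 y2. sw H (hscale H) (\<lambda>h1 h'.
        hscale H (Qmap H y2 (bmat W d e)) (x * y1) * hscale H (?k d e h') h1) h) y)"
      by (simp only: sw_fsum[OF vs])
    also have "\<dots> = (\<Sum>d\<in>bidx W. \<Sum>e\<in>bidx W. theta d e (htens H x y) * ?K d e)"
      unfolding theta_htens by (simp only: sw_of_lin[OF lh, symmetric] sw_of_lin[OF rh, symmetric])
    finally show "theta \<alpha> \<beta> (?L (htens H x y)) = (\<Sum>d\<in>bidx W. \<Sum>e\<in>bidx W. theta d e (htens H x y) * ?K d e)" .
  qed
  then show "theta \<alpha> \<beta> (ract H (QH H W) t h) = (\<Sum>d\<in>bidx W. \<Sum>e\<in>bidx W. theta d e t * ?K d e)"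
    by (simp add: ract_def theta_cls1 ab)
qed

text \<open>In \<open>S(v1) v2 \<Q>(v3)\<close> the first two factors cancel, so a Maurer-Cartan
  form has constant components, the matrix entries of \<open>\<rho>_W \<Q>(v)\<close>. The same
  cancellation with \<open>\<epsilon>(v) = 0\<close> puts its representative into the kernel of
  \<open>mu\<close>.\<close>

lemma e_MC:
  assumes v: "counit H v = 0"
  shows e_MC_in: "e_MC H (QH H W) v \<in> car (Omega1 H (QH H W))"
    and theta_e_MC: "\<alpha> \<in> bidx W \<Longrightarrow> \<beta> \<in> bidx W \<Longrightarrow> theta \<alpha> \<beta> (e_MC H (QH H W) v) = hscale H (Qmap H v (bmat W \<alpha> \<beta>)) 1"
proof -
  interpret V: vector_space "hscale H" by (rule vs)
  let ?t = "sw H pscale (\<lambda>v1 v2. htens H (antipode H v1) v2) v"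
  have "mu ?t = 0" by (simp add: sw_of_lin[OF lin_mu] mu_htens antipode_left v)
  then have "?t \<in> car (ker_mult H)" by (simp add: in_ker_mult sw_hh_in htens_in)
  then show "e_MC H (QH H W) v \<in> car (Omega1 H (QH H W))" unfolding e_MC_def by (rule Omega1_quot(3))
  assume ab: "\<alpha> \<in> bidx W" "\<beta> \<in> bidx W"
  have "theta \<alpha> \<beta> ?t = sw H (hscale H) (\<lambda>x y. sw H (hscale H) (\<lambda>y1 y2. hscale H (Qmap H y2 (bmat W \<alpha> \<beta>)) (antipode H x * y1)) y) v"
    by (simp only: sw_of_lin[OF lin_theta] theta_htens)
  also have "\<dots> = sw H (hscale H) (\<lambda>x y. sw H (hscale H) (\<lambda>x1 x2. hscale H (Qmap H y (bmat W \<alpha> \<beta>)) (antipode H x1 * x2)) x) v"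
    by (rule sw_assoc[OF vs, symmetric]) (intro lin_intros_Q)+
  also have "\<dots> = sw H (hscale H) (\<lambda>x y. hscale H (counit H x) (hscale H (Qmap H y (bmat W \<alpha> \<beta>)) 1)) v"
    by (intro sw_cong sw_antipode_left lin_intros_Q)
  also have "\<dots> = hscale H (Qmap H v (bmat W \<alpha> \<beta>)) 1"
    by (rule sw_counit_left) (intro lin_intros_Q)
  finally show "theta \<alpha> \<beta> (e_MC H (QH H W) v) = hscale H (Qmap H v (bmat W \<alpha> \<beta>)) 1"
    by (simp add: e_MC_def theta_cls1 ab)
qed

lemma vbein:
  assumes "\<phi> \<in> car (End W)"
  shows vbein_in: "vbein H W \<phi> \<in> car (Omega1 H (QH H W))"
    and theta_vbein: "\<alpha> \<in> bidx W \<Longrightarrow> \<beta> \<in> bidx W \<Longrightarrow> theta \<alpha> \<beta> (vbein H W \<phi>) = hscale H (entry W \<phi> \<alpha> \<beta>) 1"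
  using e_MC[OF counit_lift[OF assms]] rho_Q_lift[OF assms]
  by (simp_all add: vbein_def lift_def entry_rho_Q[symmetric])

text \<open>The part \<open>1 \<otimes> h\<close> contributes \<open>h1 \<Q>(h2)\<close>, and the
  part \<open>h \<otimes> 1\<close> contributes \<open>h\<close> times
  \<open>\<rho>_W \<Q>(1) = id\<close>.\<close>

lemma extd:
  shows extd_in: "extd H (QH H W) h \<in> car (Omega1 H (QH H W))"
    and theta_extd: "\<alpha> \<in> bidx W \<Longrightarrow> \<beta> \<in> bidx W \<Longrightarrow> theta \<alpha> \<beta> (extd H (QH H W) h)
      = sw H (hscale H) (\<lambda>h1 h2. hscale H (Qmap H h2 (bmat W \<alpha> \<beta>)) h1) h - (if \<alpha> = \<beta> then h else 0)"
proof -
  let ?t = "htens H 1 h - htens H h 1"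
  have "?t \<in> car (ker_mult H)"
    by (simp add: in_ker_mult vspace_diff[OF vspace_hh] htens_in lin_diff[OF lin_mu] mu_htens)
  then show "extd H (QH H W) h \<in> car (Omega1 H (QH H W))" unfolding extd_def by (rule Omega1_quot(3))
  assume ab: "\<alpha> \<in> bidx W" "\<beta> \<in> bidx W"
  have "sw H (hscale H) (\<lambda>y1 y2. hscale H (Qmap H y2 (bmat W \<alpha> \<beta>)) (h * y1)) 1 = hscale H (Qmap H 1 (bmat W \<alpha> \<beta>)) (h * 1)"
    by (rule sw_one) (intro lin_intros_Q)+
  then show "theta \<alpha> \<beta> (extd H (QH H W) h)
      = sw H (hscale H) (\<lambda>h1 h2. hscale H (Qmap H h2 (bmat W \<alpha> \<beta>)) h1) h - (if \<alpha> = \<beta> then h else 0)"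
    by (simp add: extd_def theta_cls1 ab lin_diff[OF lin_theta] theta_htens Qmap_one scale_if[OF vs])
qed

lemma lin_extd: "lin (hscale H) pscale (extd H (QH H W))"
proof -
  note l = lin_cls[OF vector_space_pscale subspace_Omega1_rel[of "QH H W"]]
  show ?thesis unfolding extd_def by (rule lin_compose[OF _ l]) (intro lin_intros)
qed

text \<open>The components of \<open>vbein H W \<phi>\<close> are the entries of
  \<open>\<phi>\<close>, which are linear in \<open>\<phi>\<close>. Comparing components yields
  linearity without a detour through the inverse map \<open>lift\<close>.\<close>

lemma vlin_vbein: "vlin (End W) (Omega1 H (QH H W)) (vbein H W)"
proof -
  interpret V: vector_space "hscale H" by (rule vs)
  show ?thesis
    unfolding vlin_def
  proof (intro conjI ballI allI)
    show "vbein H W ` car (End W) \<subseteq> car (Omega1 H (QH H W))" by (auto simp: vbein_in)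
    show "vbein H W (x + y) = vbein H W x + vbein H W y" if "x \<in> car (End W)" "y \<in> car (End W)" for x y
      using that by (intro Omega1_eqI)
        (simp_all add: vbein_in vspace_add[OF vspace_End] vspace_add[OF Omega1_quot(1)] theta_vbein lin_add[OF lin_theta]
          lin_add[OF lin_dvec] V.scale_left_distrib)
    show "vbein H W (scl (End W) c x) = scl (Omega1 H (QH H W)) c (vbein H W x)" if "x \<in> car (End W)" for c x
      using that by (intro Omega1_eqI)
        (simp_all add: vbein_in vspace_scl[OF vspace_End] vspace_scl[OF Omega1_quot(1), unfolded scl_Omega1] theta_vbein lin_scale[OF lin_theta]
          lin_scale[OF lin_dvec] End_scale)
  qed
qed

lemma lact_vbein_in: "\<phi> \<in> car (End W) \<Longrightarrow> lact H (QH H W) h (vbein H W \<phi>) \<in> car (Omega1 H (QH H W))"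
  and theta_lact_vbein: "\<phi> \<in> car (End W) \<Longrightarrow> \<alpha> \<in> bidx W \<Longrightarrow> \<beta> \<in> bidx W \<Longrightarrow>
    theta \<alpha> \<beta> (lact H (QH H W) h (vbein H W \<phi>)) = hscale H (entry W \<phi> \<alpha> \<beta>) h"
  by (simp_all add: lact_in theta_lact vbein_in theta_vbein hscale_mult)

text \<open>On matrix units the components are Kronecker deltas, so \<open>theta\<close> recovers
  the coefficients. This serves both the inverse of the framing map and the uniqueness demanded by
  \<open>comps\<close>.\<close>

lemma theta_basis_sum:
  assumes "\<alpha> \<in> bidx W" "\<beta> \<in> bidx W"
  shows "theta \<alpha> \<beta> (\<Sum>p\<in>bidx W \<times> bidx W. lact H (QH H W) (c p) (vbein H W (unit_op W p))) = c (\<alpha>, \<beta>)"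
proof -
  interpret V: vector_space "hscale H" by (rule vs)
  have "theta \<alpha> \<beta> (\<Sum>p\<in>bidx W \<times> bidx W. lact H (QH H W) (c p) (vbein H W (unit_op W p)))
     = (\<Sum>p\<in>bidx W \<times> bidx W. if p = (\<alpha>, \<beta>) then c p else 0)"
    unfolding lin_sum[OF lin_theta]
    by (intro sum.cong refl) (auto simp: theta_lact_vbein unit_op_in assms entry_unit_op split: if_splits)
  then show ?thesis using assms finite_basis by simp
qed

lemma basis_sum_in: "(\<Sum>p\<in>I. lact H (QH H W) (c p) (vbein H W (unit_op W p))) \<in> car (Omega1 H (QH H W))"
  by (intro vspace_sum[OF Omega1_quot(1)] lact_vbein_in unit_op_in)

lemma framed_End: "framed H (QH H W) (End W) (End_coact H W) (rho_Q H W) (vbein H W)"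
  unfolding framed_def
proof (intro conjI right_comodule_End comodule_map_rho_Q vlin_vbein)
  let ?F = "\<lambda>h v. lact H (QH H W) h (vbein H W v)" and ?O = "Omega1 H (QH H W)" and ?t = "tens (hvs H) (End W)"
  let ?L = "lin_ext pscale ?F"
  have bF: "bilin (hvs H) (End W) ?O ?F"
    unfolding bilin_def
  proof (intro conjI ballI)
    show "vlin (End W) ?O (?F h)" for h
      using vlin_vbein by (auto simp: vlin_def lact_in lin_add[OF lin_lact] lin_scale[OF lin_lact])
    show "vlin (hvs H) ?O (\<lambda>h. ?F h v)" if "v \<in> car (End W)" for v
      by (rule vlin_lin) (auto simp: lin_lact_left lact_vbein_in that)
  qed
  have bF': "bilin (hvs H) (End W) (uvs pscale) ?F"
    using bF by (simp add: bilin_def vlin_def)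
  have vL: "vlin (tprod (hvs H) (End W)) ?O ?L"
    using lin_ext_vlin[OF Omega1_quot(1) bF vspace_hvs vspace_End] by simp
  have Lt: "?L (?t h v) = ?F h v" for h v
    by (rule lin_ext_eval_bilin[OF vspace_hvs vspace_End vector_space_pscale bF'])
  have lL: "lin pscale pscale ?L" by (rule linear_lin_ext[OF vector_space_pscale])
  \<comment> \<open>The inverse of the framing map: the components of \<open>\<omega>\<close>,
    tensored with the matrix units.\<close>
  define g where "g \<omega> = (\<Sum>p\<in>bidx W \<times> bidx W. ?t (theta (fst p) (snd p) \<omega>) (unit_op W p))" for \<omega>
  note tl = tens_lin_left[OF vspace_hvs vspace_End car_hvs, unfolded scl_hvs]
  have lg: "lin pscale pscale g"
    unfolding g_def by (intro lin_fsum lin_compose[OF lin_theta tl] unit_op_in vector_space_pscale)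
  have gin: "g \<omega> \<in> car (tprod (hvs H) (End W))" for \<omega>
    unfolding g_def by (intro vspace_sum[OF vspace_tprod] tens_in[OF vspace_hvs vspace_End] unit_op_in) simp
  have Lg: "?L (g \<omega>) = \<omega>" if "\<omega> \<in> car ?O" for \<omega>
    unfolding g_def lin_sum[OF lL] Lt
    by (rule Omega1_eqI[OF basis_sum_in that]) (simp add: theta_basis_sum)
  have gL: "g (?L t) = t" if "t \<in> car (tprod (hvs H) (End W))" for t
  proof (rule tprod_eqI[OF vspace_hvs vspace_End that lin_compose[OF lL lg] lin_id[OF vector_space_pscale]])
    fix h v assume v: "v \<in> car (End W)"
    have "g (?L (?t h v)) = (\<Sum>p\<in>bidx W \<times> bidx W. ?t (hscale H (entry W v (fst p) (snd p)) h) (unit_op W p))"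
      unfolding g_def Lt by (intro sum.cong refl) (auto simp: theta_lact_vbein v)
    \<comment> \<open>The scalar entries pass from \<open>H\<close> to \<open>End W\<close>, where
      the matrix units recombine to \<open>v\<close>.\<close>
    also have "\<dots> = (\<Sum>p\<in>bidx W \<times> bidx W. ?t h (scl (End W) (entry W v (fst p) (snd p)) (unit_op W p)))"
      by (intro sum.cong refl)
        (simp add: tens_scale_left[OF vspace_hvs vspace_End, unfolded scl_hvs] tens_scale_right[OF vspace_hvs vspace_End] unit_op_in)
    also have "\<dots> = ?t h (mat_op W (entry W v))"
      by (simp add: mat_op_def sum.cartesian_product split_def tens_sum_right[OF vspace_hvs vspace_End] vspace_scl[OF vspace_End] unit_op_in)
    finally show "g (?L (?t h v)) = ?t h v" by (simp only: End_expand[OF v, symmetric])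
  qed
  show "viso (tprod (hvs H) (End W)) ?O ?L"
    unfolding viso_def
    by (intro conjI vL bij_betw_byWitness[where f'=g]) (use vL in \<open>auto simp: Lg gL gin vlin_def\<close>)
qed

lemma comps_W_eq:
  assumes "\<omega> \<in> car (Omega1 H (QH H W))" "\<alpha> \<in> bidx W" "\<beta> \<in> bidx W"
  shows "comps_W H W \<omega> (\<alpha>, \<beta>) = theta \<alpha> \<beta> \<omega>"
proof -
  \<comment> \<open>The value \<open>0\<close> off the index set is the convention under which
    \<open>comps\<close> describes a unique function.\<close>
  let ?c = "\<lambda>p. if p \<in> bidx W \<times> bidx W then theta (fst p) (snd p) \<omega> else 0"
  have "comps_W H W \<omega> = ?c"
    unfolding comps_def
  proof (rule the_equality, intro conjI allI impI)
    show "\<omega> = (\<Sum>a\<in>bidx W \<times> bidx W. lact H (QH H W) (?c a) (vbein H W (unit_op W a)))"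
      by (rule Omega1_eqI[OF assms(1) basis_sum_in], subst theta_basis_sum) simp_all
    fix c assume c: "(\<forall>a. a \<notin> bidx W \<times> bidx W \<longrightarrow> c a = 0) \<and> \<omega> = (\<Sum>a\<in>bidx W \<times> bidx W. lact H (QH H W) (c a) (vbein H W (unit_op W a)))"
    show "c = ?c"
    proof
      fix p :: "'i \<times> 'i"
      obtain a b where p: "p = (a, b)" by (cases p)
      show "c p = ?c p"
      proof (cases "p \<in> bidx W \<times> bidx W")
        case True
        then have "theta a b \<omega> = c (a, b)" using c theta_basis_sum[of a b c] by (simp add: p)
        then show ?thesis using True by (simp add: p)
      next
        case False
        with c have "c p = 0" by blast
        then show ?thesis using False by (simp only: if_False)
      qed
    qed
  qed simp
  then show ?thesis using assms by simp
qed

lemma sw_Omega1_in: "(\<And>a b. f a b \<in> car (Omega1 H (QH H W))) \<Longrightarrow> sw H pscale f h \<in> car (Omega1 H (QH H W))"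
  unfolding sw_def using lin_ext_in[OF Omega1_quot(1)[of "QH H W"], of f] by simp

lemma extd_eq:
  "extd H (QH H W) h = sw H pscale (\<lambda>h1 h2. lact H (QH H W) h1 (vbein H W (rho_Q H W h2))) h - lact H (QH H W) h (vbein H W id)"
proof (rule Omega1_eqI[OF extd_in])
  show "sw H pscale (\<lambda>h1 h2. lact H (QH H W) h1 (vbein H W (rho_Q H W h2))) h - lact H (QH H W) h (vbein H W id) \<in> car (Omega1 H (QH H W))"
    by (intro vspace_diff[OF Omega1_quot(1)] sw_Omega1_in lact_vbein_in rho_Q_in id_in_End)
qed (simp only: theta_extd lin_diff[OF lin_theta] sw_of_lin[OF lin_theta] theta_lact_vbein rho_Q_in id_in_End
    entry_rho_Q id_apply dvec_basis scale_if[OF vs])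

text \<open>By \<open>rform_inv_antipode\<close>, \<open>\<rho>_-(S h2)\<close> has the entries
  \<open>\<R>(\<rho> \<otimes> h2)\<close>. The sandwiched operator then has exactly the
  coefficients that appear in \<open>theta_ract\<close>.\<close>

lemma ract_vbein:
  assumes \<phi>: "\<phi> \<in> car (End W)"
  shows "ract H (QH H W) (vbein H W \<phi>) h =
    sw3 H pscale (\<lambda>h1 h2 h3. lact H (QH H W) h1 (vbein H W (rho_minus H W (antipode H h2) \<circ> \<phi> \<circ> rho_plus H W h3))) h"
proof (rule Omega1_eqI[OF ract_in[OF vbein_in[OF \<phi>]]])
  let ?m = "\<lambda>h2 h3. rho_minus H W (antipode H h2) \<circ> \<phi> \<circ> rho_plus H W h3"
  have mi: "rho_minus H W x \<in> car (End W)" "rho_plus H W x \<in> car (End W)" for x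
    by (simp_all add: rho_minus_def rho_plus_def mat_op_in)
  then have m: "?m h2 h3 \<in> car (End W)" for h2 h3 by (intro comp_in_End \<phi>)
  show "sw3 H pscale (\<lambda>h1 h2 h3. lact H (QH H W) h1 (vbein H W (?m h2 h3))) h \<in> car (Omega1 H (QH H W))"
    unfolding sw3_def by (intro sw_Omega1_in lact_vbein_in m)
  fix \<alpha> \<beta> assume ab: "\<alpha> \<in> bidx W" "\<beta> \<in> bidx W"
  interpret V: vector_space "hscale H" by (rule vs)
  let ?R = "\<lambda>d e h2 h3. rform H (bmat W \<alpha> d) h2 * rform H h3 (bmat W e \<beta>)"
  note k = vector_space_mult[where 'k='k]
  have em: "entry W (?m h2 h3) \<alpha> \<beta> = (\<Sum>d\<in>bidx W. \<Sum>e\<in>bidx W. entry W \<phi> d e * ?R d e h2 h3)" for h2 h3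
  proof -
    have "entry W (?m h2 h3) \<alpha> \<beta> = (\<Sum>e\<in>bidx W. (\<Sum>d\<in>bidx W. rform_inv H (bmat W \<alpha> d) (antipode H h2) * entry W \<phi> d e) * rform H h3 (bmat W e \<beta>))"
      using ab by (subst entry_comp[OF comp_in_End[OF mi(1) \<phi>]], subst entry_comp[OF mi(1)])
        (simp add: rho_minus_def rho_plus_def entry_mat_op cong: sum.cong)
    also have "\<dots> = (\<Sum>e\<in>bidx W. \<Sum>d\<in>bidx W. entry W \<phi> d e * ?R d e h2 h3)"
      by (rule sum.cong[OF refl], unfold sum_distrib_right, rule sum.cong[OF refl]) (simp add: rform_inv_antipode ab)
    finally show ?thesis by (subst sum.swap)
  qed
  have vl: "lin (*) (hscale H) (\<lambda>c. hscale H c x)" for x by (intro lin_vec lin_id k vs)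
  have "theta \<alpha> \<beta> (sw3 H pscale (\<lambda>h1 h2 h3. lact H (QH H W) h1 (vbein H W (?m h2 h3))) h)
     = sw3 H (hscale H) (\<lambda>h1 h2 h3. \<Sum>d\<in>bidx W. \<Sum>e\<in>bidx W. hscale H (entry W \<phi> d e) (hscale H (?R d e h2 h3) h1)) h"
    by (simp only: sw3_of_lin[OF lin_theta] theta_lact_vbein m ab em V.scale_sum_left V.scale_scale)
  also have "\<dots> = (\<Sum>d\<in>bidx W. \<Sum>e\<in>bidx W. hscale H (entry W \<phi> d e) (sw3 H (hscale H) (\<lambda>h1 h2 h3. hscale H (?R d e h2 h3) h1) h))"
    by (simp only: sw3_fsum[OF vs] sw3_of_lin[OF lin_fscale[OF lin_id[OF vs]]])
  also have "\<dots> = theta \<alpha> \<beta> (ract H (QH H W) (vbein H W \<phi>) h)"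
    by (simp add: theta_ract vbein_in \<phi> ab theta_vbein hscale_mult sw3_def sw_of_lin[OF vl])
  finally show "theta \<alpha> \<beta> (ract H (QH H W) (vbein H W \<phi>) h)
     = theta \<alpha> \<beta> (sw3 H pscale (\<lambda>h1 h2 h3. lact H (QH H W) h1 (vbein H W (?m h2 h3))) h)" ..
qed

end

section \<open>The Dirac operator\<close>

lemma lin_inv:
  assumes "lin s s f" "bij f"
  shows "lin s s (inv f)"
proof -
  have i: "f (inv f x) = x" "inv f (f x) = x" for x
    using assms(2) by (simp_all add: bij_is_surj surj_f_inv_f bij_is_inj)
  have "inv f (x + y) = inv f x + inv f y" for x y
    by (metis i lin_add[OF assms(1)])
  moreover have "inv f (s c x) = s c (inv f x)" for c x
    by (metis i lin_scale[OF assms(1)])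
  ultimately show ?thesis using assms(1) by (simp add: lin_iff)
qed

context comodule_calculus
begin

text \<open>It suffices to treat \<open>h \<otimes> e_\<gamma>\<close>. In the derivative term the
  matrix unit \<open>(\<alpha>, \<beta>)\<close> survives only for
  \<open>\<beta> = \<gamma>\<close>. In the gauge term the coaction spreads
  \<open>e_\<gamma>\<close> over \<open>e_\<delta> \<otimes> \<rho>^\<delta>_\<gamma>\<close>, and
  the matrix unit selects \<open>\<delta> = \<beta>\<close>.\<close>

lemma dirac_W_eq:
  assumes S: "bij (antipode H)" and A: "gauge_field H (QH H W) A"
  shows "dirac_W H W A (\<Sum>\<alpha>\<in>bidx W. tens (hvs H) (wvs W) (\<psi> \<alpha>) (bvec W \<alpha>)) =
           (\<Sum>\<alpha>\<in>bidx W. tens (hvs H) (wvs W)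
              ((\<Sum>\<beta>\<in>bidx W. partial_W H W (\<alpha>, \<beta>) (\<psi> \<beta>))
               - (\<Sum>\<beta>\<in>bidx W. \<Sum>\<gamma>\<in>bidx W. \<psi> \<gamma> *
                    comps_W H W (A (pi_tilde H (QH H W) (inv (antipode H) (bmat W \<beta> \<gamma>)))) (\<alpha>, \<beta>)))
              (bvec W \<alpha>))"
proof -
  let ?t = "tens (hvs H) (wvs W)" and ?I = "bidx W"
  let ?a = "\<lambda>w. A (pi_tilde H (QH H W) (inv (antipode H) w))"
  let ?d = "partial_W H W" and ?c = "\<lambda>p w. comps_W H W (?a w) p"
  have vA: "vlin (Omega0 H (QH H W)) (Omega1 H (QH H W)) A" using A by (simp add: gauge_field_def)
  note lS = lin_inv[OF lin_antipode[OF lin_id[OF vs]] S]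
  have ain: "?a w \<in> car (Omega1 H (QH H W))" for w
    using vA pi_tilde_in by (auto simp: vlin_def)
  \<comment> \<open>\<open>A\<close> is linear on \<open>\<Omega>_0\<close> only; composed with
    \<open>pi_tilde\<close> and the inverse antipode it is linear on all of
    \<open>H\<close>.\<close>
  have la: "lin (hscale H) pscale ?a"
    using vA pi_tilde_in by (simp add: lin_iff vlin_def vs vector_space_pscale lin_add[OF lin_pi_tilde[OF lS]] lin_scale[OF lin_pi_tilde[OF lS]])
  \<comment> \<open>\<open>comps\<close> is a definite description, which hides its linearity. For
    indices in the basis it is traded for \<open>theta\<close>, where linearity is known.\<close>
  have d: "?d p = (\<lambda>h. theta (fst p) (snd p) (extd H (QH H W) h))" if "p \<in> ?I \<times> ?I" for p
    using that by (auto simp: partial_def comps_W_eq extd_in)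
  have c: "?c p = (\<lambda>w. theta (fst p) (snd p) (?a w))" if "p \<in> ?I \<times> ?I" for p
    using that by (auto simp: comps_W_eq ain)
  have ld: "lin (hscale H) (hscale H) (?d p)" if "p \<in> ?I \<times> ?I" for p
    unfolding d[OF that] by (rule lin_compose[OF lin_extd lin_theta])
  have lc: "lin (hscale H) (hscale H) (?c p)" if "p \<in> ?I \<times> ?I" for p
    unfolding c[OF that] by (rule lin_compose[OF la lin_theta])
  have lu: "lin (bscale W) (bscale W) (unit_op W p)" for p
    using unit_op_in by (simp add: in_End)
  note tl = lin_compose[OF _ tens_lin_left[OF vspace_hvs vspace_wvs car_hvs, unfolded scl_hvs], simplified]
  note tr = lin_compose[OF _ tens_lin_right[OF vspace_hvs vspace_wvs car_wvs, unfolded scl_wvs], simplified]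
  let ?G = "\<lambda>p h w. ?t (?d p h) (unit_op W p w) - lin_ext pscale (\<lambda>w0 w1. ?t (h * ?c p w1) (unit_op W p w0)) (bcoact W w)"
  let ?F = "\<lambda>h w. \<Sum>p\<in>?I \<times> ?I. ?G p h w"
  have dirac: "dirac_W H W A = lin_ext pscale ?F"
    by (simp only: dirac_def eval_gamma_tens)
  have F: "lin_ext pscale ?F (?t h w) = ?F h w" for h w
  proof (rule lin_ext_eval[OF vspace_hvs vspace_wvs vector_space_pscale])
    show "lin (scl (wvs W)) pscale (?F h)" for h
      by (simp only: scl_wvs) (intro lin_fsum lin_fdiff tr lu lin_lin_ext lin_bcoact vs_W vector_space_pscale)
    show "lin (scl (hvs H)) pscale (\<lambda>h. ?F h w)" for w
      by (simp only: scl_hvs) (intro lin_fsum lin_fdiff tl ld lin_lin_ext_fun lin_mult_right lin_id vs vector_space_pscale)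
  qed
  have basis: "?F h (bvec W \<gamma>) = (\<Sum>\<alpha>\<in>?I. ?t (?d (\<alpha>, \<gamma>) h - (\<Sum>\<beta>\<in>?I. h * ?c (\<alpha>, \<beta>) (bmat W \<beta> \<gamma>))) (bvec W \<alpha>))"
    if g: "\<gamma> \<in> ?I" for h \<gamma>
  proof -
    have b: "lin_ext pscale (\<lambda>w0 w1. ?t (h * ?c p w1) (unit_op W p w0)) (bcoact W (bvec W \<gamma>))
        = (\<Sum>\<delta>\<in>?I. ?t (h * ?c p (bmat W \<delta> \<gamma>)) (unit_op W p (bvec W \<delta>)))" if "p \<in> ?I \<times> ?I" for p
      by (rule lin_ext_bcoact[OF vector_space_pscale tl tr g]) (intro lin_mult_left lc that lu)+
    have tm: "lin (hscale H) pscale (\<lambda>x. ?t x w)" for w by (rule tl[OF lin_id[OF vs]])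
    have "?F h (bvec W \<gamma>) = (\<Sum>\<alpha>\<in>?I. \<Sum>\<beta>\<in>?I. (if \<beta> = \<gamma> then ?t (?d (\<alpha>, \<beta>) h) (bvec W \<alpha>) else 0)
        - ?t (h * ?c (\<alpha>, \<beta>) (bmat W \<beta> \<gamma>)) (bvec W \<alpha>))"
      unfolding sum.cartesian_product
    proof (rule sum.cong[OF refl])
      fix p assume p: "p \<in> ?I \<times> ?I"
      then obtain \<alpha> \<beta> where ab: "p = (\<alpha>, \<beta>)" "\<alpha> \<in> ?I" "\<beta> \<in> ?I" by auto
      have z: "?t x 0 = 0" for x by (rule tens_zero_right[OF vspace_hvs vspace_wvs]) simp
      have "(\<Sum>\<delta>\<in>?I. ?t (h * ?c p (bmat W \<delta> \<gamma>)) (unit_op W p (bvec W \<delta>)))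
          = (\<Sum>\<delta>\<in>?I. if \<delta> = \<beta> then ?t (h * ?c p (bmat W \<delta> \<gamma>)) (bvec W \<alpha>) else 0)"
        by (intro sum.cong refl) (auto simp: ab unit_op_basis z)
      then have "lin_ext pscale (\<lambda>w0 w1. ?t (h * ?c p w1) (unit_op W p w0)) (bcoact W (bvec W \<gamma>)) = ?t (h * ?c p (bmat W \<beta> \<gamma>)) (bvec W \<alpha>)"
        unfolding b[OF p] using finite_basis ab by simp
      then show "?G p h (bvec W \<gamma>) = (case p of (\<alpha>, \<beta>) \<Rightarrow> (if \<beta> = \<gamma> then ?t (?d (\<alpha>, \<beta>) h) (bvec W \<alpha>) else 0)
        - ?t (h * ?c (\<alpha>, \<beta>) (bmat W \<beta> \<gamma>)) (bvec W \<alpha>))"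
        by (simp add: ab g unit_op_basis z)
    qed
    also have "\<dots> = (\<Sum>\<alpha>\<in>?I. ?t (?d (\<alpha>, \<gamma>) h - (\<Sum>\<beta>\<in>?I. h * ?c (\<alpha>, \<beta>) (bmat W \<beta> \<gamma>))) (bvec W \<alpha>))"
      using g finite_basis by (simp add: sum_subtractf lin_diff[OF tm] lin_sum[OF tm])
    finally show ?thesis .
  qed
  have tm: "lin (hscale H) pscale (\<lambda>x. ?t x w)" for w by (rule tl[OF lin_id[OF vs]])
  have "dirac_W H W A (\<Sum>\<gamma>\<in>?I. ?t (\<psi> \<gamma>) (bvec W \<gamma>)) = (\<Sum>\<gamma>\<in>?I. ?F (\<psi> \<gamma>) (bvec W \<gamma>))"
    unfolding dirac by (simp only: lin_sum[OF linear_lin_ext[OF vector_space_pscale]] F)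
  also have "\<dots> = (\<Sum>\<gamma>\<in>?I. \<Sum>\<alpha>\<in>?I. ?t (?d (\<alpha>, \<gamma>) (\<psi> \<gamma>) - (\<Sum>\<beta>\<in>?I. \<psi> \<gamma> * ?c (\<alpha>, \<beta>) (bmat W \<beta> \<gamma>))) (bvec W \<alpha>))"
    by (rule sum.cong[OF refl basis])
  also have "\<dots> = (\<Sum>\<alpha>\<in>?I. \<Sum>\<gamma>\<in>?I. ?t (?d (\<alpha>, \<gamma>) (\<psi> \<gamma>) - (\<Sum>\<beta>\<in>?I. \<psi> \<gamma> * ?c (\<alpha>, \<beta>) (bmat W \<beta> \<gamma>))) (bvec W \<alpha>))"
    by (rule sum.swap)
  also have "\<dots> = (\<Sum>\<alpha>\<in>?I. ?t ((\<Sum>\<gamma>\<in>?I. ?d (\<alpha>, \<gamma>) (\<psi> \<gamma>)) - (\<Sum>\<gamma>\<in>?I. \<Sum>\<beta>\<in>?I. \<psi> \<gamma> * ?c (\<alpha>, \<beta>) (bmat W \<beta> \<gamma>))) (bvec W \<alpha>))"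
    by (simp only: lin_sum[OF tm, symmetric] sum_subtractf)
  also have "\<dots> = (\<Sum>\<alpha>\<in>?I. ?t ((\<Sum>\<beta>\<in>?I. ?d (\<alpha>, \<beta>) (\<psi> \<beta>)) - (\<Sum>\<beta>\<in>?I. \<Sum>\<gamma>\<in>?I. \<psi> \<gamma> * ?c (\<alpha>, \<beta>) (bmat W \<beta> \<gamma>))) (bvec W \<alpha>))"
    by (subst (2) sum.swap) (rule refl)
  finally show ?thesis .
qed

end

theorem proposition4p6:
  fixes H :: "('k::field, 'h::ring_1) dqt_hopf"
    and W :: "('k, 'h, 'w::ab_group_add, 'i) based_comod"
  assumes dqt: "dual_quasitriangular H"
    and bij_antipode: "bij (antipode H)"
    and comod: "based_comodule H W"
    and surj: "rho_Q H W ` car (ker_eps H) = car (End W)"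
  shows "(viso (Omega0 H (QH H W)) (End W) (rho_Q H W))
    \<and> (viso (tprod (wvs W) (predual W)) (End W) (as_End W))
    \<and> (comodule_map H (tprod (wvs W) (predual W))
           (tens_coact H (wvs W) (bcoact W) (predual W) (predual_coact H W)) (End W) (End_coact H W) (as_End W))
    \<and> (framed H (QH H W) (End W) (End_coact H W) (rho_Q H W) (vbein H W))
    \<and> (\<forall>h. \<forall>\<phi>\<in>car (End W). ract H (QH H W) (vbein H W \<phi>) h =
           sw3 H pscale (\<lambda>h1 h2 h3.
             lact H (QH H W) h1 (vbein H W (rho_minus H W (antipode H h2) \<circ> \<phi> \<circ> rho_plus H W h3))) h)
    \<and> (\<forall>h. extd H (QH H W) h =
           sw H pscale (\<lambda>h1 h2. lact H (QH H W) h1 (vbein H W (rho_Q H W h2))) h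
           - lact H (QH H W) h (vbein H W id))
    \<and> (spinor_space H (End W) (End_coact H W) (wvs W) (bcoact W) (eval_gamma W))
    \<and> (\<forall>A. gauge_field H (QH H W) A \<longrightarrow> (\<forall>\<psi>.
           dirac_W H W A (\<Sum>\<alpha>\<in>bidx W. tens (hvs H) (wvs W) (\<psi> \<alpha>) (bvec W \<alpha>)) =
           (\<Sum>\<alpha>\<in>bidx W. tens (hvs H) (wvs W)
              ((\<Sum>\<beta>\<in>bidx W. partial_W H W (\<alpha>, \<beta>) (\<psi> \<beta>))
               - (\<Sum>\<beta>\<in>bidx W. \<Sum>\<gamma>\<in>bidx W. \<psi> \<gamma> *
                    comps_W H W (A (pi_tilde H (QH H W) (inv (antipode H) (bmat W \<beta> \<gamma>)))) (\<alpha>, \<beta>)))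
              (bvec W \<alpha>))))"
proof -
  interpret dual_quasitriangular H by (rule dqt)
  interpret based_comodule H W by (rule comod)
  interpret comodule_calculus H W by unfold_locales (rule surj)
  show ?thesis
    by (intro conjI allI ballI impI viso_rho_Q viso_as_End comodule_map_as_End framed_End ract_vbein extd_eq
        spinor_space_eval dirac_W_eq bij_antipode)
qed

end
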